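(* Let $N\ge 2$ and let $A$ be a Lie algebra of local vector fields in the plane $\mathbb{R}^2$ with Levi decomposition $A=S\oplus R$ ($S$ a Levi complement, $R$ the radical), where $S$ has a basis $X,Y,H$ with $[X,Y]=H$, $[H,X]=2X$, $[H,Y]=-2Y$, and where $R$, as a representation of $S$ under the adjoint action, is a sum of an irreducible $N$-dimensional representation and a $1$-dimensional representation. Let $V$ be a highest weight vector, relative to the subalgebra $\langle H,X\rangle$, of the $N$-dimensional component. Assume that $R$ is of rank $1$ and that the subalgebra $\langle X,V\rangle$ is of rank $2$. Then the canonical coordinates for $\langle X,V\rangle$, after an affine change of coordinates, give coordinates $(x,y)$ in which, for $N\ge 3$, the algebra $A$ coincides with the symmetry algebra of the equation $y^{(N)}=0$; and $y^{(N)}=0$ is the only hypersurface of the form $y^{(N)}=f(x,y,y',\dots,y^{(N-1)})$ which is invariant under $A$.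
   Context: All Lie algebras are real. The symbol $\oplus$ in a Levi decomposition denotes the direct sum of vector spaces. Vector fields are local, and coordinates are introduced locally near generic points. Rank: the rank of a Lie algebra of vector fields is the dimension of its generic orbit (equivalently, the dimension of the span of its values at a generic point). Highest weight vector relative to $\langle H,X\rangle$: a nonzero vector $V$ of the $N$-dimensional component with $[X,V]=0$ and which is an eigenvector of $\operatorname{ad} H$ (so $[H,V]=(N-1)V$). Canonical coordinates for $\langle X,V\rangle$: since $X,V$ commute and are pointwise linearly independent at generic points, there are local coordinates $(x,y)$ with $X=\partial_x$, $V=\partial_y$; these are called canonical coordinates. Symmetry algebra of $y^{(N)}=0$ for $N\ge 3$: the Lie algebra of point symmetries, which is $$\Big\langle \partial_x,\ \tfrac{x^2}{2}\partial_x+\tfrac{N-1}{2}xy\,\partial_y,\ x\partial_x+\tfrac{N-1}{2}y\,\partial_y\Big\rangle\oplus\big\langle \partial_y,\ x\partial_y,\dots,x^{N-1}\partial_y,\ y\partial_y\big\rangle .$$ Prolongation and invariance: for $Z=\xi(x,y)\partial_x+\eta(x,y)\partial_y$ the $N$-th prolongation on the space with coordinates $(x,y,y',\dots,y^{(N)})$ is $Z^{(N)}=\xi\partial_x+\eta\partial_y+\sum_{k=1}^N\eta^{(k)}\partial_{y^{(k)}}$, where $\eta^{(0)}=\eta$, $\eta^{(k)}=D\eta^{(k-1)}-y^{(k)}D\xi$ and $D=\partial_x+y'\partial_y+y''\partial_{y'}+\cdots$ is the total derivative. A hypersurface $y^{(N)}=f(x,y,y',\dots,y^{(N-1)})$ is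 invariant under $A$ if, for every $Z\in A$, $Z^{(N)}$ applied to $y^{(N)}-f$ vanishes on the hypersurface. *)

theory Defs
  imports "HOL-Analysis.Analysis" "HOL-Library.Function_Algebras"
begin

text \<open>Pointwise real vector space structure on functions, so that \<^const>\<open>span\<close>,
  \<^const>\<open>dim\<close> and \<^const>\<open>independent\<close> apply to sets of vector fields.\<close>

instantiation "fun" :: (type, real_vector) real_vector
begin

definition scaleR_fun :: "real \<Rightarrow> ('a \<Rightarrow> 'b) \<Rightarrow> 'a \<Rightarrow> 'b"
  where "scaleR_fun c f = (\<lambda>x. c *\<^sub>R f x)"

instance
  by standard (auto simp: scaleR_fun_def fun_eq_iff scaleR_add_right scaleR_add_left)

end

text \<open>\<open>C_k_on k U f\<close> is the usual recursive notion of k-fold continuous differentiability and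
  is meant for open \<open>U\<close>.\<close>

primrec C_k_on :: "nat \<Rightarrow> 'a::real_normed_vector set \<Rightarrow> ('a \<Rightarrow> 'b::real_normed_vector) \<Rightarrow> bool"
  where
    "C_k_on 0 U f \<longleftrightarrow> continuous_on U f"
  | "C_k_on (Suc k) U f \<longleftrightarrow>
      (\<forall>p\<in>U. f differentiable (at p)) \<and> (\<forall>v. C_k_on k U (\<lambda>p. frechet_derivative f (at p) v))"

definition smooth_on :: "'a::real_normed_vector set \<Rightarrow> ('a \<Rightarrow> 'b::real_normed_vector) \<Rightarrow> bool"
  where "smooth_on U f \<longleftrightarrow> (\<forall>k. C_k_on k U f)"

type_synonym vfield = "real \<times> real \<Rightarrow> real \<times> real"

text \<open>A vector field on \<open>U\<close> is normalised to be 0 outside \<open>U\<close>, so that fields which agree on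
  \<open>U\<close> are equal.\<close>

definition vfields :: "(real \<times> real) set \<Rightarrow> vfield set"
  where "vfields U = {Z. smooth_on U Z \<and> (\<forall>p. p \<notin> U \<longrightarrow> Z p = 0)}"

definition lie_bracket :: "(real \<times> real) set \<Rightarrow> vfield \<Rightarrow> vfield \<Rightarrow> vfield"
  where "lie_bracket U Z W = (\<lambda>p. if p \<in> U
     then frechet_derivative W (at p) (Z p) - frechet_derivative Z (at p) (W p) else 0)"

definition lie_subalgebra :: "(real \<times> real) set \<Rightarrow> vfield set \<Rightarrow> bool"
  where "lie_subalgebra U L \<longleftrightarrow>
     subspace L \<and> L \<subseteq> vfields U \<and> (\<forall>Z\<in>L. \<forall>W\<in>L. lie_bracket U Z W \<in> L)"

text \<open>A Lie algebra of local vector fields: an element is determined by its restriction to any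
  nonempty open subset of \<open>U\<close>, i.e. by its germ at any point. This is automatic for analytic
  fields on a connected domain. For smooth fields it has to be said, since otherwise the
  algebra of germs at a generic point may be a proper quotient of the algebra of fields on
  \<open>U\<close>.\<close>

definition local_lie_algebra :: "(real \<times> real) set \<Rightarrow> vfield set \<Rightarrow> bool"
  where "local_lie_algebra U A \<longleftrightarrow> lie_subalgebra U A \<and>
     (\<forall>Z\<in>A. \<forall>G. open G \<and> G \<noteq> {} \<and> G \<subseteq> U \<and> (\<forall>p\<in>G. Z p = 0) \<longrightarrow> Z = 0)"

definition lie_ideal :: "(real \<times> real) set \<Rightarrow> vfield set \<Rightarrow> vfield set \<Rightarrow> bool"
  where "lie_ideal U A I \<longleftrightarrow> subspace I \<and> I \<subseteq> A \<and> (\<forall>Z\<in>A. \<forall>W\<in>I. lie_bracket U Z W \<in> I)"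

definition derived_algebra :: "(real \<times> real) set \<Rightarrow> vfield set \<Rightarrow> vfield set"
  where "derived_algebra U L = span {lie_bracket U Z W | Z W. Z \<in> L \<and> W \<in> L}"

definition solvable :: "(real \<times> real) set \<Rightarrow> vfield set \<Rightarrow> bool"
  where "solvable U L \<longleftrightarrow> (\<exists>n. (derived_algebra U ^^ n) L = {0})"

definition is_radical :: "(real \<times> real) set \<Rightarrow> vfield set \<Rightarrow> vfield set \<Rightarrow> bool"
  where "is_radical U A R \<longleftrightarrow> lie_ideal U A R \<and> solvable U R \<and>
     (\<forall>I. lie_ideal U A I \<and> solvable U I \<longrightarrow> I \<subseteq> R)"

definition direct_sum :: "vfield set \<Rightarrow> vfield set \<Rightarrow> vfield set \<Rightarrow> bool"
  where "direct_sum L L1 L2 \<longleftrightarrow> subspace L1 \<and> subspace L2 \<and>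
     L1 \<inter> L2 = {0} \<and> L = {Z + W | Z W. Z \<in> L1 \<and> W \<in> L2}"

definition levi_decomposition ::
    "(real \<times> real) set \<Rightarrow> vfield set \<Rightarrow> vfield set \<Rightarrow> vfield set \<Rightarrow> bool"
  where "levi_decomposition U A S R \<longleftrightarrow>
     is_radical U A R \<and> lie_subalgebra U S \<and> direct_sum A S R"

text \<open>Subrepresentations of the adjoint action of \<open>S\<close>.\<close>

definition ad_invariant :: "(real \<times> real) set \<Rightarrow> vfield set \<Rightarrow> vfield set \<Rightarrow> bool"
  where "ad_invariant U S W \<longleftrightarrow> subspace W \<and> (\<forall>Z\<in>S. \<forall>w\<in>W. lie_bracket U Z w \<in> W)"

definition ad_irreducible :: "(real \<times> real) set \<Rightarrow> vfield set \<Rightarrow> vfield set \<Rightarrow> bool"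
  where "ad_irreducible U S W \<longleftrightarrow> ad_invariant U S W \<and> W \<noteq> {0} \<and>
     (\<forall>W'. ad_invariant U S W' \<and> W' \<subseteq> W \<longrightarrow> W' = {0} \<or> W' = W)"

definition highest_weight_vector ::
    "(real \<times> real) set \<Rightarrow> vfield \<Rightarrow> vfield \<Rightarrow> vfield set \<Rightarrow> vfield \<Rightarrow> bool"
  where "highest_weight_vector U H X W V \<longleftrightarrow>
     V \<in> W \<and> V \<noteq> 0 \<and> lie_bracket U X V = 0 \<and> (\<exists>c. lie_bracket U H V = c *\<^sub>R V)"

definition has_rank :: "(real \<times> real) set \<Rightarrow> vfield set \<Rightarrow> nat \<Rightarrow> bool"
  where "has_rank U L r \<longleftrightarrow>
     (\<exists>G. open G \<and> G \<subseteq> U \<and> U \<subseteq> closure G \<and> (\<forall>p\<in>G. dim {Z p | Z. Z \<in> L} = r))"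

definition is_chart :: "(real \<times> real) set \<Rightarrow> vfield \<Rightarrow> bool"
  where "is_chart D \<phi> \<longleftrightarrow> open D \<and> connected D \<and> smooth_on D \<phi> \<and> inj_on \<phi> D \<and>
     open (\<phi> ` D) \<and> smooth_on (\<phi> ` D) (inv_into D \<phi>)"

text \<open>The expression of the restriction of \<open>Z\<close> to \<open>D\<close> in the coordinates \<open>\<phi>\<close>, as a
  vector field on \<open>\<phi> ` D\<close>.\<close>

definition pushforward :: "(real \<times> real) set \<Rightarrow> (real \<times> real \<Rightarrow> real \<times> real) \<Rightarrow> vfield \<Rightarrow> vfield"
  where "pushforward D \<phi> Z = (\<lambda>q. if q \<in> \<phi> ` D
     then frechet_derivative \<phi> (at (inv_into D \<phi> q)) (Z (inv_into D \<phi> q)) else 0)"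

definition canonical_coordinates ::
    "(real \<times> real) set \<Rightarrow> (real \<times> real \<Rightarrow> real \<times> real) \<Rightarrow> vfield \<Rightarrow> vfield \<Rightarrow> bool"
  where "canonical_coordinates D \<phi> X V \<longleftrightarrow> is_chart D \<phi> \<and>
     (\<forall>q\<in>\<phi> ` D. pushforward D \<phi> X q = (1, 0) \<and> pushforward D \<phi> V q = (0, 1))"

definition affine_change :: "(real \<times> real \<Rightarrow> real \<times> real) \<Rightarrow> bool"
  where "affine_change \<alpha> \<longleftrightarrow> (\<exists>l b. linear l \<and> bij l \<and> \<alpha> = (\<lambda>p. l p + b))"

text \<open>A jet is a pair \<open>(x, u)\<close> where \<open>u k\<close> is the coordinate \<open>y\<^sup>(\<^sup>k\<^sup>)\<close>; in particular
  \<open>u 0\<close> is \<open>y\<close>. A function on n-jets is a function of all jets which only depends on \<open>x\<close>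
  and \<open>u 0, \<dots>, u n\<close>.\<close>

type_synonym jet = "real \<times> (nat \<Rightarrow> real)"

definition jets_over :: "(real \<times> real) set \<Rightarrow> jet set"
  where "jets_over D = {(x, u). (x, u 0) \<in> D}"

definition pdx :: "(jet \<Rightarrow> real) \<Rightarrow> jet \<Rightarrow> real"
  where "pdx F = (\<lambda>(x, u). deriv (\<lambda>t. F (t, u)) x)"

definition pdu :: "nat \<Rightarrow> (jet \<Rightarrow> real) \<Rightarrow> jet \<Rightarrow> real"
  where "pdu k F = (\<lambda>(x, u). deriv (\<lambda>t. F (x, u(k := t))) (u k))"

primrec jet_C_k_on :: "nat \<Rightarrow> nat \<Rightarrow> jet set \<Rightarrow> (jet \<Rightarrow> real) \<Rightarrow> bool"
  where
    "jet_C_k_on N 0 \<Omega> F \<longleftrightarrow> continuous_on \<Omega> F"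
  | "jet_C_k_on N (Suc k) \<Omega> F \<longleftrightarrow> continuous_on \<Omega> F \<and>
      (\<forall>(x, u)\<in>\<Omega>. (\<lambda>t. F (t, u)) differentiable (at x) \<and>
         (\<forall>i<N. (\<lambda>t. F (x, u(i := t))) differentiable (at (u i)))) \<and>
      jet_C_k_on N k \<Omega> (pdx F) \<and> (\<forall>i<N. jet_C_k_on N k \<Omega> (pdu i F))"

text \<open>\<open>f\<close> is a smooth function of \<open>x, y, \<dots>, y\<^sup>(\<^sup>N\<^sup>-\<^sup>1\<^sup>)\<close> on an open set \<open>\<Omega>\<close> of (N-1)-jets
  over \<open>D\<close>. The subset of (N-1)-jet space is represented by its preimage among all jets.\<close>

definition hypersurface_fun ::
    "nat \<Rightarrow> (real \<times> real) set \<Rightarrow> jet set \<Rightarrow> (jet \<Rightarrow> real) \<Rightarrow> bool"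
  where "hypersurface_fun N D \<Omega> f \<longleftrightarrow> open \<Omega> \<and> \<Omega> \<subseteq> jets_over D \<and>
     (\<forall>x u v. (\<forall>k<N. u k = v k) \<and> (x, u) \<in> \<Omega> \<longrightarrow> (x, v) \<in> \<Omega> \<and> f (x, u) = f (x, v)) \<and>
     (\<forall>k. jet_C_k_on N k \<Omega> f)"

text \<open>The total derivative of a function on m-jets.\<close>

definition total_deriv :: "nat \<Rightarrow> (jet \<Rightarrow> real) \<Rightarrow> jet \<Rightarrow> real"
  where "total_deriv m F = (\<lambda>(x, u). pdx F (x, u) + (\<Sum>k\<le>m. u (Suc k) * pdu k F (x, u)))"

text \<open>The coefficients \<open>\<eta>\<^sup>(\<^sup>k\<^sup>)\<close> of the prolongation of \<open>Z = \<xi> \<partial>\<^sub>x + \<eta> \<partial>\<^sub>y\<close>.\<close>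

primrec prolong_coeff :: "vfield \<Rightarrow> nat \<Rightarrow> jet \<Rightarrow> real"
  where
    "prolong_coeff Z 0 = (\<lambda>(x, u). snd (Z (x, u 0)))"
  | "prolong_coeff Z (Suc k) = (\<lambda>(x, u). total_deriv k (prolong_coeff Z k) (x, u)
       - u (Suc k) * total_deriv 0 (\<lambda>(x, u). fst (Z (x, u 0))) (x, u))"

definition prolong :: "nat \<Rightarrow> vfield \<Rightarrow> (jet \<Rightarrow> real) \<Rightarrow> jet \<Rightarrow> real"
  where "prolong N Z F = (\<lambda>(x, u). fst (Z (x, u 0)) * pdx F (x, u)
     + (\<Sum>k\<le>N. prolong_coeff Z k (x, u) * pdu k F (x, u)))"

definition invariant_hypersurface ::
    "nat \<Rightarrow> jet set \<Rightarrow> (jet \<Rightarrow> real) \<Rightarrow> vfield set \<Rightarrow> bool"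
  where "invariant_hypersurface N \<Omega> f L \<longleftrightarrow> (\<forall>Z\<in>L. \<forall>(x, u)\<in>\<Omega>.
     u N = f (x, u) \<longrightarrow> prolong N Z (\<lambda>(x, u). u N - f (x, u)) (x, u) = 0)"

text \<open>The point symmetries on \<open>D\<close> of the equation \<open>y\<^sup>(\<^sup>N\<^sup>) = 0\<close>.\<close>

definition symmetry_algebra :: "nat \<Rightarrow> (real \<times> real) set \<Rightarrow> vfield set"
  where "symmetry_algebra N D =
     {Z \<in> vfields D. invariant_hypersurface N (jets_over D) (\<lambda>_. 0) {Z}}"

end

theory Submission
  imports Defs
begin

text \<open>Write \<open>c\<close> for the weight of \<open>V\<close>, so \<open>[H, V] = c V\<close>. In canonical coordinates \<open>X = \<partial>\<^sub>x\<close> and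
  \<open>V = \<partial>\<^sub>y\<close>, so \<open>ad X\<close> and \<open>ad V\<close> differentiate components, and each relation of the algebra becomes a
  differential equation for the components of a field. Rank one makes every field of the radical a
  multiple \<open>g \<partial>\<^sub>y\<close> of \<open>V\<close>. From \<open>[H, X] = 2 X\<close> and \<open>[H, V] = c V\<close> one gets
  \<open>H = (a - 2 x) \<partial>\<^sub>x + (b - c y) \<partial>\<^sub>y\<close>. If \<open>c\<close> were zero, either the one-dimensional summand would be
  proportional to \<open>V\<close> or the line through \<open>V\<close> would be invariant (\<open>weight_nonzero\<close>), so a
  translation makes \<open>a = b = 0\<close>.

  The one-dimensional summand is a trivial representation, and commuting with \<open>X\<close> and \<open>H\<close> it is
  spanned by \<open>\<tau> = y \<partial>\<^sub>y\<close> up to a factor (\<open>T_is_scaling\<close>). As \<open>ad \<tau>\<close> commutes with \<open>S\<close> and \<open>W\<close> is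
  irreducible, \<open>ad \<tau>\<close> is a scalar on \<open>W\<close>, the same as on \<open>V\<close>; in coordinates, the fields of \<open>W\<close> are
  \<open>g(x) \<partial>\<^sub>y\<close> (\<open>W_indep_of_y\<close>). Applied to \<open>[Y, V]\<close> this gives \<open>Y = - x\<^sup>2 \<partial>\<^sub>x + (m - c x y) \<partial>\<^sub>y\<close> with
  \<open>(c + 2) m = 0\<close> (\<open>push_Y\<close>), and then \<open>(ad Y)\<^sup>k V = c (c - 1) \<cdots> (c - k + 1) x\<^sup>k \<partial>\<^sub>y\<close>. Comparison with
  \<open>dim W = N\<close> forces \<open>c = N - 1\<close> and \<open>W = \<langle>\<partial>\<^sub>y, \<dots>, x\<^sup>N\<^sup>-\<^sup>1 \<partial>\<^sub>y\<rangle>\<close>, so \<open>m = 0\<close> and the algebra is known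
  explicitly (\<open>push_algebra\<close>).

  For the comparison with the symmetry algebra, the vanishing of the \<open>N\<close>-th prolongation coefficient
  of \<open>\<xi> \<partial>\<^sub>x + \<eta> \<partial>\<^sub>y\<close> on \<open>u\<^sub>N = 0\<close> is a polynomial identity in the jet coordinates. The derivative of
  this coefficient in \<open>u\<^sub>N\<^sub>-\<^sub>1\<close> obeys a simple recursion in \<open>N\<close> and yields \<open>\<xi>\<^sub>y = 0\<close> and \<open>\<eta>\<^sub>y\<^sub>y = 0\<close>; for
  such fields the coefficient is a linear expression in the jet coordinates given by the Leibniz
  rule, and one reads off the remaining conditions (\<open>symmetry_algebra_eq\<close>). Uniqueness of the
  invariant hypersurface only uses the fields \<open>x\<^sup>i \<partial>\<^sub>y\<close> and \<open>y \<partial>\<^sub>y\<close>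
  (\<open>invariant_hypersurface_iff_zero\<close>).

  Canonical coordinates exist because the coframe dual to a commuting frame is closed, so it is the
  differential of a map, to which the inverse function theorem applies
  (\<open>canonical_coordinates_exist\<close>).\<close>

section \<open>Smooth functions\<close>

lemma C_k_on_cong:
  assumes "open U" "\<And>p. p \<in> U \<Longrightarrow> f p = g p" "C_k_on k U f"
  shows "C_k_on k U g"
  using assms(2,3)
proof (induction k arbitrary: f g)
  case 0
  then show ?case by (simp cong: continuous_on_cong)
next
  case (Suc k)
  have d: "(g has_derivative frechet_derivative f (at p)) (at p)" if "p \<in> U" for p
    using has_derivative_transform_within_open[OF _ \<open>open U\<close> that, of f] Suc.prems that
    by (metis C_k_on.simps(2) frechet_derivative_works)
  have e: "frechet_derivative f (at p) = frechet_derivative g (at p)" if "p \<in> U" for p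
    by (rule frechet_derivative_at[OF d[OF that]])
  show ?case
    unfolding C_k_on.simps
  proof (intro conjI ballI allI)
    show "g differentiable at p" if "p \<in> U" for p
      using d[OF that] by (auto simp: differentiable_def)
    show "C_k_on k U (\<lambda>p. frechet_derivative g (at p) v)" for v
      by (rule Suc.IH[of "\<lambda>p. frechet_derivative f (at p) v"]) (use Suc.prems e in auto)
  qed
qed

lemma C_k_on_SucI:
  assumes "open U" "\<And>p. p \<in> U \<Longrightarrow> (f has_derivative f' p) (at p)"
    and "\<And>v. C_k_on k U (\<lambda>p. f' p v)"
  shows "C_k_on (Suc k) U f"
  unfolding C_k_on.simps
proof (intro conjI ballI allI)
  show "f differentiable at p" if "p \<in> U" for p
    using assms(2)[OF that] by (auto simp: differentiable_def)
  show "C_k_on k U (\<lambda>p. frechet_derivative f (at p) v)" for v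
    by (rule C_k_on_cong[OF assms(1) _ assms(3)[of v]])
      (simp add: frechet_derivative_at[OF assms(2)])
qed

lemma C_k_on_SucE:
  assumes "C_k_on (Suc k) U f" "p \<in> U"
  shows "(f has_derivative frechet_derivative f (at p)) (at p)"
  using assms by (simp add: frechet_derivative_works[symmetric])

lemma C_k_on_SucD: "C_k_on (Suc k) U f \<Longrightarrow> C_k_on k U f"
proof (induction k arbitrary: f)
  case 0
  then show ?case
    by (auto intro!: continuous_at_imp_continuous_on differentiable_imp_continuous_within)
next
  case (Suc k)
  then show ?case by auto
qed

lemma C_k_on_subset:
  assumes "C_k_on k U f" "G \<subseteq> U"
  shows "C_k_on k G f"
  using assms by (induction k arbitrary: f) (auto intro: continuous_on_subset)

lemma C_k_on_const: "C_k_on k U (\<lambda>p. c)"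
  by (induction k arbitrary: c) auto

lemma C_k_on_linear:
  assumes "open U" "bounded_linear L" "C_k_on k U f"
  shows "C_k_on k U (\<lambda>p. L (f p))"
  using assms(3)
proof (induction k arbitrary: f)
  case 0
  then show ?case using assms(2) by (auto intro: bounded_linear.continuous_on)
next
  case (Suc k)
  show ?case
  proof (rule C_k_on_SucI[OF assms(1)])
    show "((\<lambda>p. L (f p)) has_derivative (\<lambda>v. L (frechet_derivative f (at p) v))) (at p)"
      if "p \<in> U" for p
      by (rule bounded_linear.has_derivative[OF assms(2)]) (rule C_k_on_SucE[OF Suc.prems that])
    show "C_k_on k U (\<lambda>p. L (frechet_derivative f (at p) v))" for v
      by (rule Suc.IH) (use Suc.prems in auto)
  qed
qed

lemma C_k_on_add:
  assumes "open U" "C_k_on k U f" "C_k_on k U g"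
  shows "C_k_on k U (\<lambda>p. f p + g p)"
  using assms(2,3)
proof (induction k arbitrary: f g)
  case 0
  then show ?case by (auto intro: continuous_on_add)
next
  case (Suc k)
  show ?case
    by (rule C_k_on_SucI[OF assms(1) has_derivative_add[OF C_k_on_SucE C_k_on_SucE]])
      (use Suc in auto)
qed

lemma C_k_on_bilinear:
  assumes "open U" "bounded_bilinear m" "C_k_on k U f" "C_k_on k U g"
  shows "C_k_on k U (\<lambda>p. m (f p) (g p))"
  using assms(3,4)
proof (induction k arbitrary: f g)
  case 0
  then show ?case using assms(2) by (auto intro: bounded_bilinear.continuous_on)
next
  case (Suc k)
  note lower = Suc.prems[THEN C_k_on_SucD]
  show ?case
    by (rule C_k_on_SucI[OF assms(1) bounded_bilinear.FDERIV[OF assms(2) C_k_on_SucE C_k_on_SucE]];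
      (intro C_k_on_add[OF assms(1)] Suc.IH)?) (use Suc.prems lower in auto)
qed

lemma C_k_on_ident: "open U \<Longrightarrow> C_k_on k U (\<lambda>p. p)"
  by (cases k) (auto intro!: C_k_on_SucI[where f'="\<lambda>p v. v"] C_k_on_const simp del: C_k_on.simps(2))

lemma C_k_on_inverse:
  fixes f :: "'a::real_normed_vector \<Rightarrow> real"
  assumes "open U" "\<And>p. p \<in> U \<Longrightarrow> f p \<noteq> 0" "C_k_on k U f"
  shows "C_k_on k U (\<lambda>p. inverse (f p))"
  using assms(3)
proof (induction k)
  case 0
  then show ?case using assms(2) by (auto intro: continuous_on_inverse)
next
  case (Suc k)
  have i: "C_k_on k U (\<lambda>p. inverse (f p))"
    by (rule Suc.IH) (rule C_k_on_SucD[OF Suc.prems])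
  show ?case
  proof (rule C_k_on_SucI[OF assms(1)])
    show "((\<lambda>p. inverse (f p)) has_derivative
       (\<lambda>v. - (inverse (f p) * frechet_derivative f (at p) v * inverse (f p)))) (at p)" if "p \<in> U" for p
      using that by (auto intro!: Deriv.has_derivative_inverse C_k_on_SucE[OF Suc.prems] assms(2))
    show "C_k_on k U (\<lambda>p. - (inverse (f p) * frechet_derivative f (at p) v * inverse (f p)))" for v
      by (intro C_k_on_linear[OF assms(1) bounded_linear_minus[OF bounded_linear_ident]]
          C_k_on_bilinear[OF assms(1) bounded_bilinear_mult] i) (use Suc.prems in auto)
  qed
qed

lemma C_k_on_sum:
  assumes "open U" "\<And>i. i \<in> I \<Longrightarrow> C_k_on k U (f i)"
  shows "C_k_on k U (\<lambda>p. \<Sum>i\<in>I. f i p)"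
  using assms(2)
  by (induction I rule: infinite_finite_induct) (auto intro: C_k_on_const C_k_on_add[OF assms(1)])

text \<open>The derivative of a composite in direction \<open>v\<close> is a sum, over a basis of the middle space,
  of products of functions that are covered by the induction hypothesis.\<close>

lemma C_k_on_compose:
  fixes g :: "'a::real_normed_vector \<Rightarrow> 'b::euclidean_space"
    and f :: "'b \<Rightarrow> 'c::real_normed_vector"
  assumes "open U" "open G" "g ` U \<subseteq> G" "C_k_on k U g" "C_k_on k G f"
  shows "C_k_on k U (\<lambda>p. f (g p))"
  using assms(4,5)
proof (induction k arbitrary: f)
  case 0
  then show ?case using assms(3) by (auto intro: continuous_on_compose2)
next
  case (Suc k)
  have gU: "g p \<in> G" if "p \<in> U" for p using assms(3) that by auto
  show ?case
  proof (rule C_k_on_SucI[OF assms(1)])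
    fix p assume p: "p \<in> U"
    have lin: "linear (frechet_derivative f (at (g p)))"
      using Suc.prems(2) gU[OF p] by (auto intro: linear_frechet_derivative)
    have "((\<lambda>p. f (g p)) has_derivative
        (\<lambda>v. frechet_derivative f (at (g p)) (frechet_derivative g (at p) v))) (at p)"
      by (rule has_derivative_compose[OF C_k_on_SucE[OF Suc.prems(1) p]
            C_k_on_SucE[OF Suc.prems(2) gU[OF p]]])
    also have "(\<lambda>v. frechet_derivative f (at (g p)) (frechet_derivative g (at p) v))
       = (\<lambda>v. \<Sum>b\<in>Basis. (frechet_derivative g (at p) v \<bullet> b) *\<^sub>R frechet_derivative f (at (g p)) b)"
    proof
      fix v
      have "frechet_derivative f (at (g p)) (\<Sum>b\<in>Basis. (frechet_derivative g (at p) v \<bullet> b) *\<^sub>R b)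
         = (\<Sum>b\<in>Basis. (frechet_derivative g (at p) v \<bullet> b) *\<^sub>R frechet_derivative f (at (g p)) b)"
        by (simp add: linear_sum[OF lin] linear_scale[OF lin])
      then show "frechet_derivative f (at (g p)) (frechet_derivative g (at p) v) =
          (\<Sum>b\<in>Basis. (frechet_derivative g (at p) v \<bullet> b) *\<^sub>R frechet_derivative f (at (g p)) b)"
        by (simp add: euclidean_representation)
    qed
    finally show "((\<lambda>p. f (g p)) has_derivative (\<lambda>v. \<Sum>b\<in>Basis.
        (frechet_derivative g (at p) v \<bullet> b) *\<^sub>R frechet_derivative f (at (g p)) b)) (at p)" .
  next
    show "C_k_on k U (\<lambda>p. \<Sum>b\<in>Basis.
        (frechet_derivative g (at p) v \<bullet> b) *\<^sub>R frechet_derivative f (at (g p)) b)" for v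
    proof (intro C_k_on_sum C_k_on_bilinear[OF assms(1) bounded_bilinear_scaleR] assms(1))
      fix b
      show "C_k_on k U (\<lambda>p. frechet_derivative g (at p) v \<bullet> b)"
        by (rule C_k_on_linear[OF assms(1) bounded_linear_inner_left]) (use Suc.prems in auto)
      show "C_k_on k U (\<lambda>p. frechet_derivative f (at (g p)) b)"
        by (rule Suc.IH) (use Suc.prems C_k_on_SucD in auto)
    qed
  qed
qed

lemma smooth_on_cong:
  "open U \<Longrightarrow> (\<And>p. p \<in> U \<Longrightarrow> f p = g p) \<Longrightarrow> smooth_on U f \<Longrightarrow> smooth_on U g"
  by (metis smooth_on_def C_k_on_cong)

lemma smooth_on_subset: "smooth_on U f \<Longrightarrow> G \<subseteq> U \<Longrightarrow> smooth_on G f"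
  by (auto simp: smooth_on_def intro: C_k_on_subset)

lemma smooth_on_const: "smooth_on U (\<lambda>p. c)"
  by (simp add: smooth_on_def C_k_on_const)

lemma smooth_on_ident: "open U \<Longrightarrow> smooth_on U (\<lambda>p. p)"
  by (simp add: smooth_on_def C_k_on_ident)

lemma smooth_on_linear: "open U \<Longrightarrow> bounded_linear L \<Longrightarrow> smooth_on U f \<Longrightarrow> smooth_on U (\<lambda>p. L (f p))"
  by (simp add: smooth_on_def C_k_on_linear)

lemma smooth_on_add:
  "open U \<Longrightarrow> smooth_on U f \<Longrightarrow> smooth_on U g \<Longrightarrow> smooth_on U (\<lambda>p. f p + g p)"
  by (simp add: smooth_on_def C_k_on_add)

lemma smooth_on_minus: "open U \<Longrightarrow> smooth_on U f \<Longrightarrow> smooth_on U (\<lambda>p. - f p)"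
  by (rule smooth_on_linear[OF _ bounded_linear_minus[OF bounded_linear_ident]])

lemma smooth_on_diff:
  "open U \<Longrightarrow> smooth_on U f \<Longrightarrow> smooth_on U g \<Longrightarrow> smooth_on U (\<lambda>p. f p - g p)"
  using smooth_on_add[of U f "\<lambda>p. - g p"] smooth_on_minus[of U g] by simp

lemma smooth_on_scaleR:
  "open U \<Longrightarrow> smooth_on U f \<Longrightarrow> smooth_on U g \<Longrightarrow> smooth_on U (\<lambda>p. f p *\<^sub>R g p)"
  by (simp add: smooth_on_def C_k_on_bilinear[OF _ bounded_bilinear_scaleR])

lemma smooth_on_mult:
  fixes f g :: "'a::real_normed_vector \<Rightarrow> real"
  shows "open U \<Longrightarrow> smooth_on U f \<Longrightarrow> smooth_on U g \<Longrightarrow> smooth_on U (\<lambda>p. f p * g p)"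
  by (simp add: smooth_on_def C_k_on_bilinear[OF _ bounded_bilinear_mult])

lemma smooth_on_power:
  fixes f :: "'a::real_normed_vector \<Rightarrow> real"
  shows "open U \<Longrightarrow> smooth_on U f \<Longrightarrow> smooth_on U (\<lambda>p. f p ^ n)"
  by (induction n) (auto intro: smooth_on_const smooth_on_mult)

lemma smooth_on_divide:
  fixes f g :: "'a::real_normed_vector \<Rightarrow> real"
  shows "open U \<Longrightarrow> smooth_on U f \<Longrightarrow> smooth_on U g \<Longrightarrow> (\<And>p. p \<in> U \<Longrightarrow> g p \<noteq> 0)
    \<Longrightarrow> smooth_on U (\<lambda>p. f p / g p)"
  by (simp add: divide_inverse smooth_on_mult smooth_on_def C_k_on_inverse
      C_k_on_bilinear[OF _ bounded_bilinear_mult])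

lemma smooth_on_sum:
  "open U \<Longrightarrow> (\<And>i. i \<in> I \<Longrightarrow> smooth_on U (f i)) \<Longrightarrow> smooth_on U (\<lambda>p. \<Sum>i\<in>I. f i p)"
  by (simp add: smooth_on_def C_k_on_sum)

lemma smooth_on_fst: "open U \<Longrightarrow> smooth_on U f \<Longrightarrow> smooth_on U (\<lambda>p. fst (f p))"
  by (rule smooth_on_linear[OF _ bounded_linear_fst])

lemma smooth_on_snd: "open U \<Longrightarrow> smooth_on U f \<Longrightarrow> smooth_on U (\<lambda>p. snd (f p))"
  by (rule smooth_on_linear[OF _ bounded_linear_snd])

lemma smooth_on_Pair:
  assumes "open U" "smooth_on U f" "smooth_on U g"
  shows "smooth_on U (\<lambda>p. (f p, g p))"
proof -
  have "smooth_on U (\<lambda>p. (f p, 0) + (0, g p))"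
    by (intro smooth_on_add[OF assms(1)]
        smooth_on_linear[OF assms(1) bounded_linear_Pair[OF bounded_linear_ident bounded_linear_zero] assms(2)]
        smooth_on_linear[OF assms(1) bounded_linear_Pair[OF bounded_linear_zero bounded_linear_ident] assms(3)])
  then show ?thesis by simp
qed

lemma smooth_on_compose:
  fixes g :: "'a::real_normed_vector \<Rightarrow> 'b::euclidean_space"
    and f :: "'b \<Rightarrow> 'c::real_normed_vector"
  shows "open U \<Longrightarrow> open G \<Longrightarrow> g ` U \<subseteq> G \<Longrightarrow> smooth_on U g \<Longrightarrow> smooth_on G f
    \<Longrightarrow> smooth_on U (\<lambda>p. f (g p))"
  by (simp add: smooth_on_def C_k_on_compose)

lemma smooth_on_imp_has_derivative:
  "smooth_on U f \<Longrightarrow> p \<in> U \<Longrightarrow> (f has_derivative frechet_derivative f (at p)) (at p)"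
  by (metis smooth_on_def C_k_on_SucE)

lemma smooth_continuous_on: "smooth_on U f \<Longrightarrow> continuous_on U f"
  by (metis smooth_on_def C_k_on.simps(1))

lemma smooth_on_frechet_derivative:
  "smooth_on U f \<Longrightarrow> smooth_on U (\<lambda>p. frechet_derivative f (at p) v)"
  by (metis smooth_on_def C_k_on.simps(2))

text \<open>A map whose derivative is given by smooth functions is smooth. This is how primitives are seen to
  be smooth.\<close>

lemma smooth_onI:
  assumes "open U" "\<And>p. p \<in> U \<Longrightarrow> (f has_derivative f' p) (at p)"
    and "\<And>v. smooth_on U (\<lambda>p. f' p v)"
  shows "smooth_on U f"
  unfolding smooth_on_def
proof
  fix k show "C_k_on k U f"
    using C_k_on_SucI[OF assms(1,2)] assms(3) C_k_on_SucD smooth_on_def by blast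
qed

section \<open>Partial derivatives in the plane\<close>

definition dx :: "(real \<times> real \<Rightarrow> 'b::real_normed_vector) \<Rightarrow> real \<times> real \<Rightarrow> 'b"
  where "dx f = (\<lambda>p. frechet_derivative f (at p) (1, 0))"

definition dy :: "(real \<times> real \<Rightarrow> 'b::real_normed_vector) \<Rightarrow> real \<times> real \<Rightarrow> 'b"
  where "dy f = (\<lambda>p. frechet_derivative f (at p) (0, 1))"

lemma dx_eqI: "(f has_derivative f') (at p) \<Longrightarrow> dx f p = f' (1, 0)"
  by (metis dx_def frechet_derivative_at)

lemma dy_eqI: "(f has_derivative f') (at p) \<Longrightarrow> dy f p = f' (0, 1)"
  by (metis dy_def frechet_derivative_at)

lemma frechet_derivative_partials:
  assumes "f differentiable at p"
  shows "frechet_derivative f (at p) h = fst h *\<^sub>R dx f p + snd h *\<^sub>R dy f p"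
proof -
  have lin: "linear (frechet_derivative f (at p))"
    by (rule linear_frechet_derivative[OF assms])
  have "frechet_derivative f (at p) (fst h *\<^sub>R (1, 0) + snd h *\<^sub>R (0, 1)) = fst h *\<^sub>R dx f p + snd h *\<^sub>R dy f p"
    by (simp only: dx_def dy_def linear_add[OF lin] linear_scale[OF lin])
  then show ?thesis by simp
qed

lemma has_derivative_partials:
  assumes "f differentiable at p"
  shows "(f has_derivative (\<lambda>h. fst h *\<^sub>R dx f p + snd h *\<^sub>R dy f p)) (at p)"
  by (rule has_derivative_eq_rhs[OF frechet_derivative_works[THEN iffD1, OF assms]])
    (simp add: fun_eq_iff frechet_derivative_partials[OF assms])

lemma smooth_differentiable: "smooth_on U f \<Longrightarrow> p \<in> U \<Longrightarrow> f differentiable at p"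
  by (metis smooth_on_imp_has_derivative differentiable_def)

lemma smooth_on_dx: "smooth_on U f \<Longrightarrow> smooth_on U (dx f)"
  unfolding dx_def by (rule smooth_on_frechet_derivative)

lemma smooth_on_dy: "smooth_on U f \<Longrightarrow> smooth_on U (dy f)"
  unfolding dy_def by (rule smooth_on_frechet_derivative)

lemma smooth_onI_partials:
  assumes "open U" "smooth_on U g" "smooth_on U h"
    and "\<And>p. p \<in> U \<Longrightarrow> (f has_derivative (\<lambda>v. fst v *\<^sub>R g p + snd v *\<^sub>R h p)) (at p)"
  shows "smooth_on U f"
proof (rule smooth_onI)
  show "smooth_on U (\<lambda>p. fst v *\<^sub>R g p + snd v *\<^sub>R h p)" for v
    by (rule smooth_on_add[OF assms(1)
          smooth_on_scaleR[OF assms(1) smooth_on_const assms(2)]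
          smooth_on_scaleR[OF assms(1) smooth_on_const assms(3)]])
qed (use assms in auto)

lemma dx_cong:
  assumes "open U" "p \<in> U" "\<And>q. q \<in> U \<Longrightarrow> f q = g q" "f differentiable at p"
  shows "dx f p = dx g p"
  unfolding dx_def using frechet_derivative_transform_within_open[OF assms(4,1,2,3)] by simp

lemma dy_cong:
  assumes "open U" "p \<in> U" "\<And>q. q \<in> U \<Longrightarrow> f q = g q" "f differentiable at p"
  shows "dy f p = dy g p"
  unfolding dy_def using frechet_derivative_transform_within_open[OF assms(4,1,2,3)] by simp

context
  fixes f g :: "real \<times> real \<Rightarrow> 'b::real_normed_vector" and p
  assumes f: "f differentiable at p" and g: "g differentiable at p"
begin

lemma dx_add: "dx (\<lambda>p. f p + g p) p = dx f p + dx g p"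
  and dy_add: "dy (\<lambda>p. f p + g p) p = dy f p + dy g p"
  and dx_diff: "dx (\<lambda>p. f p - g p) p = dx f p - dx g p"
  and dy_diff: "dy (\<lambda>p. f p - g p) p = dy f p - dy g p"
  using dx_eqI[OF has_derivative_add[OF f[THEN has_derivative_partials] g[THEN has_derivative_partials]]]
    dy_eqI[OF has_derivative_add[OF f[THEN has_derivative_partials] g[THEN has_derivative_partials]]]
    dx_eqI[OF has_derivative_diff[OF f[THEN has_derivative_partials] g[THEN has_derivative_partials]]]
    dy_eqI[OF has_derivative_diff[OF f[THEN has_derivative_partials] g[THEN has_derivative_partials]]]
  by simp_all

end

context
  fixes f g :: "real \<times> real \<Rightarrow> real" and p
  assumes f: "f differentiable at p" and g: "g differentiable at p"
begin

lemma dx_mult: "dx (\<lambda>p. f p * g p) p = dx f p * g p + f p * dx g p"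
  and dy_mult: "dy (\<lambda>p. f p * g p) p = dy f p * g p + f p * dy g p"
  using dx_eqI[OF has_derivative_mult[OF f[THEN has_derivative_partials] g[THEN has_derivative_partials]]]
    dy_eqI[OF has_derivative_mult[OF f[THEN has_derivative_partials] g[THEN has_derivative_partials]]]
  by simp_all

end

lemma dx_minus: "f differentiable at p \<Longrightarrow> dx (\<lambda>p. - f p) p = - dx f p"
  using dx_eqI[OF has_derivative_minus[OF has_derivative_partials, of f p]] by simp

lemma dx_const [simp]: "dx (\<lambda>p. c) = (\<lambda>p. 0)" and dy_const [simp]: "dy (\<lambda>p. c) = (\<lambda>p. 0)"
  by (simp_all add: dx_def dy_def)

lemma dy_snd [simp]: "dy snd = (\<lambda>p. 1)"
  using dy_eqI[OF has_derivative_snd[OF has_derivative_ident]] by (auto simp: fun_eq_iff)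

lemma DERIV_fst_arg:
  fixes f :: "real \<times> real \<Rightarrow> real"
  assumes "f differentiable at (x, y)"
  shows "((\<lambda>s. f (s, y)) has_real_derivative dx f (x, y)) (at x)"
proof -
  have "((\<lambda>s. f (s, y)) has_derivative (\<lambda>h. fst (h, 0::real) *\<^sub>R dx f (x, y) + snd (h, 0::real) *\<^sub>R dy f (x, y))) (at x)"
    by (rule has_derivative_compose[OF has_derivative_Pair[OF has_derivative_ident has_derivative_const]
          has_derivative_partials[OF assms]])
  then show ?thesis
    unfolding has_field_derivative_def by (rule has_derivative_eq_rhs) (simp add: fun_eq_iff)
qed

lemma DERIV_snd_arg:
  fixes f :: "real \<times> real \<Rightarrow> real"
  assumes "f differentiable at (x, y)"
  shows "((\<lambda>s. f (x, s)) has_real_derivative dy f (x, y)) (at y)"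
proof -
  have "((\<lambda>s. f (x, s)) has_derivative (\<lambda>h. fst (0::real, h) *\<^sub>R dx f (x, y) + snd (0::real, h) *\<^sub>R dy f (x, y))) (at y)"
    by (rule has_derivative_compose[OF has_derivative_Pair[OF has_derivative_const has_derivative_ident]
          has_derivative_partials[OF assms]])
  then show ?thesis
    unfolding has_field_derivative_def by (rule has_derivative_eq_rhs) (simp add: fun_eq_iff)
qed

text \<open>The mean value theorem, once in each variable, expresses the second difference of \<open>F\<close> over a
  square by a value of the mixed derivative. The second difference does not see the order of the
  variables, so the two mixed derivatives come arbitrarily close to each other near each point.\<close>

lemma second_difference_mean_value:
  fixes F :: "real \<Rightarrow> real \<Rightarrow> real"
  assumes "0 < h"
    and F: "\<And>s r. s \<in> {a..a+h} \<Longrightarrow> r \<in> {b..b+h} \<Longrightarrow> ((\<lambda>s. F s r) has_real_derivative F1 s r) (at s)"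
    and F1: "\<And>s r. s \<in> {a..a+h} \<Longrightarrow> r \<in> {b..b+h} \<Longrightarrow> ((\<lambda>r. F1 s r) has_real_derivative F12 s r) (at r)"
  obtains s r where "s \<in> {a..a+h}" "r \<in> {b..b+h}"
    "F (a+h) (b+h) - F a (b+h) - (F (a+h) b - F a b) = h * h * F12 s r"
proof -
  have "((\<lambda>s. F s (b+h) - F s b) has_real_derivative F1 s (b+h) - F1 s b) (at s)"
    if "a \<le> s" "s \<le> a + h" for s
    using that \<open>0 < h\<close> by (intro DERIV_diff F) auto
  then obtain s where s: "a < s" "s < a + h"
      "(F (a+h) (b+h) - F (a+h) b) - (F a (b+h) - F a b) = (a + h - a) * (F1 s (b+h) - F1 s b)"
    using MVT2[of a "a+h" "\<lambda>s. F s (b+h) - F s b" "\<lambda>s. F1 s (b+h) - F1 s b"] \<open>0 < h\<close> by auto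
  obtain r where r: "b < r" "r < b + h" "F1 s (b+h) - F1 s b = (b + h - b) * F12 s r"
    using MVT2[of b "b+h" "F1 s" "F12 s"] \<open>0 < h\<close> s F1 by auto
  show thesis by (rule that[of s r]) (use s r in \<open>auto simp: algebra_simps\<close>)
qed

text \<open>If the mixed derivatives differed at \<open>p\<close>, then by continuity they would differ throughout a
  neighbourhood, even when taken at two different points, against the equality of the two mean
  values over a small square.\<close>

lemma dx_dy_commute:
  fixes f :: "real \<times> real \<Rightarrow> real"
  assumes "open U" "smooth_on U f" "p \<in> U"
  shows "dx (dy f) p = dy (dx f) p"
proof (rule ccontr)
  assume neq: "\<not> ?thesis"
  obtain a b where p: "p = (a, b)" by force
  define e where "e = \<bar>dx (dy f) p - dy (dx f) p\<bar> / 2"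
  have e: "e > 0" using neq by (simp add: e_def)
  note sm = smooth_on_dx[OF assms(2)] smooth_on_dy[OF assms(2)]
  have "continuous (at p) (dx (dy f))" "continuous (at p) (dy (dx f))"
    using smooth_continuous_on[OF smooth_on_dx[OF sm(2)]]
      smooth_continuous_on[OF smooth_on_dy[OF sm(1)]] assms(1,3)
    by (auto simp: continuous_on_eq_continuous_at)
  then obtain d1 d2 where d: "d1 > 0" "\<And>q. dist q p < d1 \<Longrightarrow> dist (dx (dy f) q) (dx (dy f) p) < e"
      "d2 > 0" "\<And>q. dist q p < d2 \<Longrightarrow> dist (dy (dx f) q) (dy (dx f) p) < e"
    unfolding continuous_at_eps_delta by (metis e)
  obtain d3 where d3: "d3 > 0" "ball p d3 \<subseteq> U" using assms(1,3) open_contains_ball by metis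
  define h where "h = min d1 (min d2 d3) / 3"
  have h: "h > 0" using d d3 by (simp add: h_def)
  have near: "dist (s, r) p < min d1 (min d2 d3)" if "s \<in> {a..a+h}" "r \<in> {b..b+h}" for s r
  proof -
    have "dist (s, r) p \<le> \<bar>s - a\<bar> + \<bar>r - b\<bar>"
      by (simp add: p dist_Pair_Pair dist_real_def sqrt_sum_squares_le_sum_abs)
    also have "\<dots> \<le> 2 * h" using that by auto
    also have "\<dots> < min d1 (min d2 d3)" using h unfolding h_def by linarith
    finally show ?thesis .
  qed
  have inU: "(s, r) \<in> U" if "s \<in> {a..a+h}" "r \<in> {b..b+h}" for s r
    using near[OF that] d3 by (auto simp: dist_commute)
  have df: "f differentiable at (s, r)" "dx f differentiable at (s, r)" "dy f differentiable at (s, r)"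
    if "s \<in> {a..a+h}" "r \<in> {b..b+h}" for s r
    using smooth_differentiable[OF _ inU[OF that]] assms(2) sm by auto
  obtain s r where sr: "s \<in> {a..a+h}" "r \<in> {b..b+h}"
    "f (a+h, b+h) - f (a, b+h) - (f (a+h, b) - f (a, b)) = h * h * dy (dx f) (s, r)"
    by (rule second_difference_mean_value[OF h, of a b "\<lambda>s r. f (s, r)" "\<lambda>s r. dx f (s, r)" "\<lambda>s r. dy (dx f) (s, r)"])
      (intro DERIV_fst_arg DERIV_snd_arg df; assumption)+
  obtain r' s' where sr': "r' \<in> {b..b+h}" "s' \<in> {a..a+h}"
    "f (a+h, b+h) - f (a+h, b) - (f (a, b+h) - f (a, b)) = h * h * dx (dy f) (s', r')"
    by (rule second_difference_mean_value[OF h, of b a "\<lambda>r s. f (s, r)" "\<lambda>r s. dy f (s, r)" "\<lambda>r s. dx (dy f) (s, r)"])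
      (intro DERIV_fst_arg DERIV_snd_arg df; assumption)+
  have "h * h * dy (dx f) (s, r) = h * h * dx (dy f) (s', r')" using sr(3) sr'(3) by linarith
  then have "dy (dx f) (s, r) = dx (dy f) (s', r')" using h by simp
  moreover have "\<bar>dx (dy f) (s', r') - dx (dy f) p\<bar> < e" "\<bar>dy (dx f) (s, r) - dy (dx f) p\<bar> < e"
    using d(2)[of "(s', r')"] d(4)[of "(s, r)"] near[OF sr(1,2)] near[OF sr'(2,1)]
    by (auto simp: dist_real_def)
  ultimately have "\<bar>dx (dy f) p - dy (dx f) p\<bar> < 2 * e" by linarith
  then show False by (simp add: e_def)
qed

lemma partials_zero_imp_const:
  fixes f :: "real \<times> real \<Rightarrow> real"
  assumes "open D" "connected D"
    and "\<And>p. p \<in> D \<Longrightarrow> f differentiable at p \<and> dx f p = 0 \<and> dy f p = 0"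
  obtains c where "\<And>p. p \<in> D \<Longrightarrow> f p = c"
proof (cases "D = {}")
  case True
  then show thesis using that by auto
next
  case False
  then obtain p0 where "p0 \<in> D" by auto
  have "(f has_derivative (\<lambda>x. 0)) (at p)" if "p \<in> D" for p
    using has_derivative_partials[of f p] assms(3)[OF that] by simp
  then have "f p = f p0" if "p \<in> D" for p
    using has_derivative_zero_unique_connected[OF assms(1,2) _ that \<open>p0 \<in> D\<close>] by blast
  then show thesis using that by blast
qed

text \<open>Division by the coordinate \<open>y\<close>: off the axis one divides, and the axis is in the closure of
  its complement.\<close>

lemma snd_mult_zero_imp_zero:
  fixes g :: "real \<times> real \<Rightarrow> real"
  assumes "open D" "continuous_on D g" "\<And>p. p \<in> D \<Longrightarrow> snd p * g p = 0" "p \<in> D"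
  shows "g p = 0"
proof (rule ccontr)
  assume "g p \<noteq> 0"
  obtain a b where p: "p = (a, b)" by force
  have "open (D \<inter> g -` (- {0}))"
    by (rule continuous_open_preimage[OF assms(2,1)]) auto
  moreover have "D \<inter> g -` (- {0}) = {q \<in> D. g q \<noteq> 0}" by auto
  ultimately have op: "open {q \<in> D. g q \<noteq> 0}" by simp
  have "p \<in> {q \<in> D. g q \<noteq> 0}" using \<open>g p \<noteq> 0\<close> assms(4) by simp
  then obtain e where e: "e > 0" "ball p e \<subseteq> {q \<in> D. g q \<noteq> 0}"
    using openE[OF op] by blast
  define t where "t = (if b = 0 then e/2 else b)"
  have "(a, t) \<in> ball p e" using e by (simp add: p t_def dist_Pair_Pair dist_real_def)
  then have "(a, t) \<in> {q \<in> D. g q \<noteq> 0}" using e(2) by blast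
  then have gt: "g (a, t) \<noteq> 0" "(a, t) \<in> D" by simp_all
  have "t = 0" using assms(3)[OF gt(2)] gt(1) by simp
  then show False using e by (simp add: t_def split: if_splits)
qed

text \<open>The primitive is the integral of the form along the segments that issue from \<open>p0\<close>. Closedness
  turns the derivative of the integrand in a coordinate direction into the derivative of
  \<open>t \<mapsto> t * a (p0 + t (q - p0))\<close> with respect to the parameter \<open>t\<close>.\<close>

lemma poincare_lemma_plane:
  fixes a b :: "real \<times> real \<Rightarrow> real"
  assumes "open B" "convex B" "p0 \<in> B" "smooth_on B a" "smooth_on B b"
    and closed: "\<And>p. p \<in> B \<Longrightarrow> dy a p = dx b p"
  obtains f where "smooth_on B f" "\<And>p. p \<in> B \<Longrightarrow> dx f p = a p" "\<And>p. p \<in> B \<Longrightarrow> dy f p = b p"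
proof -
  define l where "l = (\<lambda>(q::real \<times> real) (t::real). p0 + t *\<^sub>R (q - p0))"
  define w where "w = (\<lambda>q t. a (l q t) * fst (q - p0) + b (l q t) * snd (q - p0))"
  define c1 where "c1 = (\<lambda>q t. t * (dx a (l q t) * fst (q - p0) + dx b (l q t) * snd (q - p0)) + a (l q t))"
  define c2 where "c2 = (\<lambda>q t. t * (dy a (l q t) * fst (q - p0) + dy b (l q t) * snd (q - p0)) + b (l q t))"
  define Fst :: "(real \<times> real) \<Rightarrow>\<^sub>L real" where "Fst = Blinfun fst"
  define Snd :: "(real \<times> real) \<Rightarrow>\<^sub>L real" where "Snd = Blinfun snd"
  have FS: "blinfun_apply Fst = fst" "blinfun_apply Snd = snd"
    by (simp_all add: Fst_def Snd_def bounded_linear_Blinfun_apply bounded_linear_fst bounded_linear_snd)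
  have lB: "l q t \<in> B" if "q \<in> B" "t \<in> {0..1}" for q t
    using convexD_alt[OF assms(2,3) that(1), of t] that(2) by (simp add: l_def algebra_simps)
  have contl: "continuous_on (B \<times> {0..1}) (\<lambda>z. l (fst z) (snd z))"
    unfolding l_def by (intro continuous_intros)
  have lsub: "(\<lambda>z. l (fst z) (snd z)) ` (B \<times> {0..1}) \<subseteq> B" using lB by auto
  have cont: "continuous_on (B \<times> {0..1}) (\<lambda>z. g (l (fst z) (snd z)))" if "smooth_on B g" for g :: "real \<times> real \<Rightarrow> real"
    by (rule continuous_on_compose2[OF smooth_continuous_on[OF that] contl lsub])
  note cont' = cont[OF assms(4)] cont[OF assms(5)] cont[OF smooth_on_dx[OF assms(4)]] cont[OF smooth_on_dx[OF assms(5)]]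
    cont[OF smooth_on_dy[OF assms(4)]] cont[OF smooth_on_dy[OF assms(5)]]
  have contc: "continuous_on (B \<times> {0..1}) (\<lambda>z. c1 (fst z) (snd z))" "continuous_on (B \<times> {0..1}) (\<lambda>z. c2 (fst z) (snd z))"
      "continuous_on (B \<times> {0..1}) (\<lambda>z. w (fst z) (snd z))"
    unfolding c1_def c2_def w_def by (intro continuous_intros cont')+
  have int: "g q integrable_on {0..1}" if "continuous_on (B \<times> {0..1}) (\<lambda>z. g (fst z) (snd z))" "q \<in> B"
    for g :: "real \<times> real \<Rightarrow> real \<Rightarrow> real" and q
  proof (rule integrable_continuous_interval)
    have "continuous_on {0..1} (\<lambda>t. (q, t))" by (intro continuous_intros)
    from continuous_on_compose2[OF that(1) this] show "continuous_on {0..1} (g q)"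
      using that(2) by auto
  qed
  \<comment> \<open>the chain rule along the segments\<close>
  have derg: "((\<lambda>q. g (l q t)) has_derivative (\<lambda>v. t * (fst v * dx g (l q t) + snd v * dy g (l q t)))) (at q)"
    "((\<lambda>t. g (l q t)) has_real_derivative (dx g (l q t) * fst (q - p0) + dy g (l q t) * snd (q - p0))) (at t)"
    if "smooth_on B g" "q \<in> B" "t \<in> {0..1}" for g :: "real \<times> real \<Rightarrow> real" and q t
  proof -
    note d = has_derivative_partials[OF smooth_differentiable[OF that(1) lB[OF that(2,3)]]]
    have "((\<lambda>q. l q t) has_derivative (\<lambda>v. t *\<^sub>R v)) (at q)"
      unfolding l_def by (auto intro!: derivative_eq_intros)
    from has_derivative_compose[OF this d]
    show "((\<lambda>q. g (l q t)) has_derivative (\<lambda>v. t * (fst v * dx g (l q t) + snd v * dy g (l q t)))) (at q)"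
      by (simp add: algebra_simps)
    have "((\<lambda>t. l q t) has_derivative (\<lambda>s. s *\<^sub>R (q - p0))) (at t)"
      unfolding l_def by (auto intro!: derivative_eq_intros)
    from has_derivative_compose[OF this d]
    show "((\<lambda>t. g (l q t)) has_real_derivative (dx g (l q t) * fst (q - p0) + dy g (l q t) * snd (q - p0))) (at t)"
      unfolding has_field_derivative_def
      by (rule has_derivative_eq_rhs) (simp add: algebra_simps fun_eq_iff)
  qed
  define f where "f = (\<lambda>q. integral {0..1} (w q))"
  have fd: "(f has_derivative (\<lambda>v. fst v *\<^sub>R a q + snd v *\<^sub>R b q)) (at q)" if q: "q \<in> B" for q
  proof -
    have "((\<lambda>q. integral (cbox 0 1) (w q)) has_derivative
        integral (cbox 0 1) (\<lambda>t. c1 q t *\<^sub>R Fst + c2 q t *\<^sub>R Snd)) (at q within B)"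
    proof (rule leibniz_rule[OF _ _ _ q assms(2)])
      fix x t assume x: "x \<in> B" and t: "t \<in> cbox (0::real) 1"
      have t': "t \<in> {0..1}" using t by simp
      have dfs: "((\<lambda>x. fst (x - p0)) has_derivative fst) (at x)" "((\<lambda>x. snd (x - p0)) has_derivative snd) (at x)"
        by (rule has_derivative_eq_rhs[OF has_derivative_fst[OF has_derivative_diff[OF has_derivative_ident has_derivative_const]]], simp)
          (rule has_derivative_eq_rhs[OF has_derivative_snd[OF has_derivative_diff[OF has_derivative_ident has_derivative_const]]], simp)
      note d1 = has_derivative_mult[OF derg(1)[OF assms(4) x t'] dfs(1)]
      note d2 = has_derivative_mult[OF derg(1)[OF assms(5) x t'] dfs(2)]
      have "((\<lambda>x. w x t) has_derivative (\<lambda>v. c1 x t * fst v + c2 x t * snd v)) (at x)"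
        unfolding w_def
        by (rule has_derivative_eq_rhs[OF has_derivative_add[OF d1 d2]])
          (simp add: c1_def c2_def fun_eq_iff algebra_simps)
      then show "((\<lambda>x. w x t) has_derivative blinfun_apply (c1 x t *\<^sub>R Fst + c2 x t *\<^sub>R Snd)) (at x within B)"
        by (rule has_derivative_at_withinI[OF has_derivative_eq_rhs])
          (simp add: plus_blinfun.rep_eq scaleR_blinfun.rep_eq FS fun_eq_iff)
    next
      show "w x integrable_on cbox 0 1" if "x \<in> B" for x using int[OF contc(3) that] by simp
      show "continuous_on (B \<times> cbox 0 1) (\<lambda>(x, t). c1 x t *\<^sub>R Fst + c2 x t *\<^sub>R Snd)"
        unfolding split_beta by (intro continuous_intros) (use contc in auto)
    qed
    moreover have "integral {0..1} (c1 q) = a q" "integral {0..1} (c2 q) = b q"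
    proof -
      have "(c1 q has_integral (1 * a (l q 1) - 0 * a (l q 0))) {0..1}"
      proof (rule fundamental_theorem_of_calculus)
        show "((\<lambda>t. t * a (l q t)) has_vector_derivative c1 q t) (at t within {0..1})" if "t \<in> {0..1}" for t
          unfolding has_real_derivative_iff_has_vector_derivative[symmetric]
          using DERIV_mult[OF DERIV_ident derg(2)[OF assms(4) q that]] closed[OF lB[OF q that]]
          by (intro has_field_derivative_at_within[of _ _ t "{0..1}"]) (simp add: c1_def algebra_simps)
      qed simp
      then show "integral {0..1} (c1 q) = a q" by (simp add: l_def integral_unique)
      have "(c2 q has_integral (1 * b (l q 1) - 0 * b (l q 0))) {0..1}"
      proof (rule fundamental_theorem_of_calculus)
        show "((\<lambda>t. t * b (l q t)) has_vector_derivative c2 q t) (at t within {0..1})" if "t \<in> {0..1}" for t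
          unfolding has_real_derivative_iff_has_vector_derivative[symmetric]
          using DERIV_mult[OF DERIV_ident derg(2)[OF assms(5) q that]] closed[OF lB[OF q that]]
          by (intro has_field_derivative_at_within[of _ _ t "{0..1}"]) (simp add: c2_def algebra_simps)
      qed simp
      then show "integral {0..1} (c2 q) = b q" by (simp add: l_def integral_unique)
    qed
    moreover have "integral {0..1} (\<lambda>t. c1 q t *\<^sub>R Fst + c2 q t *\<^sub>R Snd)
        = integral {0..1} (c1 q) *\<^sub>R Fst + integral {0..1} (c2 q) *\<^sub>R Snd"
      by (intro integral_unique has_integral_add has_integral_scaleR_left integrable_integral int contc q)
    ultimately have "(f has_derivative blinfun_apply (a q *\<^sub>R Fst + b q *\<^sub>R Snd)) (at q within B)"
      by (simp add: f_def)
    then show ?thesis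
      by (simp add: plus_blinfun.rep_eq scaleR_blinfun.rep_eq FS at_within_open[OF q assms(1)] mult.commute)
  qed
  show thesis
    using that[of f] smooth_onI_partials[OF assms(1,4,5) fd] dx_eqI[OF fd] dy_eqI[OF fd] by simp
qed

section \<open>Lie algebras of vector fields in the plane\<close>

definition along :: "vfield \<Rightarrow> (real \<times> real \<Rightarrow> real) \<Rightarrow> real \<times> real \<Rightarrow> real"
  where "along Z g = (\<lambda>p. fst (Z p) * dx g p + snd (Z p) * dy g p)"

lemma along_cong:
  assumes "open U" "p \<in> U" "\<And>q. q \<in> U \<Longrightarrow> g q = h q" "g differentiable at p"
  shows "along Z g p = along Z h p"
  unfolding along_def by (simp only: dx_cong[OF assms] dy_cong[OF assms])

lemma along_diff:
  assumes "g differentiable at p" "h differentiable at p"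
  shows "along Z (\<lambda>p. g p - h p) p = along Z g p - along Z h p"
  unfolding along_def dx_diff[OF assms] dy_diff[OF assms] by (simp add: algebra_simps)

lemma smooth_on_along:
  "open U \<Longrightarrow> smooth_on U Z \<Longrightarrow> smooth_on U g \<Longrightarrow> smooth_on U (along Z g)"
  unfolding along_def
  by (intro smooth_on_add smooth_on_mult smooth_on_fst smooth_on_snd smooth_on_dx smooth_on_dy)

lemma dx_fst_comp: "W differentiable at p \<Longrightarrow> dx (\<lambda>q. fst (W q)) p = fst (dx W p)"
  and dy_fst_comp: "W differentiable at p \<Longrightarrow> dy (\<lambda>q. fst (W q)) p = fst (dy W p)"
  and dx_snd_comp: "W differentiable at p \<Longrightarrow> dx (\<lambda>q. snd (W q)) p = snd (dx W p)"
  and dy_snd_comp: "W differentiable at p \<Longrightarrow> dy (\<lambda>q. snd (W q)) p = snd (dy W p)"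
  for W :: "real \<times> real \<Rightarrow> real \<times> real"
  using dx_eqI[OF has_derivative_fst[OF has_derivative_partials, of W p]]
    dy_eqI[OF has_derivative_fst[OF has_derivative_partials, of W p]]
    dx_eqI[OF has_derivative_snd[OF has_derivative_partials, of W p]]
    dy_eqI[OF has_derivative_snd[OF has_derivative_partials, of W p]]
  by simp_all

lemma frechet_derivative_along:
  fixes W :: "real \<times> real \<Rightarrow> real \<times> real"
  assumes "W differentiable at p"
  shows "frechet_derivative W (at p) (Z p) = (along Z (\<lambda>q. fst (W q)) p, along Z (\<lambda>q. snd (W q)) p)"
  using frechet_derivative_partials[OF assms, of "Z p"]
  by (simp add: along_def dx_fst_comp dy_fst_comp dx_snd_comp dy_snd_comp assms prod_eq_iff)

lemma lie_bracket_along: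
  assumes "p \<in> U" "Z differentiable at p" "W differentiable at p"
  shows "lie_bracket U Z W p =
    (along Z (\<lambda>q. fst (W q)) p - along W (\<lambda>q. fst (Z q)) p,
     along Z (\<lambda>q. snd (W q)) p - along W (\<lambda>q. snd (Z q)) p)"
  using assms by (simp add: lie_bracket_def frechet_derivative_along)

lemma vfieldsD: "Z \<in> vfields U \<Longrightarrow> smooth_on U Z" "Z \<in> vfields U \<Longrightarrow> p \<notin> U \<Longrightarrow> Z p = 0"
  by (cases p; auto simp: vfields_def)+

lemma vfields_differentiable: "Z \<in> vfields U \<Longrightarrow> p \<in> U \<Longrightarrow> Z differentiable at p"
  by (rule smooth_differentiable[OF vfieldsD(1)])

lemma vfields_eqI:
  "Z \<in> vfields U \<Longrightarrow> W \<in> vfields U \<Longrightarrow> (\<And>p. p \<in> U \<Longrightarrow> Z p = W p) \<Longrightarrow> Z = W"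
  by (metis ext vfieldsD(2))

lemma subspace_vfields: "open U \<Longrightarrow> subspace (vfields U)"
  unfolding subspace_def vfields_def
  by (auto simp: scaleR_fun_def plus_fun_def zero_fun_def
      intro: smooth_on_const smooth_on_add smooth_on_scaleR)

lemma lie_bracket_vfields:
  assumes U: "open U" and Z: "Z \<in> vfields U" and W: "W \<in> vfields U"
  shows "lie_bracket U Z W \<in> vfields U"
proof -
  note sm = vfieldsD(1)[OF Z] vfieldsD(1)[OF W]
  have "smooth_on U (\<lambda>p. (along Z (\<lambda>q. fst (W q)) p - along W (\<lambda>q. fst (Z q)) p,
     along Z (\<lambda>q. snd (W q)) p - along W (\<lambda>q. snd (Z q)) p))"
    by (intro smooth_on_Pair smooth_on_diff smooth_on_along smooth_on_fst smooth_on_snd U sm)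
  then have "smooth_on U (lie_bracket U Z W)"
    by (rule smooth_on_cong[OF U, rotated])
      (use lie_bracket_along vfields_differentiable[OF Z] vfields_differentiable[OF W] in auto)
  then show ?thesis by (simp add: vfields_def lie_bracket_def)
qed

text \<open>A bracket of fields acts on functions as the commutator of their actions: the second order
  terms cancel because mixed partial derivatives commute.\<close>

lemma along_lie_bracket:
  assumes U: "open U" and Z: "Z \<in> vfields U" and W: "W \<in> vfields U" and g: "smooth_on U g"
    and p: "p \<in> U"
  shows "along (lie_bracket U Z W) g p = along Z (along W g) p - along W (along Z g) p"
proof -
  note sm = vfieldsD(1)[OF Z] vfieldsD(1)[OF W]
  note diff = smooth_differentiable[OF _ p]
  have d: "(\<lambda>q. fst (Z q)) differentiable at p" "(\<lambda>q. snd (Z q)) differentiable at p"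
    "(\<lambda>q. fst (W q)) differentiable at p" "(\<lambda>q. snd (W q)) differentiable at p"
    "dx g differentiable at p" "dy g differentiable at p"
    by (intro diff smooth_on_fst smooth_on_snd smooth_on_dx smooth_on_dy g U sm)+
  have "dx (along A g) p = dx (\<lambda>q. fst (A q)) p * dx g p + fst (A p) * dx (dx g) p
      + (dx (\<lambda>q. snd (A q)) p * dy g p + snd (A p) * dx (dy g) p)"
    "dy (along A g) p = dy (\<lambda>q. fst (A q)) p * dx g p + fst (A p) * dy (dx g) p
      + (dy (\<lambda>q. snd (A q)) p * dy g p + snd (A p) * dy (dy g) p)"
    if "(\<lambda>q. fst (A q)) differentiable at p" "(\<lambda>q. snd (A q)) differentiable at p" for A :: vfield
    unfolding along_def using that d(5,6)
    by (simp_all add: dx_add dy_add dx_mult dy_mult differentiable_mult)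
  note e = this[OF d(1,2)] this[OF d(3,4)]
  show ?thesis
    using lie_bracket_along[OF p vfields_differentiable[OF Z p] vfields_differentiable[OF W p]]
      dx_dy_commute[OF U g p]
    by (simp add: along_def[of _ "along _ g"] along_def[of "lie_bracket U Z W"] e)
      (simp add: along_def algebra_simps)
qed

lemma lie_bracket_jacobi:
  assumes U: "open U" and Z: "Z \<in> vfields U" and W: "W \<in> vfields U" and T: "T \<in> vfields U"
  shows "lie_bracket U Z (lie_bracket U W T)
    = lie_bracket U (lie_bracket U Z W) T + lie_bracket U W (lie_bracket U Z T)"
proof (rule vfields_eqI)
  note v = lie_bracket_vfields[OF U]
  show "lie_bracket U Z (lie_bracket U W T) \<in> vfields U"
    by (intro v Z W T)
  show "lie_bracket U (lie_bracket U Z W) T + lie_bracket U W (lie_bracket U Z T) \<in> vfields U"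
    by (intro subspace_add[OF subspace_vfields[OF U]] v Z W T)
  fix p assume p: "p \<in> U"
  note dv = vfields_differentiable[OF _ p]
  \<comment> \<open>both components of a double bracket, written with iterated derivatives\<close>
  have c: "along A (\<lambda>q. L (lie_bracket U B C q)) p - along (lie_bracket U B C) (\<lambda>q. L (A q)) p
    = along A (along B (\<lambda>q. L (C q))) p - along A (along C (\<lambda>q. L (B q))) p
      - along B (along C (\<lambda>q. L (A q))) p + along C (along B (\<lambda>q. L (A q))) p"
    if A: "A \<in> vfields U" and B: "B \<in> vfields U" and C: "C \<in> vfields U" and L: "L = fst \<or> L = snd"
    for A B C :: vfield and L
  proof -
    have sm: "smooth_on U (\<lambda>q. L (E q))" if "E \<in> vfields U" for E :: vfield
      using L that U vfieldsD(1) smooth_on_fst smooth_on_snd by blast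
    note al = smooth_on_along[OF U vfieldsD(1)]
    have "along A (\<lambda>q. L (lie_bracket U B C q)) p
        = along A (\<lambda>q. along B (\<lambda>q. L (C q)) q - along C (\<lambda>q. L (B q)) q) p"
    proof (rule along_cong[OF U p])
      show "L (lie_bracket U B C q) = along B (\<lambda>q. L (C q)) q - along C (\<lambda>q. L (B q)) q" if "q \<in> U" for q
        using L lie_bracket_along[OF that vfields_differentiable[OF B that] vfields_differentiable[OF C that]]
        by auto
      show "(\<lambda>q. L (lie_bracket U B C q)) differentiable at p"
        by (rule smooth_differentiable[OF sm[OF v[OF B C]] p])
    qed
    also have "\<dots> = along A (along B (\<lambda>q. L (C q))) p - along A (along C (\<lambda>q. L (B q))) p"
      by (intro along_diff smooth_differentiable[OF _ p] al B C sm)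
    finally show ?thesis using along_lie_bracket[OF U B C sm[OF A] p] by simp
  qed
  show "lie_bracket U Z (lie_bracket U W T) p
    = (lie_bracket U (lie_bracket U Z W) T + lie_bracket U W (lie_bracket U Z T)) p"
    using c[OF Z W T, of fst] c[OF T Z W, of fst] c[OF W Z T, of fst]
      c[OF Z W T, of snd] c[OF T Z W, of snd] c[OF W Z T, of snd]
    by (simp add: lie_bracket_along[OF p] dv v Z W T plus_fun_def)
qed

lemma lie_bracket_antisym: "lie_bracket U W Z = - lie_bracket U Z W"
  by (auto simp: lie_bracket_def fun_eq_iff fun_Compl_def)

lemma lie_bracket_self: "lie_bracket U Z Z = 0"
  by (auto simp: lie_bracket_def fun_eq_iff)

lemma lie_bracket_add_right:
  assumes "Z \<in> vfields U" "W \<in> vfields U" "T \<in> vfields U"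
  shows "lie_bracket U Z (W + T) = lie_bracket U Z W + lie_bracket U Z T"
proof
  fix p
  show "lie_bracket U Z (W + T) p = (lie_bracket U Z W + lie_bracket U Z T) p"
  proof (cases "p \<in> U")
    case True
    note d = vfields_differentiable[OF assms(1) True] vfields_differentiable[OF assms(2) True]
      vfields_differentiable[OF assms(3) True]
    have "frechet_derivative (W + T) (at p) = (\<lambda>h. frechet_derivative W (at p) h + frechet_derivative T (at p) h)"
      unfolding plus_fun_def
      by (rule frechet_derivative_at[symmetric])
        (intro has_derivative_add d(2,3)[THEN frechet_derivative_works[THEN iffD1]])
    then show ?thesis
      using True linear_add[OF linear_frechet_derivative[OF d(1)]]
      by (simp add: lie_bracket_def plus_fun_def)
  qed (simp add: lie_bracket_def)
qed

lemma lie_bracket_scale_right: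
  assumes "Z \<in> vfields U" "W \<in> vfields U"
  shows "lie_bracket U Z (c *\<^sub>R W) = c *\<^sub>R lie_bracket U Z W"
proof
  fix p
  show "lie_bracket U Z (c *\<^sub>R W) p = (c *\<^sub>R lie_bracket U Z W) p"
  proof (cases "p \<in> U")
    case True
    note d = vfields_differentiable[OF assms(1) True] vfields_differentiable[OF assms(2) True]
    have "frechet_derivative (c *\<^sub>R W) (at p) = (\<lambda>h. c *\<^sub>R frechet_derivative W (at p) h)"
      unfolding scaleR_fun_def
      by (rule frechet_derivative_at[symmetric])
        (intro has_derivative_scaleR_right d(2)[THEN frechet_derivative_works[THEN iffD1]])
    then show ?thesis
      using True linear_scale[OF linear_frechet_derivative[OF d(1)]]
      by (simp add: lie_bracket_def scaleR_fun_def scaleR_diff_right)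
  qed (simp add: lie_bracket_def scaleR_fun_def)
qed

lemma lie_bracket_add_left:
  "Z \<in> vfields U \<Longrightarrow> W \<in> vfields U \<Longrightarrow> T \<in> vfields U \<Longrightarrow>
    lie_bracket U (W + T) Z = lie_bracket U W Z + lie_bracket U T Z"
  using lie_bracket_add_right[of Z U W T] lie_bracket_antisym[of U _ Z] by simp

lemma lie_bracket_scale_left:
  "Z \<in> vfields U \<Longrightarrow> W \<in> vfields U \<Longrightarrow> lie_bracket U (c *\<^sub>R W) Z = c *\<^sub>R lie_bracket U W Z"
  using lie_bracket_scale_right[of Z U W c] lie_bracket_antisym[of U _ Z] by simp

section \<open>Vector fields in a chart\<close>

text \<open>For a field \<open>Z\<close>, the components of its pushforward at \<open>\<phi> p\<close> are the derivatives along \<open>Z\<close> of the two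
  coordinate functions of \<open>\<phi>\<close>, which reduces everything about pushforwards to the operators
  \<open>along Z\<close>.\<close>

locale chart =
  fixes D :: "(real \<times> real) set" and \<phi> :: "real \<times> real \<Rightarrow> real \<times> real"
  assumes chart: "is_chart D \<phi>"
begin

abbreviation "\<psi> \<equiv> inv_into D \<phi>"
abbreviation "push \<equiv> pushforward D \<phi>"

lemma open_D: "open D" and connected_D: "connected D" and smooth: "smooth_on D \<phi>"
  and inj: "inj_on \<phi> D" and open_im: "open (\<phi> ` D)" and smooth_inv: "smooth_on (\<phi> ` D) \<psi>"
  using chart by (auto simp: is_chart_def)

lemma inv [simp]: "p \<in> D \<Longrightarrow> \<psi> (\<phi> p) = p"
  using inj by simp

lemma connected_im: "connected (\<phi> ` D)"
  by (rule connected_continuous_image[OF smooth_continuous_on[OF smooth] connected_D])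

lemma differentiable: "p \<in> D \<Longrightarrow> \<phi> differentiable at p"
  by (rule smooth_differentiable[OF smooth])

lemma push_apply: "p \<in> D \<Longrightarrow> push Z (\<phi> p) = frechet_derivative \<phi> (at p) (Z p)"
  by (simp add: pushforward_def)

lemma push_along:
  "p \<in> D \<Longrightarrow> push Z (\<phi> p) = (along Z (\<lambda>q. fst (\<phi> q)) p, along Z (\<lambda>q. snd (\<phi> q)) p)"
  by (simp add: push_apply frechet_derivative_along differentiable)

lemma push_outside: "q \<notin> \<phi> ` D \<Longrightarrow> push Z q = 0"
  by (simp add: pushforward_def)

lemma push_add: "push (Z + W) = push Z + push W"
  by (auto simp: fun_eq_iff pushforward_def plus_fun_def
      linear_add[OF linear_frechet_derivative[OF differentiable]])

lemma push_scale: "push (c *\<^sub>R Z) = c *\<^sub>R push Z"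
  by (auto simp: fun_eq_iff pushforward_def scaleR_fun_def
      linear_scale[OF linear_frechet_derivative[OF differentiable]])

lemma linear_push: "linear push"
  by (rule linearI) (simp_all add: push_add push_scale)

lemma push_zero_imp:
  assumes "p \<in> D" "push Z (\<phi> p) = 0"
  shows "Z p = 0"
proof -
  note d1 = frechet_derivative_works[THEN iffD1, OF differentiable[OF assms(1)]]
  have "\<psi> differentiable at (\<phi> p)"
    by (rule smooth_differentiable[OF smooth_inv]) (use assms in auto)
  note d2 = frechet_derivative_works[THEN iffD1, OF this]
  have "((\<lambda>q. q) has_derivative (\<lambda>v. frechet_derivative \<psi> (at (\<phi> p)) (frechet_derivative \<phi> (at p) v))) (at p)"
    by (rule has_derivative_transform_within_open[OF has_derivative_compose[OF d1 d2] open_D assms(1)]) simp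
  then have "(\<lambda>v. frechet_derivative \<psi> (at (\<phi> p)) (frechet_derivative \<phi> (at p) v)) = (\<lambda>v. v)"
    using has_derivative_ident has_derivative_unique by blast
  then have "frechet_derivative \<psi> (at (\<phi> p)) 0 = Z p"
    using assms by (metis push_apply)
  then show ?thesis using linear_0[OF has_derivative_linear[OF d2]] by simp
qed

lemma push_vfields:
  assumes "smooth_on D Z"
  shows "push Z \<in> vfields (\<phi> ` D)"
proof -
  let ?e = "\<lambda>p. (along Z (\<lambda>q. fst (\<phi> q)) p, along Z (\<lambda>q. snd (\<phi> q)) p)"
  have sub: "\<psi> ` \<phi> ` D \<subseteq> D" by auto
  have "smooth_on D ?e"
    by (intro smooth_on_Pair smooth_on_along smooth_on_fst smooth_on_snd open_D assms smooth)
  then have "smooth_on (\<phi> ` D) (\<lambda>q. ?e (\<psi> q))"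
    by (rule smooth_on_compose[OF open_im open_D sub smooth_inv])
  then have "smooth_on (\<phi> ` D) (push Z)"
    by (rule smooth_on_cong[OF open_im, rotated]) (auto simp: push_along)
  then show ?thesis by (simp add: vfields_def push_outside)
qed

lemma along_compose:
  assumes "smooth_on (\<phi> ` D) g" "p \<in> D"
  shows "along Z (\<lambda>q. g (\<phi> q)) p = along (push Z) g (\<phi> p)"
proof -
  have g: "g differentiable at (\<phi> p)"
    using assms by (auto intro: smooth_differentiable)
  have d: "((\<lambda>q. g (\<phi> q)) has_derivative
      (\<lambda>v. frechet_derivative g (at (\<phi> p)) (frechet_derivative \<phi> (at p) v))) (at p)"
    by (rule has_derivative_compose[OF frechet_derivative_works[THEN iffD1, OF differentiable[OF assms(2)]]
          frechet_derivative_works[THEN iffD1, OF g]])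
  then have d': "(\<lambda>q. g (\<phi> q)) differentiable at p" by (auto simp: differentiable_def)
  have "along Z (\<lambda>q. g (\<phi> q)) p = frechet_derivative (\<lambda>q. g (\<phi> q)) (at p) (Z p)"
    by (simp add: frechet_derivative_partials[OF d'] along_def)
  also have "\<dots> = frechet_derivative g (at (\<phi> p)) (push Z (\<phi> p))"
    by (simp add: frechet_derivative_at[OF d, symmetric] push_apply assms(2))
  also have "\<dots> = along (push Z) g (\<phi> p)"
    by (simp add: frechet_derivative_partials[OF g] along_def)
  finally show ?thesis .
qed

text \<open>The components of the pushforward of \<open>Z\<close> are the derivatives along \<open>Z\<close> of the coordinates, so
  the claim is the commutator formula for the coordinate functions.\<close>

lemma push_lie_bracket:
  assumes "D \<subseteq> U" "open U" "Z \<in> vfields U" "W \<in> vfields U"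
  shows "push (lie_bracket U Z W) = lie_bracket (\<phi> ` D) (push Z) (push W)"
proof
  fix q
  show "push (lie_bracket U Z W) q = lie_bracket (\<phi> ` D) (push Z) (push W) q"
  proof (cases "q \<in> \<phi> ` D")
    case False
    then show ?thesis by (simp add: push_outside lie_bracket_def)
  next
    case True
    then obtain p where p: "p \<in> D" "q = \<phi> p" by auto
    define Z' where "Z' = (\<lambda>p. if p \<in> D then Z p else 0)"
    define W' where "W' = (\<lambda>p. if p \<in> D then W p else 0)"
    have smZ: "smooth_on D Z" and smW: "smooth_on D W"
      using assms vfieldsD(1) smooth_on_subset by blast+
    have v: "Z' \<in> vfields D" "W' \<in> vfields D"
      using smooth_on_cong[OF open_D _ smZ, of Z'] smooth_on_cong[OF open_D _ smW, of W']
      by (auto simp: vfields_def Z'_def W'_def)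
    have br: "lie_bracket D Z' W' p = lie_bracket U Z W p"
      using p assms frechet_derivative_transform_within_open[OF smooth_differentiable[OF smZ p(1)] open_D p(1), of Z']
        frechet_derivative_transform_within_open[OF smooth_differentiable[OF smW p(1)] open_D p(1), of W']
      by (auto simp: lie_bracket_def Z'_def W'_def)
    have pw: "push Z' = push Z" "push W' = push W"
      by (auto simp: fun_eq_iff pushforward_def Z'_def W'_def)
    have comp: "along (lie_bracket D Z' W') (\<lambda>q. L (\<phi> q)) p
        = along (push Z) (\<lambda>q. L (push W q)) (\<phi> p) - along (push W) (\<lambda>q. L (push Z q)) (\<phi> p)"
      if L: "L = fst \<or> L = snd" for L
    proof -
      have sm: "smooth_on D (\<lambda>q. L (\<phi> q))"
        using L smooth_on_fst[OF open_D smooth] smooth_on_snd[OF open_D smooth] by auto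
      have smp: "smooth_on (\<phi> ` D) (\<lambda>q. L (push Y q))" if "smooth_on D Y" for Y
        using L smooth_on_fst[OF open_im vfieldsD(1)[OF push_vfields[OF that]]]
          smooth_on_snd[OF open_im vfieldsD(1)[OF push_vfields[OF that]]] by auto
      have one: "along A (along B (\<lambda>q. L (\<phi> q))) p = along (push A) (\<lambda>q. L (push B q)) (\<phi> p)"
        if "A \<in> vfields D" "B \<in> vfields D" for A B
      proof -
        have "along A (along B (\<lambda>q. L (\<phi> q))) p = along A (\<lambda>q. L (push B (\<phi> q))) p"
          using L that by (intro along_cong[OF open_D p(1)]
              smooth_differentiable[OF smooth_on_along[OF open_D vfieldsD(1) sm] p(1)])
            (auto simp: push_along)
        then show ?thesis using along_compose[OF smp[OF vfieldsD(1)[OF that(2)]] p(1), of A] by simp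
      qed
      show ?thesis
        unfolding along_lie_bracket[OF open_D v sm p(1)] one[OF v] one[OF v(2,1)] pw ..
    qed
    have "push (lie_bracket U Z W) q = push (lie_bracket D Z' W') q"
      using p br by (simp add: push_apply)
    also have "\<dots> = lie_bracket (\<phi> ` D) (push Z) (push W) q"
      using p comp[of fst] comp[of snd]
        lie_bracket_along[of q "\<phi> ` D", OF _ vfields_differentiable[OF push_vfields[OF smZ]]
          vfields_differentiable[OF push_vfields[OF smW]]]
      by (simp add: push_along)
    finally show ?thesis .
  qed
qed

end

text \<open>The Cartan formula \<open>d\<theta>(X, V) = X (\<theta> V) - V (\<theta> X) - \<theta> [X, V]\<close> in coordinates: a one-form \<open>a dx + b dy\<close>
  that is constant on each member of a commuting frame is closed.\<close>

lemma closed_one_form_of_commuting_frame: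
  fixes a b :: "real \<times> real \<Rightarrow> real"
  assumes B: "open B" "B \<subseteq> U" and X: "X \<in> vfields U" and V: "V \<in> vfields U"
    and comm: "lie_bracket U X V = 0"
    and indep: "\<And>p. p \<in> B \<Longrightarrow> fst (X p) * snd (V p) - snd (X p) * fst (V p) \<noteq> 0"
    and a: "smooth_on B a" and b: "smooth_on B b"
    and cX: "\<And>p. p \<in> B \<Longrightarrow> a p * fst (X p) + b p * snd (X p) = c"
    and cV: "\<And>p. p \<in> B \<Longrightarrow> a p * fst (V p) + b p * snd (V p) = d"
    and p: "p \<in> B"
  shows "dy a p = dx b p"
proof -
  note sm = smooth_on_subset[OF vfieldsD(1)[OF X] B(2)] smooth_on_subset[OF vfieldsD(1)[OF V] B(2)]
  have df: "a differentiable at p" "b differentiable at p"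
    "(\<lambda>q. fst (X q)) differentiable at p" "(\<lambda>q. snd (X q)) differentiable at p"
    "(\<lambda>q. fst (V q)) differentiable at p" "(\<lambda>q. snd (V q)) differentiable at p"
    by (intro smooth_differentiable[OF _ p] a b smooth_on_fst smooth_on_snd B(1) sm)+
  have e: "dx (\<lambda>q. a q * fst (Z q) + b q * snd (Z q)) p = dx a p * fst (Z p) + a p * dx (\<lambda>q. fst (Z q)) p
        + (dx b p * snd (Z p) + b p * dx (\<lambda>q. snd (Z q)) p)"
    "dy (\<lambda>q. a q * fst (Z q) + b q * snd (Z q)) p = dy a p * fst (Z p) + a p * dy (\<lambda>q. fst (Z q)) p
        + (dy b p * snd (Z p) + b p * dy (\<lambda>q. snd (Z q)) p)"
    if "(\<lambda>q. fst (Z q)) differentiable at p" "(\<lambda>q. snd (Z q)) differentiable at p" for Z :: vfield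
    using that df(1,2) by (simp_all add: dx_add dy_add dx_mult dy_mult differentiable_mult)
  have z: "dx (\<lambda>q. a q * fst (Z q) + b q * snd (Z q)) p = 0" "dy (\<lambda>q. a q * fst (Z q) + b q * snd (Z q)) p = 0"
    if "(\<lambda>q. fst (Z q)) differentiable at p" "(\<lambda>q. snd (Z q)) differentiable at p"
      "\<And>q. q \<in> B \<Longrightarrow> a q * fst (Z q) + b q * snd (Z q) = k" for Z :: vfield and k
    using dx_cong[OF B(1) p that(3)] dy_cong[OF B(1) p that(3)] that(1,2) df(1,2)
    by (simp_all add: differentiable_mult differentiable_add)
  note zX = z[OF df(3,4) cX, unfolded e[OF df(3,4)]] and zV = z[OF df(5,6) cV, unfolded e[OF df(5,6)]]
  have "p \<in> U" using p B by auto
  then have br: "along X (\<lambda>q. fst (V q)) p = along V (\<lambda>q. fst (X q)) p"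
    "along X (\<lambda>q. snd (V q)) p = along V (\<lambda>q. snd (X q)) p"
    using lie_bracket_along[of p U X V] vfields_differentiable[OF X] vfields_differentiable[OF V] comm
    by (simp_all add: prod_eq_iff)
  have "(fst (X p) * snd (V p) - snd (X p) * fst (V p)) * (dy a p - dx b p) =
     (fst (V p) * (dx a p * fst (X p) + a p * dx (\<lambda>q. fst (X q)) p + (dx b p * snd (X p) + b p * dx (\<lambda>q. snd (X q)) p))
     + snd (V p) * (dy a p * fst (X p) + a p * dy (\<lambda>q. fst (X q)) p + (dy b p * snd (X p) + b p * dy (\<lambda>q. snd (X q)) p)))
    - (fst (X p) * (dx a p * fst (V p) + a p * dx (\<lambda>q. fst (V q)) p + (dx b p * snd (V p) + b p * dx (\<lambda>q. snd (V q)) p))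
     + snd (X p) * (dy a p * fst (V p) + a p * dy (\<lambda>q. fst (V q)) p + (dy b p * snd (V p) + b p * dy (\<lambda>q. snd (V q)) p)))
    + a p * (along X (\<lambda>q. fst (V q)) p - along V (\<lambda>q. fst (X q)) p)
    + b p * (along X (\<lambda>q. snd (V q)) p - along V (\<lambda>q. snd (X q)) p)"
    unfolding along_def by algebra
  also have "\<dots> = 0" using zX zV br by simp
  finally show ?thesis using indep[OF p] by simp
qed

text \<open>The coordinates are primitives of the two one-forms dual to the frame, which are closed by the
  previous lemma.\<close>

theorem canonical_coordinates_exist:
  assumes U: "open U" and X: "X \<in> vfields U" and V: "V \<in> vfields U"
    and comm: "lie_bracket U X V = 0" and p: "p \<in> U"
    and indep: "fst (X p) * snd (V p) - snd (X p) * fst (V p) \<noteq> 0"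
  obtains D \<phi> where "p \<in> D" "D \<subseteq> U" "canonical_coordinates D \<phi> X V"
proof -
  define \<Delta> where "\<Delta> = (\<lambda>p. fst (X p) * snd (V p) - snd (X p) * fst (V p))"
  note smU = smooth_on_fst[OF U vfieldsD(1)[OF X]] smooth_on_snd[OF U vfieldsD(1)[OF X]]
    smooth_on_fst[OF U vfieldsD(1)[OF V]] smooth_on_snd[OF U vfieldsD(1)[OF V]]
  have sm\<Delta>: "smooth_on U \<Delta>" unfolding \<Delta>_def by (intro smooth_on_diff smooth_on_mult U smU)
  have "open (U \<inter> \<Delta> -` (- {0}))"
    by (rule continuous_open_preimage[OF smooth_continuous_on[OF sm\<Delta>] U]) auto
  moreover have "p \<in> U \<inter> \<Delta> -` (- {0})" using p indep by (simp add: \<Delta>_def)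
  ultimately obtain e where e: "e > 0" "ball p e \<subseteq> U \<inter> \<Delta> -` (- {0})"
    by (rule openE)
  define B where "B = ball p e"
  have B: "open B" "convex B" "p \<in> B" "B \<subseteq> U" and nz: "\<And>q. q \<in> B \<Longrightarrow> \<Delta> q \<noteq> 0"
    using e by (auto simp: B_def)
  note sm = smU[THEN smooth_on_subset, OF B(4)] smooth_on_subset[OF sm\<Delta> B(4)]
  define a1 where "a1 = (\<lambda>p. snd (V p) / \<Delta> p)"
  define b1 where "b1 = (\<lambda>p. - fst (V p) / \<Delta> p)"
  define a2 where "a2 = (\<lambda>p. - snd (X p) / \<Delta> p)"
  define b2 where "b2 = (\<lambda>p. fst (X p) / \<Delta> p)"
  have ab: "smooth_on B a1" "smooth_on B b1" "smooth_on B a2" "smooth_on B b2"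
    unfolding a1_def b1_def a2_def b2_def by (intro smooth_on_divide smooth_on_minus B(1) sm nz; assumption)+
  have dual: "a1 q * fst (X q) + b1 q * snd (X q) = 1" "a1 q * fst (V q) + b1 q * snd (V q) = 0"
    "a2 q * fst (X q) + b2 q * snd (X q) = 0" "a2 q * fst (V q) + b2 q * snd (V q) = 1" if "q \<in> B" for q
    using nz[OF that] by (simp_all add: a1_def b1_def a2_def b2_def field_simps) (simp_all add: \<Delta>_def algebra_simps)
  have dual': "(fst v * a1 q + snd v * b1 q) *\<^sub>R X q + (fst v * a2 q + snd v * b2 q) *\<^sub>R V q = v" if "q \<in> B" for q v
    using nz[OF that]
    by (simp add: a1_def b1_def a2_def b2_def field_simps prod_eq_iff) (simp add: \<Delta>_def algebra_simps)
  have ind: "fst (X q) * snd (V q) - snd (X q) * fst (V q) \<noteq> 0" if "q \<in> B" for q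
    using nz[OF that] by (simp add: \<Delta>_def)
  note cl = closed_one_form_of_commuting_frame[OF B(1,4) X V comm]
  obtain f1 where f1: "smooth_on B f1" "\<And>q. q \<in> B \<Longrightarrow> dx f1 q = a1 q" "\<And>q. q \<in> B \<Longrightarrow> dy f1 q = b1 q"
    by (rule poincare_lemma_plane[OF B(1,2,3) ab(1,2) cl[OF ind ab(1,2) dual(1,2)]]) blast+
  obtain f2 where f2: "smooth_on B f2" "\<And>q. q \<in> B \<Longrightarrow> dx f2 q = a2 q" "\<And>q. q \<in> B \<Longrightarrow> dy f2 q = b2 q"
    by (rule poincare_lemma_plane[OF B(1,2,3) ab(3,4) cl[OF ind ab(3,4) dual(3,4)]]) blast+
  define \<phi> where "\<phi> = (\<lambda>q. (f1 q, f2 q))"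
  define A where "A = (\<lambda>q v. (fst v * a1 q + snd v * b1 q, fst v * a2 q + snd v * b2 q))"
  have sm\<phi>: "smooth_on B \<phi>" unfolding \<phi>_def by (rule smooth_on_Pair[OF B(1) f1(1) f2(1)])
  have der: "(\<phi> has_derivative A q) (at q)" if "q \<in> B" for q
    unfolding \<phi>_def A_def
    using has_derivative_Pair[OF has_derivative_partials[OF smooth_differentiable[OF f1(1) that]]
        has_derivative_partials[OF smooth_differentiable[OF f2(1) that]]]
    by (simp add: f1 f2 that)
  have blA: "bounded_linear (A q)" if "q \<in> B" for q
    by (rule has_derivative_bounded_linear[OF der[OF that]])
  have blinv: "bounded_linear (\<lambda>w. fst w *\<^sub>R X q + snd w *\<^sub>R V q)" for q
    by (intro bounded_linear_add bounded_linear_compose[OF bounded_linear_scaleR_left bounded_linear_fst]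
        bounded_linear_compose[OF bounded_linear_scaleR_left bounded_linear_snd])
  define f' where "f' = (\<lambda>q. Blinfun (A q))"
  have f': "blinfun_apply (f' q) = A q" if "q \<in> B" for q
    by (simp add: f'_def bounded_linear_Blinfun_apply blA that)
  have cA: "continuous_on B (\<lambda>q. A q i)" for i
    unfolding A_def by (intro continuous_intros ab[THEN smooth_continuous_on])
  have contf': "continuous_on B f'"
    by (rule continuous_on_blinfun_componentwise) (use cA in \<open>simp add: f' cong: continuous_on_cong\<close>)
  have invf: "Blinfun (\<lambda>w. fst w *\<^sub>R X p + snd w *\<^sub>R V p) o\<^sub>L f' p = id_blinfun"
    by (rule blinfun_eqI) (simp add: f' B bounded_linear_Blinfun_apply[OF blinv] A_def dual')
  have der': "(\<phi> has_derivative blinfun_apply (f' q)) (at q)" if "q \<in> B" for q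
    using der[OF that] f'[OF that] by simp
  obtain U' V' g g' where g: "open U'" "U' \<subseteq> B" "p \<in> U'" "open V'" "\<phi> p \<in> V'" "homeomorphism U' V' \<phi> g"
    and dg: "\<And>y. y \<in> V' \<Longrightarrow> (g has_derivative (g' y)) (at y)"
    and g': "\<And>y. y \<in> V' \<Longrightarrow> g' y = inv (blinfun_apply (f' (g y)))"
      "\<And>y. y \<in> V' \<Longrightarrow> bij (blinfun_apply (f' (g y)))"
    by (rule inverse_function_theorem[OF B(1) der' contf' B(3) invf]) blast+
  note hom = g(6)[unfolded homeomorphism_def]
  have gB: "g y \<in> B" if "y \<in> V'" for y using hom that g(2) by auto
  have g'_eq: "g' y = (\<lambda>w. fst w *\<^sub>R X (g y) + snd w *\<^sub>R V (g y))" if "y \<in> V'" for y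
  proof
    fix w
    have "A (g y) (fst w *\<^sub>R X (g y) + snd w *\<^sub>R V (g y)) = w"
      using dual[OF gB[OF that]] unfolding A_def by (simp add: prod_eq_iff) algebra
    then show "g' y w = fst w *\<^sub>R X (g y) + snd w *\<^sub>R V (g y)"
      using g'[OF that] f'[OF gB[OF that]] by (metis bij_is_inj inv_f_f)
  qed
  \<comment> \<open>each derivative of the inverse is a combination of the frame, composed with the inverse\<close>
  have smg: "C_k_on k V' g" for k
  proof (induction k)
    case 0
    then show ?case using hom by simp
  next
    case (Suc k)
    have sub: "g ` V' \<subseteq> B" using gB by auto
    have c: "C_k_on k V' (\<lambda>y. Z (g y))" if "Z \<in> vfields U" for Z
      by (rule C_k_on_compose[OF g(4) B(1) sub Suc])
        (use smooth_on_subset[OF vfieldsD(1)[OF that] B(4)] in \<open>simp add: smooth_on_def\<close>)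
    show ?case
    proof (rule C_k_on_SucI[OF g(4)])
      show "(g has_derivative (\<lambda>w. fst w *\<^sub>R X (g y) + snd w *\<^sub>R V (g y))) (at y)" if "y \<in> V'" for y
        using dg[OF that] g'_eq[OF that] by simp
      show "C_k_on k V' (\<lambda>y. fst w *\<^sub>R X (g y) + snd w *\<^sub>R V (g y))" for w
        by (intro C_k_on_add[OF g(4)] C_k_on_bilinear[OF g(4) bounded_bilinear_scaleR] C_k_on_const c X V)
    qed
  qed
  obtain r where r: "r > 0" "ball p r \<subseteq> U'" using openE[OF g(1,3)] by blast
  define D where "D = ball p r"
  have D: "open D" "connected D" "p \<in> D" "D \<subseteq> U'" "D \<subseteq> B"
    using r g(2) by (auto simp: D_def convex_connected)
  have im: "\<phi> ` D = V' \<inter> g -` D" using hom D(4) by force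
  have "open (V' \<inter> g -` D)"
    using hom by (intro continuous_open_preimage g D) auto
  moreover have inj: "inj_on \<phi> D" using hom D(4) by (metis inj_on_inverseI subsetD)
  moreover have "smooth_on (\<phi> ` D) (inv_into D \<phi>)"
  proof (rule smooth_on_cong)
    show "open (\<phi> ` D)" using calculation im by simp
    show "g q = inv_into D \<phi> q" if "q \<in> \<phi> ` D" for q
      using that inj hom D(4) by auto
    show "smooth_on (\<phi> ` D) g"
      using smg im by (auto simp: smooth_on_def intro: C_k_on_subset)
  qed
  ultimately have "is_chart D \<phi>"
    using D smooth_on_subset[OF sm\<phi>] im by (simp add: is_chart_def)
  moreover have "pushforward D \<phi> X q = (1, 0) \<and> pushforward D \<phi> V q = (0, 1)" if q: "q \<in> \<phi> ` D" for q
  proof -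
    have i: "inv_into D \<phi> q \<in> B" using inv_into_into[OF q] D(5) by auto
    show ?thesis
      using dual[OF i] q
      by (simp add: pushforward_def frechet_derivative_at[OF der[OF i], symmetric] A_def mult.commute)
  qed
  ultimately show thesis
    using that[of D \<phi>] D B by (auto simp: canonical_coordinates_def)
qed

lemma dim_span_values_2_imp_det:
  fixes X V :: vfield
  assumes "dim {Z p |Z. Z \<in> span {X, V}} = 2"
  shows "fst (X p) * snd (V p) - snd (X p) * fst (V p) \<noteq> 0"
proof
  assume det: "fst (X p) * snd (V p) - snd (X p) * fst (V p) = 0"
  obtain w \<alpha> \<beta> where w: "X p = \<alpha> *\<^sub>R w" "V p = \<beta> *\<^sub>R w"
  proof (cases "X p = 0")
    case True
    then show thesis using that[of 0 "V p" 1] by simp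
  next
    case False
    then consider "fst (X p) \<noteq> 0" | "snd (X p) \<noteq> 0" by (auto simp: prod_eq_iff)
    then show thesis
    proof cases
      case 1
      then have "V p = (fst (V p) / fst (X p)) *\<^sub>R X p" using det by (simp add: prod_eq_iff field_simps)
      then show thesis using that[of 1 "X p"] by simp
    next
      case 2
      then have "V p = (snd (V p) / snd (X p)) *\<^sub>R X p" using det by (simp add: prod_eq_iff field_simps)
      then show thesis using that[of 1 "X p"] by simp
    qed
  qed
  have "linear (\<lambda>Z :: vfield. Z p)"
    by (rule linearI) (simp_all add: plus_fun_def scaleR_fun_def)
  then have "{Z p |Z. Z \<in> span {X, V}} = span {X p, V p}"
    using linear_span_image[of "\<lambda>Z. Z p" "{X, V}"] by (simp add: Setcompr_eq_image)
  also have "\<dots> \<subseteq> span {w}"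
    by (rule span_minimal) (auto simp: w intro: span_scale span_base)
  finally have "dim {Z p |Z. Z \<in> span {X, V}} \<le> card {w}"
    by (intro dim_le_card) auto
  then show False using assms by simp
qed

section \<open>Prolongation as an algebra of jet functions\<close>

text \<open>Prolongation coefficients are polynomials in the jet coordinates whose coefficients are functions
  of \<open>(x, y)\<close>. They are represented by expressions: partial and total derivatives are then computed by
  recursion on the expression, and differentiability in each jet coordinate comes for free. The
  coordinate \<open>u\<^sub>0 = y\<close> enters coefficient functions, so its partial derivative acts on \<open>Fn g\<close>.\<close>

datatype jexp = Fn "real \<times> real \<Rightarrow> real" | Coord nat | Plus jexp jexp | Times jexp jexp

primrec jev :: "jexp \<Rightarrow> jet \<Rightarrow> real" where
  "jev (Fn g) z = g (fst z, snd z 0)"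
| "jev (Coord j) z = snd z j"
| "jev (Plus a b) z = jev a z + jev b z"
| "jev (Times a b) z = jev a z * jev b z"

primrec jdx :: "jexp \<Rightarrow> jexp" where
  "jdx (Fn g) = Fn (dx g)"
| "jdx (Coord j) = Fn (\<lambda>_. 0)"
| "jdx (Plus a b) = Plus (jdx a) (jdx b)"
| "jdx (Times a b) = Plus (Times (jdx a) b) (Times a (jdx b))"

primrec jdu :: "nat \<Rightarrow> jexp \<Rightarrow> jexp" where
  "jdu k (Fn g) = Fn (if k = 0 then dy g else (\<lambda>_. 0))"
| "jdu k (Coord j) = Fn (\<lambda>_. if j = k then 1 else 0)"
| "jdu k (Plus a b) = Plus (jdu k a) (jdu k b)"
| "jdu k (Times a b) = Plus (Times (jdu k a) b) (Times a (jdu k b))"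

primrec jD :: "jexp \<Rightarrow> jexp" where
  "jD (Fn g) = Plus (Fn (dx g)) (Times (Coord (Suc 0)) (Fn (dy g)))"
| "jD (Coord j) = Coord (Suc j)"
| "jD (Plus a b) = Plus (jD a) (jD b)"
| "jD (Times a b) = Plus (Times (jD a) b) (Times a (jD b))"

primrec jsmooth :: "(real \<times> real) set \<Rightarrow> jexp \<Rightarrow> bool" where
  "jsmooth D (Fn g) \<longleftrightarrow> smooth_on D g"
| "jsmooth D (Coord j) \<longleftrightarrow> True"
| "jsmooth D (Plus a b) \<longleftrightarrow> jsmooth D a \<and> jsmooth D b"
| "jsmooth D (Times a b) \<longleftrightarrow> jsmooth D a \<and> jsmooth D b"

primrec jorder :: "jexp \<Rightarrow> nat" where
  "jorder (Fn g) = 0"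
| "jorder (Coord j) = j"
| "jorder (Plus a b) = max (jorder a) (jorder b)"
| "jorder (Times a b) = max (jorder a) (jorder b)"

lemma jsmooth_jdu: "jsmooth D e \<Longrightarrow> jsmooth D (jdu k e)"
  by (induction e) (auto intro: smooth_on_dy smooth_on_const)

lemma jsmooth_jD: "jsmooth D e \<Longrightarrow> jsmooth D (jD e)"
  by (induction e) (auto intro: smooth_on_dx smooth_on_dy)

lemma jorder_jD: "jorder (jD e) \<le> Suc (jorder e)"
  by (induction e) auto

lemma jdu_above_order: "jorder e < k \<Longrightarrow> jev (jdu k e) z = 0"
  by (induction e) auto

lemma jets_overD: "(x, u) \<in> jets_over D \<Longrightarrow> (x, u 0) \<in> D"
  by (simp add: jets_over_def)

lemma DERIV_jev_x:
  assumes "jsmooth D e" "(x, u) \<in> jets_over D"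
  shows "((\<lambda>t. jev e (t, u)) has_real_derivative jev (jdx e) (x, u)) (at x)"
  using assms(1)
proof (induction e)
  case (Fn g)
  then show ?case
    using DERIV_fst_arg[OF smooth_differentiable[OF _ jets_overD[OF assms(2)]]] by simp
next
  case (Times a b)
  then have "jsmooth D a" "jsmooth D b" by simp_all
  from DERIV_mult[OF Times.IH(1)[OF this(1)] Times.IH(2)[OF this(2)]]
  show ?case by (simp add: algebra_simps)
qed (auto intro: DERIV_add)

lemma DERIV_jev_u:
  assumes "jsmooth D e" "(x, u) \<in> jets_over D"
  shows "((\<lambda>t. jev e (x, u(k := t))) has_real_derivative jev (jdu k e) (x, u)) (at (u k))"
  using assms(1)
proof (induction e)
  case (Fn g)
  then show ?case
    using DERIV_snd_arg[OF smooth_differentiable[OF _ jets_overD[OF assms(2)]]] by simp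
next
  case (Times a b)
  then have "jsmooth D a" "jsmooth D b" by simp_all
  from DERIV_mult[OF Times.IH(1)[OF this(1)] Times.IH(2)[OF this(2)]]
  show ?case by (simp add: algebra_simps)
qed (auto intro: DERIV_add)

lemma open_jets_over:
  assumes "open D"
  shows "open (jets_over D)"
proof -
  have "continuous_on UNIV (\<lambda>z :: jet. (fst z, snd z 0))"
    by (intro continuous_on_Pair continuous_on_fst continuous_on_id
        continuous_on_product_then_coordinatewise[OF continuous_on_snd[OF continuous_on_id]])
  moreover have "jets_over D = (\<lambda>z. (fst z, snd z 0)) -` D" by (auto simp: jets_over_def)
  ultimately show ?thesis using open_vimage[OF assms] by simp
qed

context
  fixes \<Omega> :: "jet set" and F G :: "jet \<Rightarrow> real"
  assumes \<Omega>: "open \<Omega>" and FG: "\<And>z. z \<in> \<Omega> \<Longrightarrow> F z = G z"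
begin

lemma pdx_cong:
  assumes "(x, u) \<in> \<Omega>"
  shows "pdx F (x, u) = pdx G (x, u)"
proof -
  have "open ((\<lambda>t. (t, u)) -` \<Omega>)" using \<Omega> by (intro open_vimage continuous_intros) auto
  then have "\<forall>\<^sub>F t in nhds x. t \<in> (\<lambda>t. (t, u)) -` \<Omega>"
    using assms by (intro eventually_nhds_in_open) auto
  then have "\<forall>\<^sub>F t in nhds x. F (t, u) = G (t, u)"
    by eventually_elim (simp add: FG)
  then show ?thesis by (simp add: pdx_def deriv_cong_ev)
qed

lemma pdu_cong:
  assumes "(x, u) \<in> \<Omega>"
  shows "pdu k F (x, u) = pdu k G (x, u)"
proof -
  have "continuous_on UNIV (\<lambda>t. (u(k := t)) i)" for i
    by (cases "i = k") (auto intro: continuous_on_id)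
  then have "continuous_on UNIV (\<lambda>t. (x, u(k := t)))"
    by (intro continuous_on_Pair continuous_on_const continuous_on_coordinatewise_then_product)
  from open_vimage[OF \<Omega> this] have "\<forall>\<^sub>F t in nhds (u k). t \<in> (\<lambda>t. (x, u(k := t))) -` \<Omega>"
    using assms by (intro eventually_nhds_in_open) auto
  then have "\<forall>\<^sub>F t in nhds (u k). F (x, u(k := t)) = G (x, u(k := t))"
    by eventually_elim (simp add: FG)
  then show ?thesis by (simp add: pdu_def deriv_cong_ev)
qed

lemma prolong_cong: "z \<in> \<Omega> \<Longrightarrow> prolong N Z F z = prolong N Z G z"
  by (cases z) (simp add: prolong_def pdx_cong pdu_cong)

end

lemma total_deriv_cong:
  assumes "open D" "z \<in> jets_over D" "\<And>z. z \<in> jets_over D \<Longrightarrow> F z = G z"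
  shows "total_deriv m F z = total_deriv m G z"
  using assms(2) pdx_cong[OF open_jets_over[OF assms(1)] assms(3)]
    pdu_cong[OF open_jets_over[OF assms(1)] assms(3)]
  by (cases z) (simp add: total_deriv_def)

lemma jev_jD:
  assumes "jorder e \<le> m"
  shows "jev (jD e) z = jev (jdx e) z + (\<Sum>k\<le>m. snd z (Suc k) * jev (jdu k e) z)"
  using assms
proof (induction e)
  case (Fn g)
  have "(\<Sum>k\<le>m. snd z (Suc k) * (if k = 0 then dy g else (\<lambda>_. 0)) (fst z, snd z 0))
    = (\<Sum>k\<le>m. if k = 0 then snd z (Suc 0) * dy g (fst z, snd z 0) else 0)"
    by (rule sum.cong) auto
  then show ?case by simp
next
  case (Coord j)
  have "(\<Sum>k\<le>m. snd z (Suc k) * (if j = k then 1 else 0)) = (\<Sum>k\<le>m. if k = j then snd z (Suc j) else 0)"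
    by (rule sum.cong) auto
  then show ?case using Coord by simp
next
  case (Plus a b)
  then show ?case by (simp add: algebra_simps sum.distrib)
next
  case (Times a b)
  then show ?case by (simp add: algebra_simps sum.distrib sum_distrib_left sum_distrib_right)
qed

text \<open>The total derivative of a function only depends on its values over the open set \<open>D\<close>, so it can be
  computed from any expression that represents the function there.\<close>

lemma total_deriv_jev:
  assumes "open D" "jsmooth D e" "jorder e \<le> m" "z \<in> jets_over D"
    and "\<And>z. z \<in> jets_over D \<Longrightarrow> F z = jev e z"
  shows "total_deriv m F z = jev (jD e) z"
proof -
  obtain x u where z: "z = (x, u)" by force
  have "total_deriv m F z = total_deriv m (jev e) z"
    by (rule total_deriv_cong[OF assms(1,4,5)])
  also have "\<dots> = jev (jD e) z"
    unfolding jev_jD[OF assms(3)]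
    using DERIV_imp_deriv[OF DERIV_jev_x[OF assms(2)]] DERIV_imp_deriv[OF DERIV_jev_u[OF assms(2)]] assms(4)
    by (simp add: z total_deriv_def pdx_def pdu_def)
  finally show ?thesis .
qed

lemma jev_jD_cong:
  assumes "open D" "jsmooth D a" "jsmooth D b" "\<And>z. z \<in> jets_over D \<Longrightarrow> jev a z = jev b z"
    and "z \<in> jets_over D"
  shows "jev (jD a) z = jev (jD b) z"
  using total_deriv_jev[OF assms(1,2) _ assms(5), of "max (jorder a) (jorder b)" "jev a"]
    total_deriv_jev[OF assms(1,3) _ assms(5), of "max (jorder a) (jorder b)" "jev a"] assms(4)
  by simp

text \<open>The commutation relation \<open>[\<partial>/\<partial>u\<^sub>j\<^sub>+\<^sub>1, D] = \<partial>/\<partial>u\<^sub>j\<close> for the total derivative \<open>D\<close>.\<close>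

lemma jdu_jD_commute: "jev (jdu (Suc j) (jD e)) z = jev (jD (jdu (Suc j) e)) z + jev (jdu j e) z"
  by (induction e) (auto simp: algebra_simps)

primrec jprolong :: "(real \<times> real \<Rightarrow> real) \<Rightarrow> (real \<times> real \<Rightarrow> real) \<Rightarrow> nat \<Rightarrow> jexp" where
  "jprolong \<xi> \<eta> 0 = Fn \<eta>"
| "jprolong \<xi> \<eta> (Suc k) =
     Plus (jD (jprolong \<xi> \<eta> k)) (Times (Fn (\<lambda>_. -1)) (Times (Coord (Suc k)) (jD (Fn \<xi>))))"

lemma jsmooth_jprolong: "smooth_on D \<xi> \<Longrightarrow> smooth_on D \<eta> \<Longrightarrow> jsmooth D (jprolong \<xi> \<eta> k)"
  by (induction k) (auto intro: jsmooth_jD smooth_on_const smooth_on_dx smooth_on_dy)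

lemma jorder_jprolong: "jorder (jprolong \<xi> \<eta> k) \<le> k"
  using order_trans[OF jorder_jD] by (induction k) auto

lemma prolong_coeff_jev:
  assumes D: "open D" and Z: "Z \<in> vfields D" and z: "z \<in> jets_over D"
  shows "prolong_coeff Z k z = jev (jprolong (\<lambda>p. fst (Z p)) (\<lambda>p. snd (Z p)) k) z"
  using z
proof (induction k arbitrary: z)
  case 0
  then show ?case by (cases z) simp
next
  case (Suc k)
  note sm = smooth_on_fst[OF D vfieldsD(1)[OF Z]] smooth_on_snd[OF D vfieldsD(1)[OF Z]]
  have "total_deriv k (prolong_coeff Z k) z = jev (jD (jprolong (\<lambda>p. fst (Z p)) (\<lambda>p. snd (Z p)) k)) z"
    by (rule total_deriv_jev[OF D jsmooth_jprolong[OF sm] jorder_jprolong Suc.prems Suc.IH])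
  moreover have "total_deriv 0 (\<lambda>(x, u). fst (Z (x, u 0))) z = jev (jD (Fn (\<lambda>p. fst (Z p)))) z"
    by (rule total_deriv_jev[OF D _ _ Suc.prems]) (auto simp: sm split_beta)
  ultimately show ?case by (cases z) simp
qed

context
  fixes D :: "(real \<times> real) set" and \<xi> \<eta> :: "real \<times> real \<Rightarrow> real"
  assumes D: "open D" and \<xi>: "smooth_on D \<xi>" and \<eta>: "smooth_on D \<eta>"
begin

text \<open>By the commutation relation, \<open>\<partial>/\<partial>u\<^sub>k\<^sub>+\<^sub>1\<close> of the coefficient of order \<open>k + 1\<close> is \<open>\<partial>/\<partial>u\<^sub>k\<close> of the one of
  order \<open>k\<close> minus the total derivative of \<open>\<xi>\<close>. Only in the first step does \<open>u\<^sub>k\<^sub>+\<^sub>1\<close> also occur in that total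
  derivative, whence the factor \<open>k + 2\<close> rather than \<open>k + 1\<close> of the last term.\<close>

lemma jprolong_top_coeff:
  assumes "(x, u) \<in> jets_over D"
  shows "jev (jdu (Suc k) (jprolong \<xi> \<eta> (Suc k))) (x, u) =
    dy \<eta> (x, u 0) - real (Suc k) * dx \<xi> (x, u 0) - real (Suc (Suc k)) * u 1 * dy \<xi> (x, u 0)"
proof (induction k)
  case 0
  then show ?case by (simp add: algebra_simps)
next
  case (Suc k)
  have "jev (jD (jdu (Suc (Suc k)) (jprolong \<xi> \<eta> (Suc k)))) (x, u) = jev (jD (Fn (\<lambda>_. 0))) (x, u)"
    by (rule jev_jD_cong[OF D jsmooth_jdu[OF jsmooth_jprolong[OF \<xi> \<eta>]] _ _ assms])
      (use jdu_above_order[OF order.strict_trans1[OF jorder_jprolong lessI]] in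
        \<open>auto simp: smooth_on_const simp del: jprolong.simps\<close>)
  then have "jev (jdu (Suc (Suc k)) (jD (jprolong \<xi> \<eta> (Suc k)))) (x, u)
      = jev (jdu (Suc k) (jprolong \<xi> \<eta> (Suc k))) (x, u)"
    unfolding jdu_jD_commute by simp
  moreover have "jev (jdu (Suc (Suc k)) (jprolong \<xi> \<eta> (Suc (Suc k)))) (x, u)
      = jev (jdu (Suc (Suc k)) (jD (jprolong \<xi> \<eta> (Suc k)))) (x, u) - (dx \<xi> (x, u 0) + u 1 * dy \<xi> (x, u 0))"
    by (subst jprolong.simps) (simp add: algebra_simps)
  ultimately show ?case using Suc.IH by (simp add: algebra_simps)
qed

text \<open>Of the coefficient of \<open>u\<^sub>k\<close> in the prolongation of order \<open>k + 1\<close>, the part that contains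
  \<open>u\<^sub>2\<close> and the part that is linear in \<open>u\<^sub>1\<close> are determined. They give the determining equations
  \<open>\<xi>\<^sub>y = 0\<close> and \<open>\<eta>\<^sub>y\<^sub>y = 0\<close>.\<close>

lemma jprolong_second_coeff:
  "\<exists>f0 f2 c K. K > 0 \<and> (\<forall>x u. (x, u) \<in> jets_over D \<longrightarrow>
     jev (jdu (Suc k) (jprolong \<xi> \<eta> (Suc (Suc k)))) (x, u) =
       f0 (x, u 0) + u 1 * (real (Suc (Suc k)) * dy (dy \<eta>) (x, u 0) + c * dx (dy \<xi>) (x, u 0))
       + (u 1)\<^sup>2 * f2 (x, u 0) - K * u 2 * dy \<xi> (x, u 0))"
proof -
  define A where "A = (\<lambda>k. Plus (Fn (\<lambda>p. dy \<eta> p - real (Suc k) * dx \<xi> p))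
      (Times (Coord (Suc 0)) (Fn (\<lambda>p. - (real (Suc (Suc k)) * dy \<xi> p)))))"
  define g1 where "g1 = (\<lambda>k p. dx (\<lambda>p. dy \<eta> p - real (Suc k) * dx \<xi> p) p)"
  define g2 where "g2 = (\<lambda>k p. dy (\<lambda>p. - (real (Suc (Suc k)) * dy \<xi> p)) p)"
  note sm = smooth_on_dx[OF \<xi>] smooth_on_dy[OF \<xi>] smooth_on_dx[OF \<eta>] smooth_on_dy[OF \<eta>]
  have smA: "jsmooth D (A k)" for k
    unfolding A_def jsmooth.simps by (intro conjI TrueI smooth_on_diff smooth_on_minus smooth_on_mult smooth_on_const D sm)
  have step: "jev (jD (jdu (Suc k) (jprolong \<xi> \<eta> (Suc k)))) (x, u) =
      g1 k (x, u 0) + u 1 * (dy (dy \<eta>) (x, u 0) - (2 * real k + 3) * dx (dy \<xi>) (x, u 0))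
       + (u 1)\<^sup>2 * g2 k (x, u 0) - real (Suc (Suc k)) * u 2 * dy \<xi> (x, u 0)"
    if xu: "(x, u) \<in> jets_over D" for x u k
  proof -
    have "jev (jD (jdu (Suc k) (jprolong \<xi> \<eta> (Suc k)))) (x, u) = jev (jD (A k)) (x, u)"
      by (rule jev_jD_cong[OF D jsmooth_jdu[OF jsmooth_jprolong[OF \<xi> \<eta>]] smA _ xu])
        (auto simp: A_def jprolong_top_coeff simp del: jprolong.simps)
    note df = sm[THEN smooth_differentiable, OF jets_overD[OF xu]]
    have 1: "dy (\<lambda>p. dy \<eta> p - real (Suc k) * dx \<xi> p) (x, u 0)
        = dy (dy \<eta>) (x, u 0) - real (Suc k) * dx (dy \<xi>) (x, u 0)"
      using df dx_dy_commute[OF D \<xi> jets_overD[OF xu]]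
      by (subst dy_diff) (auto simp: dy_mult differentiable_mult)
    have 2: "dx (\<lambda>p. - (real (Suc (Suc k)) * dy \<xi> p)) (x, u 0) = - (real (Suc (Suc k)) * dx (dy \<xi>) (x, u 0))"
      using df by (subst dx_minus) (auto simp: dx_mult differentiable_mult)
    have "jev (jD (A k)) (x, u) = g1 k (x, u 0)
      + u 1 * dy (\<lambda>p. dy \<eta> p - real (Suc k) * dx \<xi> p) (x, u 0)
      + (u 2 * - (real (Suc (Suc k)) * dy \<xi> (x, u 0))
        + u 1 * (dx (\<lambda>p. - (real (Suc (Suc k)) * dy \<xi> p)) (x, u 0) + u 1 * g2 k (x, u 0)))"
      unfolding A_def g1_def g2_def by (simp add: numeral_2_eq_2)
    also have "\<dots> = g1 k (x, u 0) + u 1 * (dy (dy \<eta>) (x, u 0) - (2 * real k + 3) * dx (dy \<xi>) (x, u 0))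
       + (u 1)\<^sup>2 * g2 k (x, u 0) - real (Suc (Suc k)) * u 2 * dy \<xi> (x, u 0)"
      unfolding 1 2 by (simp add: algebra_simps power2_eq_square)
    finally show ?thesis using \<open>jev (jD (jdu _ _)) _ = _\<close> by simp
  qed
  show ?thesis
  proof (induction k)
    case 0
    have "jev (jdu (Suc 0) (jprolong \<xi> \<eta> (Suc (Suc 0)))) (x, u) =
       (g1 0 (x, u 0) + dy (dx \<eta>) (x, u 0)) + u 1 * (real (Suc (Suc 0)) * dy (dy \<eta>) (x, u 0) + (-4) * dx (dy \<xi>) (x, u 0))
       + (u 1)\<^sup>2 * (g2 0 (x, u 0) - dy (dy \<xi>) (x, u 0)) - 3 * u 2 * dy \<xi> (x, u 0)"
      if xu: "(x, u) \<in> jets_over D" for x u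
    proof -
      have "jev (jdu (Suc 0) (jprolong \<xi> \<eta> (Suc (Suc 0)))) (x, u) =
        jev (jD (jdu (Suc 0) (jprolong \<xi> \<eta> (Suc 0)))) (x, u)
        + jev (jdu 0 (jprolong \<xi> \<eta> (Suc 0))) (x, u) - u 2 * dy \<xi> (x, u 0)"
        by (subst jprolong.simps(2), subst jdu.simps(3), subst jev.simps(3), subst jdu_jD_commute)
          (simp add: numeral_2_eq_2)
      moreover have "jev (jdu 0 (jprolong \<xi> \<eta> (Suc 0))) (x, u) = dy (dx \<eta>) (x, u 0)
          + u 1 * dy (dy \<eta>) (x, u 0) - u 1 * dx (dy \<xi>) (x, u 0) - (u 1)\<^sup>2 * dy (dy \<xi>) (x, u 0)"
        using dx_dy_commute[OF D \<xi> jets_overD[OF xu]] by (simp add: algebra_simps power2_eq_square)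
      ultimately show ?thesis unfolding step[OF xu] by (simp add: algebra_simps)
    qed
    then show ?case
      by (intro exI[of _ "\<lambda>p. g1 0 p + dy (dx \<eta>) p"] exI[of _ "\<lambda>p. g2 0 p - dy (dy \<xi>) p"] exI[of _ "-4"] exI[of _ 3])
        (simp del: jprolong.simps)
  next
    case (Suc k)
    then obtain f0 f2 c K where IH: "K > 0" "\<And>x u. (x, u) \<in> jets_over D \<Longrightarrow>
       jev (jdu (Suc k) (jprolong \<xi> \<eta> (Suc (Suc k)))) (x, u) =
       f0 (x, u 0) + u 1 * (real (Suc (Suc k)) * dy (dy \<eta>) (x, u 0) + c * dx (dy \<xi>) (x, u 0))
       + (u 1)\<^sup>2 * f2 (x, u 0) - K * u 2 * dy \<xi> (x, u 0)" by metis
    have "jev (jdu (Suc (Suc k)) (jprolong \<xi> \<eta> (Suc (Suc (Suc k))))) (x, u) =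
       (f0 (x, u 0) + g1 (Suc k) (x, u 0))
       + u 1 * (real (Suc (Suc (Suc k))) * dy (dy \<eta>) (x, u 0) + (c - (2 * real (Suc k) + 3)) * dx (dy \<xi>) (x, u 0))
       + (u 1)\<^sup>2 * (f2 (x, u 0) + g2 (Suc k) (x, u 0)) - (K + real (Suc (Suc (Suc k)))) * u 2 * dy \<xi> (x, u 0)"
      if xu: "(x, u) \<in> jets_over D" for x u
    proof -
      have "jev (jdu (Suc (Suc k)) (jprolong \<xi> \<eta> (Suc (Suc (Suc k))))) (x, u) =
        jev (jD (jdu (Suc (Suc k)) (jprolong \<xi> \<eta> (Suc (Suc k))))) (x, u)
        + jev (jdu (Suc k) (jprolong \<xi> \<eta> (Suc (Suc k)))) (x, u)"
        by (subst jprolong.simps(2), subst jdu.simps(3), subst jev.simps(3), subst jdu_jD_commute) simp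
      then show ?thesis unfolding step[OF xu] IH(2)[OF xu] by (simp add: algebra_simps)
    qed
    then show ?case
      using IH(1)
      by (intro exI[of _ "\<lambda>p. f0 p + g1 (Suc k) p"] exI[of _ "\<lambda>p. f2 p + g2 (Suc k) p"]
          exI[of _ "c - (2 * real (Suc k) + 3)"] exI[of _ "K + real (Suc (Suc (Suc k)))"])
        (simp del: jprolong.simps)
  qed
qed

end

section \<open>The symmetry algebra of the equation\<close>

lemma pdx_eqI: "((\<lambda>t. F (t, u)) has_real_derivative d) (at x) \<Longrightarrow> pdx F (x, u) = d"
  by (simp add: pdx_def DERIV_imp_deriv)

lemma pdu_eqI: "((\<lambda>t. F (x, u(k := t))) has_real_derivative d) (at (u k)) \<Longrightarrow> pdu k F (x, u) = d"
  by (simp add: pdu_def DERIV_imp_deriv)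

text \<open>For a field that preserves the fibration \<open>(x, y) \<mapsto> x\<close> and is affine on its fibres, the
  prolongation coefficients follow from the Leibniz rule. The families \<open>\<xi>\<close>, \<open>\<alpha>\<close> and \<open>\<beta>\<close> list the
  successive derivatives of functions of \<open>x\<close> alone.\<close>

lemma prolong_coeff_affine_fibres:
  fixes \<xi> \<alpha> \<beta> :: "nat \<Rightarrow> real \<times> real \<Rightarrow> real"
  assumes D: "open D"
    and \<xi>: "\<And>j p. p \<in> D \<Longrightarrow> (\<xi> j has_derivative (\<lambda>h. fst h * \<xi> (Suc j) p)) (at p)"
    and \<alpha>: "\<And>j p. p \<in> D \<Longrightarrow> (\<alpha> j has_derivative (\<lambda>h. fst h * \<alpha> (Suc j) p)) (at p)"
    and \<beta>: "\<And>j p. p \<in> D \<Longrightarrow> (\<beta> j has_derivative (\<lambda>h. fst h * \<beta> (Suc j) p)) (at p)"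
    and Z: "\<And>p. p \<in> D \<Longrightarrow> Z p = (\<xi> 0 p, \<alpha> 0 p * snd p + \<beta> 0 p)"
    and xu: "(x, u) \<in> jets_over D"
  shows "prolong_coeff Z k (x, u) =
    (\<Sum>j\<le>k. (real (k choose j) * \<alpha> j (x, u 0) - real (k choose Suc j) * \<xi> (Suc j) (x, u 0)) * u (k - j))
    + \<beta> k (x, u 0)"
  using xu
proof (induction k arbitrary: x u)
  case 0
  then show ?case using Z[OF jets_overD] by simp
next
  case (Suc k)
  define p where "p = (x, u 0)"
  have p: "p \<in> D" using jets_overD[OF Suc.prems] by (simp add: p_def)
  define c where "c = (\<lambda>j q. real (k choose j) * \<alpha> j q - real (k choose Suc j) * \<xi> (Suc j) q)"
  define c' where "c' = (\<lambda>j q. real (k choose j) * \<alpha> (Suc j) q - real (k choose Suc j) * \<xi> (Suc (Suc j)) q)"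
  define G where "G = (\<lambda>(x, u). (\<Sum>j\<le>k. c j (x, u (0::nat)) * u (k - j)) + \<beta> k (x, u 0))"
  have FG: "prolong_coeff Z k z = G z" if "z \<in> jets_over D" for z
    using Suc.IH[of "fst z" "snd z"] that by (simp add: G_def c_def split_beta)
  have dc: "(c j has_derivative (\<lambda>h. fst h * c' j p)) (at p)" for j
    unfolding c_def c'_def
    by (rule has_derivative_eq_rhs[OF has_derivative_diff[OF has_derivative_mult_right[OF \<alpha>[OF p]]
            has_derivative_mult_right[OF \<xi>[OF p]]]]) (simp add: fun_eq_iff algebra_simps)
  have parts: "((\<lambda>t. g (t, u 0)) has_real_derivative g') (at x)
      \<and> ((\<lambda>t. g (x, (u(i := t)) 0)) has_real_derivative 0) (at (u i))"
    if g: "(g has_derivative (\<lambda>h. fst h * g')) (at p)" for g g' i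
  proof -
    have d: "g differentiable at (x, u 0)" using g by (auto simp: differentiable_def p_def)
    have "dy g p = 0" using dy_eqI[OF g] by simp
    then have "((\<lambda>t. g (x, (u(i := t)) 0)) has_real_derivative 0) (at (u i))"
      using DERIV_snd_arg[OF d] by (cases "i = 0") (auto simp: p_def)
    moreover have "dx g (x, u 0) = g'" using dx_eqI[OF g] by (simp add: p_def)
    ultimately show ?thesis using DERIV_fst_arg[OF d] by simp
  qed
  have "pdx G (x, u) = (\<Sum>j\<le>k. c' j p * u (k - j)) + \<beta> (Suc k) p"
    unfolding G_def
    by (rule pdx_eqI, simp only: prod.case, intro DERIV_add DERIV_sum DERIV_cmult_right)
      (use parts[OF dc] parts[OF \<beta>[OF p]] in auto)
  moreover have "pdu i G (x, u) = c (k - i) p" if "i \<le> k" for i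
  proof -
    have "((\<lambda>t. (\<Sum>j\<le>k. c j (x, (u(i := t)) 0) * (u(i := t)) (k - j)) + \<beta> k (x, (u(i := t)) 0))
        has_real_derivative ((\<Sum>j\<le>k. 0 * (u(i := u i)) (k - j) + (if j = k - i then 1 else 0) * c j (x, (u(i := u i)) 0)) + 0)) (at (u i))"
    proof (intro DERIV_add DERIV_sum DERIV_mult)
      fix j assume "j \<in> {..k}"
      then have "(k - j = i) = (j = k - i)" using that by auto
      then show "((\<lambda>t. (u(i := t)) (k - j)) has_real_derivative (if j = k - i then 1 else 0)) (at (u i))"
        by auto
    qed (use parts[OF dc] parts[OF \<beta>[OF p]] in blast)+
    also have "(\<Sum>j\<le>k. 0 * (u(i := u i)) (k - j) + (if j = k - i then 1 else 0) * c j (x, (u(i := u i)) 0)) + 0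
       = (\<Sum>j\<le>k. if j = k - i then c j p else 0)"
      unfolding add_0_right by (rule sum.cong) (auto simp: p_def)
    also have "\<dots> = c (k - i) p" by simp
    finally show ?thesis unfolding G_def by (intro pdu_eqI) simp
  qed
  ultimately have tot: "total_deriv k (prolong_coeff Z k) (x, u)
      = (\<Sum>j\<le>k. c' j p * u (k - j)) + \<beta> (Suc k) p + (\<Sum>i\<le>k. u (Suc i) * c (k - i) p)"
    using total_deriv_cong[OF D Suc.prems FG, where m=k] by (simp add: total_deriv_def)
  have "(\<Sum>i\<le>k. u (Suc i) * c (k - i) p) = (\<Sum>j\<le>k. c j p * u (Suc k - j))"
    by (rule sum.reindex_bij_witness[of _ "\<lambda>j. k - j" "\<lambda>j. k - j"]) (auto simp: Suc_diff_le)
  moreover have "total_deriv 0 (\<lambda>(x, u). fst (Z (x, u 0))) (x, u) = \<xi> (Suc 0) p"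
  proof -
    have "total_deriv 0 (\<lambda>(x, u). fst (Z (x, u 0))) (x, u) = total_deriv 0 (\<lambda>(x, u). \<xi> 0 (x, u 0)) (x, u)"
      by (rule total_deriv_cong[OF D Suc.prems]) (auto simp: Z jets_over_def)
    also have "\<dots> = \<xi> (Suc 0) p"
      using parts[OF \<xi>[OF p, of 0], of 0] pdx_eqI[of "\<lambda>(x, u). \<xi> 0 (x, u 0)" u _ x]
        pdu_eqI[of "\<lambda>(x, u). \<xi> 0 (x, u 0)" x u 0] by (auto simp: total_deriv_def)
    finally show ?thesis .
  qed
  ultimately have "prolong_coeff Z (Suc k) (x, u) = (\<Sum>j\<le>k. c' j p * u (k - j))
      + (\<Sum>j\<le>k. c j p * u (Suc k - j)) - u (Suc k) * \<xi> (Suc 0) p + \<beta> (Suc k) p"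
    using tot by simp
  also have "(\<Sum>j\<le>k. c j p * u (Suc k - j)) = (\<Sum>j\<le>Suc k. c j p * u (Suc k - j))"
    by (simp add: c_def binomial_eq_0)
  also have "\<dots> = c 0 p * u (Suc k) + (\<Sum>j\<le>k. c (Suc j) p * u (k - j))"
    by (subst sum.atMost_Suc_shift) simp
  also have "(\<Sum>j\<le>k. c' j p * u (k - j)) + (c 0 p * u (Suc k) + (\<Sum>j\<le>k. c (Suc j) p * u (k - j)))
      - u (Suc k) * \<xi> (Suc 0) p + \<beta> (Suc k) p
     = (c 0 p - \<xi> (Suc 0) p) * u (Suc k) + (\<Sum>j\<le>k. (c' j p + c (Suc j) p) * u (k - j)) + \<beta> (Suc k) p"
    by (simp add: algebra_simps sum.distrib)
  also have "\<dots> = (\<Sum>j\<le>Suc k. (real (Suc k choose j) * \<alpha> j p - real (Suc k choose Suc j) * \<xi> (Suc j) p) * u (Suc k - j))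
      + \<beta> (Suc k) p"
    by (subst sum.atMost_Suc_shift) (simp add: c_def c'_def algebra_simps binomial_eq_0)
  finally show ?case by (simp add: p_def)
qed

text \<open>The \<open>j\<close>-th derivative of \<open>x\<^sup>i\<close>.\<close>

definition xpow_deriv :: "nat \<Rightarrow> nat \<Rightarrow> real \<times> real \<Rightarrow> real"
  where "xpow_deriv i j = (\<lambda>p. if j \<le> i then fact i / fact (i - j) * fst p ^ (i - j) else 0)"

lemma xpow_deriv_0 [simp]: "xpow_deriv i 0 = (\<lambda>p. fst p ^ i)"
  and xpow_deriv_self [simp]: "xpow_deriv i i = (\<lambda>p. fact i)"
  and xpow_deriv_above: "i < j \<Longrightarrow> xpow_deriv i j = (\<lambda>p. 0)"
  by (simp_all add: xpow_deriv_def)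

lemma has_derivative_xpow_deriv:
  "(xpow_deriv i j has_derivative (\<lambda>h. fst h * xpow_deriv i (Suc j) p)) (at p)"
proof (cases "j < i")
  case True
  then obtain m where m: "i = Suc (j + m)" using less_iff_Suc_add by blast
  have e: "xpow_deriv i j = (\<lambda>p. fact i / fact (Suc m) * fst p ^ Suc m)"
    "xpow_deriv i (Suc j) p = fact i / fact m * fst p ^ m"
    by (simp_all add: xpow_deriv_def m)
  show ?thesis
    unfolding e
    by (rule has_derivative_eq_rhs[OF has_derivative_mult_right[OF
            has_derivative_power[OF has_derivative_fst[OF has_derivative_ident]]]])
      (simp add: fun_eq_iff del: of_nat_Suc power_Suc)
next
  case False
  then have "xpow_deriv i j = (\<lambda>p. if j = i then fact i else 0)" "xpow_deriv i (Suc j) p = 0"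
    by (auto simp: xpow_deriv_def fun_eq_iff)
  then show ?thesis by (cases "j = i") auto
qed

text \<open>The general element of the algebra that is spanned by \<open>\<partial>\<^sub>x\<close>, \<open>x\<^sup>2 \<partial>\<^sub>x + (N - 1) x y \<partial>\<^sub>y\<close>, \<open>x \<partial>\<^sub>x\<close>, \<open>y \<partial>\<^sub>y\<close>
  and \<open>x\<^sup>i \<partial>\<^sub>y\<close> for \<open>i < N\<close>. As \<open>y \<partial>\<^sub>y\<close> belongs to it, the semisimple element may be replaced by
  \<open>x \<partial>\<^sub>x\<close>, so that \<open>a1\<close> and \<open>b0\<close> are independent parameters.\<close>

definition sym_field ::
    "nat \<Rightarrow> (real \<times> real) set \<Rightarrow> real \<Rightarrow> real \<Rightarrow> real \<Rightarrow> real \<Rightarrow> (nat \<Rightarrow> real) \<Rightarrow> vfield"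
  where "sym_field N D a0 a1 a2 b0 b = (\<lambda>p. if p \<in> D
     then (a0 + a1 * fst p + a2 * (fst p)\<^sup>2,
           (b0 + (real N - 1) * a2 * fst p) * snd p + (\<Sum>i<N. b i * fst p ^ i)) else 0)"

abbreviation sym_fields :: "nat \<Rightarrow> (real \<times> real) set \<Rightarrow> vfield set"
  where "sym_fields N D \<equiv> {sym_field N D a0 a1 a2 b0 b | a0 a1 a2 b0 b. True}"

lemma sym_field_vfields: "open D \<Longrightarrow> sym_field N D a0 a1 a2 b0 b \<in> vfields D"
  unfolding vfields_def
proof safe
  assume D: "open D"
  note i = smooth_on_fst[OF D smooth_on_ident[OF D]] smooth_on_snd[OF D smooth_on_ident[OF D]]
  have "smooth_on D (\<lambda>p. (a0 + a1 * fst p + a2 * (fst p)\<^sup>2,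
           (b0 + (real N - 1) * a2 * fst p) * snd p + (\<Sum>i<N. b i * fst p ^ i)))"
    by (intro smooth_on_Pair smooth_on_add smooth_on_mult smooth_on_const smooth_on_power smooth_on_sum D i)
  then show "smooth_on D (sym_field N D a0 a1 a2 b0 b)"
    by (rule smooth_on_cong[OF D, rotated]) (simp add: sym_field_def)
qed (simp add: sym_field_def)

lemma sum_atMost_two_terms:
  fixes f :: "nat \<Rightarrow> real"
  assumes "\<And>j. j \<ge> 2 \<Longrightarrow> f j = 0"
  shows "(\<Sum>j\<le>k. f j) = f 0 + (if k = 0 then 0 else f 1)"
proof (cases k)
  case (Suc m)
  have "(\<Sum>j\<le>k. f j) = (\<Sum>j\<in>{0, 1}. f j)"
    by (rule sum.mono_neutral_right) (use Suc assms in \<open>auto simp: Suc_le_eq\<close>)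
  then show ?thesis using Suc by simp
qed simp

lemma prolong_coeff_sym_field:
  assumes D: "open D" and xu: "(x, u) \<in> jets_over D"
  shows "prolong_coeff (sym_field N D a0 a1 a2 b0 b) k (x, u) =
    (b0 - real k * a1 + (real N - 1 - 2 * real k) * a2 * x) * u k
    + real k * (real N - real k) * a2 * u (k - 1) + (\<Sum>i<N. b i * xpow_deriv i k (x, u 0))"
proof -
  define \<xi> :: "nat \<Rightarrow> real \<times> real \<Rightarrow> real" where "\<xi> = (\<lambda>j p. if j = 0 then a0 + a1 * fst p + a2 * (fst p)\<^sup>2
     else if j = 1 then a1 + 2 * a2 * fst p else if j = 2 then 2 * a2 else 0)"
  define \<alpha> :: "nat \<Rightarrow> real \<times> real \<Rightarrow> real" where "\<alpha> = (\<lambda>j p. if j = 0 then b0 + (real N - 1) * a2 * fst p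
     else if j = 1 then (real N - 1) * a2 else 0)"
  define \<beta> where "\<beta> = (\<lambda>j p. \<Sum>i<N. b i * xpow_deriv i j p)"
  have d1: "(\<xi> j has_derivative (\<lambda>h. fst h * \<xi> (Suc j) p)) (at p)" for j p
  proof -
    consider "j = 0" | "j = 1" | "j = 2" | "j > 2" by linarith
    then show ?thesis
      by cases (auto simp: \<xi>_def power2_eq_square fun_eq_iff algebra_simps intro!: derivative_eq_intros)
  qed
  have d2: "(\<alpha> j has_derivative (\<lambda>h. fst h * \<alpha> (Suc j) p)) (at p)" for j p
  proof -
    consider "j = 0" | "j = 1" | "j > 1" by linarith
    then show ?thesis
      by cases (auto simp: \<alpha>_def fun_eq_iff algebra_simps intro!: derivative_eq_intros)
  qed
  have d3: "(\<beta> j has_derivative (\<lambda>h. fst h * \<beta> (Suc j) p)) (at p)" for j p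
  proof -
    have "(\<beta> j has_derivative (\<lambda>h. \<Sum>i<N. b i * (fst h * xpow_deriv i (Suc j) p))) (at p)"
      unfolding \<beta>_def
      by (rule has_derivative_sum, rule has_derivative_mult_right, rule has_derivative_xpow_deriv)
    then show ?thesis by (simp add: \<beta>_def sum_distrib_left algebra_simps)
  qed
  let ?f = "\<lambda>j. (real (k choose j) * \<alpha> j (x, u 0) - real (k choose Suc j) * \<xi> (Suc j) (x, u 0)) * u (k - j)"
  have c2: "real (k choose 2) = real k * (real k - 1) / 2"
    by (cases k) (simp_all add: choose_two real_of_nat_div algebra_simps)
  have "prolong_coeff (sym_field N D a0 a1 a2 b0 b) k (x, u) = (\<Sum>j\<le>k. ?f j) + \<beta> k (x, u 0)"
    by (rule prolong_coeff_affine_fibres[where \<xi>=\<xi> and \<alpha>=\<alpha> and \<beta>=\<beta>, OF D d1 d2 d3 _ xu]) (simp add: sym_field_def \<xi>_def \<alpha>_def \<beta>_def)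
  also have "(\<Sum>j\<le>k. ?f j) = ?f 0 + (if k = 0 then 0 else ?f 1)"
    by (rule sum_atMost_two_terms) (auto simp: \<xi>_def \<alpha>_def)
  also have "\<dots> = (b0 - real k * a1 + (real N - 1 - 2 * real k) * a2 * x) * u k
    + real k * (real N - real k) * a2 * u (k - 1)"
    by (simp add: \<xi>_def \<alpha>_def c2 field_simps numeral_2_eq_2[symmetric])
  finally show ?thesis by (simp add: \<beta>_def)
qed

lemma prolong_top_coordinate: "prolong N Z (\<lambda>(x, u). u N - 0) (x, u) = prolong_coeff Z N (x, u)"
proof -
  have "pdx (\<lambda>(x, u). u N - 0) (x, u) = 0" by (rule pdx_eqI) simp
  moreover have "pdu k (\<lambda>(x, u). u N - 0) (x, u) = (if k = N then 1 else 0)" for k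
    by (rule pdu_eqI) auto
  ultimately have "prolong N Z (\<lambda>(x, u). u N - 0) (x, u)
      = (\<Sum>k\<le>N. prolong_coeff Z k (x, u) * (if k = N then 1 else 0))"
    by (simp add: prolong_def)
  also have "\<dots> = (\<Sum>k\<le>N. if k = N then prolong_coeff Z k (x, u) else 0)"
    by (rule sum.cong) auto
  finally show ?thesis by simp
qed

lemma invariant_zero_iff:
  "invariant_hypersurface N \<Omega> (\<lambda>_. 0) {Z} \<longleftrightarrow>
    (\<forall>x u. (x, u) \<in> \<Omega> \<and> u N = 0 \<longrightarrow> prolong_coeff Z N (x, u) = 0)"
  using prolong_top_coordinate by (auto simp: invariant_hypersurface_def)

text \<open>At order \<open>N\<close> the coefficient of \<open>u\<^sub>N\<^sub>-\<^sub>1\<close> has the factor \<open>N - N\<close>, and the \<open>N\<close>-th derivatives of the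
  monomials of degree less than \<open>N\<close> vanish; this leaves a multiple of \<open>u\<^sub>N\<close>.\<close>

lemma sym_field_symmetry:
  assumes "open D"
  shows "sym_field N D a0 a1 a2 b0 b \<in> symmetry_algebra N D"
  using assms
  by (auto simp: symmetry_algebra_def sym_field_vfields invariant_zero_iff prolong_coeff_sym_field
      xpow_deriv_above)

lemma x_derivatives_of_fibre_constant:
  fixes g :: "real \<times> real \<Rightarrow> real"
  assumes D: "open D" and g: "smooth_on D g" and y: "\<forall>p\<in>D. dy g p = 0"
  shows "smooth_on D ((dx ^^ j) g)" "p \<in> D \<Longrightarrow> dy ((dx ^^ j) g) p = 0"
    "p \<in> D \<Longrightarrow> ((dx ^^ j) g has_derivative (\<lambda>h. fst h * (dx ^^ Suc j) g p)) (at p)"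
proof -
  have *: "smooth_on D ((dx ^^ j) g) \<and> (\<forall>p\<in>D. dy ((dx ^^ j) g) p = 0)" for j
  proof (induction j)
    case 0
    then show ?case using g y by simp
  next
    case (Suc j)
    have "dy (dx ((dx ^^ j) g)) p = 0" if "p \<in> D" for p
    proof -
      have "dx (dy ((dx ^^ j) g)) p = dx (\<lambda>_. 0) p"
        by (rule dx_cong[OF D that]) (use Suc that in \<open>auto intro: smooth_differentiable smooth_on_dy\<close>)
      then show ?thesis using dx_dy_commute[OF D _ that] Suc by simp
    qed
    then show ?case using Suc smooth_on_dx by auto
  qed
  show "smooth_on D ((dx ^^ j) g)" using * by blast
  show "dy ((dx ^^ j) g) p = 0" if "p \<in> D" using * that by blast
  show "((dx ^^ j) g has_derivative (\<lambda>h. fst h * (dx ^^ Suc j) g p)) (at p)" if "p \<in> D"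
    using has_derivative_partials[OF smooth_differentiable[OF conjunct1[OF *] that]] * that by simp
qed

lemma polynomial_of_vanishing_derivative:
  fixes g :: "real \<times> real \<Rightarrow> real"
  assumes D: "open D" "connected D"
  shows "smooth_on D g \<Longrightarrow> (\<And>p. p \<in> D \<Longrightarrow> dy g p = 0) \<Longrightarrow> (\<And>p. p \<in> D \<Longrightarrow> (dx ^^ n) g p = 0) \<Longrightarrow>
    \<exists>b. \<forall>p\<in>D. g p = (\<Sum>i<n. b i * fst p ^ i)"
proof (induction n arbitrary: g)
  case 0
  then show ?case by simp
next
  case (Suc n)
  have "\<exists>b. \<forall>p\<in>D. dx g p = (\<Sum>i<n. b i * fst p ^ i)"
  proof (rule Suc.IH)
    show "smooth_on D (dx g)" by (rule smooth_on_dx[OF Suc.prems(1)])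
    show "dy (dx g) p = 0" if "p \<in> D" for p
      using x_derivatives_of_fibre_constant(2)[OF D(1) Suc.prems(1), of p 1] Suc.prems(2) that by simp
    show "(dx ^^ n) (dx g) p = 0" if "p \<in> D" for p
      using Suc.prems(3)[OF that] by (simp add: funpow_swap1)
  qed
  then obtain b where b: "\<And>p. p \<in> D \<Longrightarrow> dx g p = (\<Sum>i<n. b i * fst p ^ i)" by blast
  define q :: "real \<times> real \<Rightarrow> real" where "q = (\<lambda>p. \<Sum>i<n. b i / real (Suc i) * fst p ^ Suc i)"
  have q: "(q has_derivative (\<lambda>h. fst h * (\<Sum>i<n. b i * fst p ^ i))) (at p)" for p
  proof -
    have "(q has_derivative (\<lambda>h. \<Sum>i<n. b i / real (Suc i) * (real (Suc i) * fst h * fst p ^ i))) (at p)"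
      unfolding q_def
      by (rule has_derivative_sum, rule has_derivative_mult_right,
          rule has_derivative_eq_rhs[OF has_derivative_power[OF has_derivative_fst[OF has_derivative_ident]]])
        (auto simp: fun_eq_iff)
    also have "(\<lambda>h. \<Sum>i<n. b i / real (Suc i) * (real (Suc i) * fst h * fst p ^ i))
        = (\<lambda>h. fst h * (\<Sum>i<n. b i * fst p ^ i))"
      by (auto simp: fun_eq_iff sum_distrib_left intro!: sum.cong)
    finally show ?thesis .
  qed
  have dz: "(\<lambda>p. g p - q p) differentiable at p \<and> dx (\<lambda>p. g p - q p) p = 0 \<and> dy (\<lambda>p. g p - q p) p = 0" if "p \<in> D" for p
  proof -
    have dg: "g differentiable at p" by (rule smooth_differentiable[OF Suc.prems(1) that])
    have dq: "q differentiable at p" unfolding differentiable_def using q[of p] by blast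
    show ?thesis
      using dx_eqI[OF q, of p] dy_eqI[OF q, of p] b[OF that] Suc.prems(2)[OF that]
      by (simp add: dx_diff[OF dg dq] dy_diff[OF dg dq] differentiable_diff[OF dg dq])
  qed
  obtain c where c: "\<And>p. p \<in> D \<Longrightarrow> g p - q p = c"
    by (rule partials_zero_imp_const[OF D dz]) blast+
  show ?case
  proof (intro exI ballI)
    fix p assume "p \<in> D"
    then have "g p = c + q p" using c[of p] by simp
    then show "g p = (\<Sum>i<Suc n. (case i of 0 \<Rightarrow> c | Suc i \<Rightarrow> b i / real (Suc i)) * fst p ^ i)"
      unfolding sum.lessThan_Suc_shift q_def by simp
  qed
qed

lemma dx_funpow_zero:
  fixes g :: "real \<times> real \<Rightarrow> real"
  assumes D: "open D" and g: "smooth_on D g" and z: "\<And>p. p \<in> D \<Longrightarrow> g p = 0" and p: "p \<in> D"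
  shows "(dx ^^ n) g p = 0"
proof -
  have "smooth_on D ((dx ^^ n) g) \<and> (\<forall>p\<in>D. (dx ^^ n) g p = 0)"
  proof (induction n)
    case (Suc n)
    have "dx ((dx ^^ n) g) p = dx (\<lambda>_. 0) p" if "p \<in> D" for p
      by (rule dx_cong[OF D that]) (use Suc that in \<open>auto intro: smooth_differentiable\<close>)
    then show ?case using Suc smooth_on_dx by auto
  qed (use g z in auto)
  then show ?thesis using p by blast
qed

text \<open>For \<open>N \<ge> 3\<close> the coordinates \<open>u\<^sub>1\<close> and \<open>u\<^sub>2\<close> can be chosen freely on \<open>u\<^sub>N = 0\<close>, so the second coefficient
  vanishes identically as a polynomial in them.\<close>

lemma symmetry_imp_affine_fibres:
  assumes D: "open D" and N: "N \<ge> 3" and Z: "Z \<in> symmetry_algebra N D" and p: "p \<in> D"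
  shows "dy (\<lambda>p. fst (Z p)) p = 0" "dy (dy (\<lambda>p. snd (Z p))) p = 0"
proof -
  define \<xi> where "\<xi> = (\<lambda>p. fst (Z p))"
  define \<eta> where "\<eta> = (\<lambda>p. snd (Z p))"
  have Zv: "Z \<in> vfields D" using Z by (simp add: symmetry_algebra_def)
  have sm: "smooth_on D \<xi>" "smooth_on D \<eta>"
    unfolding \<xi>_def \<eta>_def by (rule smooth_on_fst smooth_on_snd, rule D, rule vfieldsD(1)[OF Zv])+
  have inv: "jev (jprolong \<xi> \<eta> N) (x, u) = 0" if "(x, u) \<in> jets_over D" "u N = 0" for x u
    using Z that prolong_coeff_jev[OF D Zv that(1), of N]
    by (simp add: symmetry_algebra_def invariant_zero_iff \<xi>_def \<eta>_def)
  obtain k where k: "N = Suc (Suc k)" "k \<ge> 1" by (rule that[of "N - 2"]) (use N in auto)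
  obtain f0 f2 c K where K: "K > 0" and coeff: "\<And>x u. (x, u) \<in> jets_over D \<Longrightarrow>
     jev (jdu (Suc k) (jprolong \<xi> \<eta> (Suc (Suc k)))) (x, u) =
       f0 (x, u 0) + u 1 * (real (Suc (Suc k)) * dy (dy \<eta>) (x, u 0) + c * dx (dy \<xi>) (x, u 0))
       + (u 1)\<^sup>2 * f2 (x, u 0) - K * u 2 * dy \<xi> (x, u 0)"
    using jprolong_second_coeff[OF D sm, of k] by metis
  have det: "f0 q + s * (real N * dy (dy \<eta>) q + c * dx (dy \<xi>) q) + s\<^sup>2 * f2 q - K * r * dy \<xi> q = 0"
    if "q \<in> D" for q s r
  proof -
    define u where "u = (\<lambda>i::nat. if i = 0 then snd q else if i = 1 then s else if i = 2 then r else 0)"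
    have uD: "(fst q, u(Suc k := t)) \<in> jets_over D" for t using that by (simp add: jets_over_def u_def)
    have uD': "(fst q, u) \<in> jets_over D" using that by (simp add: jets_over_def u_def)
    have "(\<lambda>t. jev (jprolong \<xi> \<eta> N) (fst q, u(Suc k := t))) = (\<lambda>t. 0)"
      using inv[OF uD] k by (auto simp: u_def fun_eq_iff simp del: jprolong.simps)
    then have "jev (jdu (Suc k) (jprolong \<xi> \<eta> N)) (fst q, u) = 0"
      using DERIV_jev_u[OF jsmooth_jprolong[OF sm, of N] uD', of "Suc k"]
      by (metis DERIV_const DERIV_unique)
    then show ?thesis using coeff[OF uD'] k by (simp add: u_def del: jprolong.simps)
  qed
  have y0: "dy \<xi> q = 0" if "q \<in> D" for q
    using det[OF that, of 0 0] det[OF that, of 0 1] K by simp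
  then show "dy (\<lambda>p. fst (Z p)) p = 0" using p by (simp add: \<xi>_def)
  have "dx (dy \<xi>) p = dx (\<lambda>_. 0) p"
    by (rule dx_cong[OF D p y0]) (use smooth_differentiable[OF smooth_on_dy[OF sm(1)] p] in auto)
  then have "dx (dy \<xi>) p = 0" by simp
  then have "f0 p + real N * dy (dy \<eta>) p + f2 p = 0" "f0 p - real N * dy (dy \<eta>) p + f2 p = 0"
    using det[OF p, of 1 0] det[OF p, of "-1" 0] by simp_all
  then have "real N * dy (dy \<eta>) p = 0" by linarith
  then show "dy (dy (\<lambda>p. snd (Z p))) p = 0" using k by (simp add: \<eta>_def)
qed

text \<open>Once \<open>\<xi> = \<xi>(x)\<close> and \<open>\<eta> = \<alpha>(x) y + \<beta>(x)\<close>, the symmetry condition is linear in the jet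
  coordinates. The coefficients of \<open>u\<^sub>N\<^sub>-\<^sub>1\<close> and \<open>u\<^sub>N\<^sub>-\<^sub>2\<close> give two relations between \<open>\<alpha>\<close> and \<open>\<xi>\<close>, whose
  compatibility forces \<open>\<xi>''' = 0\<close>; what remains is \<open>\<beta>\<^sup>(\<^sup>N\<^sup>) = 0\<close>.\<close>

lemma symmetry_imp_sym_field:
  assumes D: "open D" "connected D" and N: "N \<ge> 3" and Z: "Z \<in> symmetry_algebra N D"
  shows "\<exists>a0 a1 a2 b0 b. Z = sym_field N D a0 a1 a2 b0 b"
proof -
  define \<xi> where "\<xi> = (\<lambda>p. fst (Z p))"
  define \<alpha> where "\<alpha> = dy (\<lambda>p. snd (Z p))"
  define \<beta> where "\<beta> = (\<lambda>p. snd (Z p) - \<alpha> p * snd p)"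
  have Zv: "Z \<in> vfields D" using Z by (simp add: symmetry_algebra_def)
  note ident = smooth_on_snd[OF D(1) smooth_on_ident[OF D(1)]]
  note sm\<eta> = smooth_on_snd[OF D(1) vfieldsD(1)[OF Zv]]
  have sm: "smooth_on D \<xi>" "smooth_on D \<alpha>" "smooth_on D \<beta>"
    unfolding \<xi>_def \<alpha>_def \<beta>_def
    by (intro smooth_on_fst smooth_on_diff smooth_on_mult smooth_on_dy D(1) vfieldsD(1)[OF Zv] sm\<eta> ident)+
  note aff = symmetry_imp_affine_fibres[OF D(1) N Z]
  have y: "dy \<xi> p = 0" "dy \<alpha> p = 0" "dy \<beta> p = 0" if "p \<in> D" for p
  proof -
    show a: "dy \<xi> p = 0" "dy \<alpha> p = 0" using aff[OF that] by (simp_all add: \<xi>_def \<alpha>_def)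
    note d = smooth_differentiable[OF _ that]
    show "dy \<beta> p = 0"
      unfolding \<beta>_def using a d[OF sm\<eta>] d[OF sm(2)] d[OF ident]
      by (subst dy_diff) (auto simp: dy_mult differentiable_mult \<alpha>_def)
  qed
  have y': "\<forall>p\<in>D. dy \<xi> p = 0" "\<forall>p\<in>D. dy \<alpha> p = 0" "\<forall>p\<in>D. dy \<beta> p = 0" using y by blast+
  note X = x_derivatives_of_fibre_constant[OF D(1) sm(1) y'(1)]
    and A = x_derivatives_of_fibre_constant[OF D(1) sm(2) y'(2)]
    and B = x_derivatives_of_fibre_constant[OF D(1) sm(3) y'(3)]
  define c where "c = (\<lambda>j p. real (N choose j) * (dx ^^ j) \<alpha> p - real (N choose Suc j) * (dx ^^ Suc j) \<xi> p)"
  have eq: "(\<Sum>j\<le>N. c j (x, u 0) * u (N - j)) + (dx ^^ N) \<beta> (x, u 0) = 0"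
    if xu: "(x, u) \<in> jets_over D" "u N = 0" for x u
  proof -
    have "prolong_coeff Z N (x, u) = (\<Sum>j\<le>N. c j (x, u 0) * u (N - j)) + (dx ^^ N) \<beta> (x, u 0)"
      unfolding c_def
      by (rule prolong_coeff_affine_fibres[where \<xi>="\<lambda>j. (dx ^^ j) \<xi>" and \<alpha>="\<lambda>j. (dx ^^ j) \<alpha>"
            and \<beta>="\<lambda>j. (dx ^^ j) \<beta>", OF D(1) X(3) A(3) B(3) _ xu(1)])
        (simp_all add: \<xi>_def \<beta>_def)
    then show ?thesis
      using Z that by (simp add: symmetry_algebra_def invariant_zero_iff)
  qed
  \<comment> \<open>the jet over \<open>p\<close> whose only other nonzero coordinate is \<open>u\<^sub>N\<^sub>-\<^sub>i = t\<close>\<close>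
  have eqt: "c i p * t + c N p * snd p + (dx ^^ N) \<beta> p = 0" if p: "p \<in> D" and i: "0 < i" "i < N" for p i t
  proof -
    define u where "u = (\<lambda>j. if j = 0 then snd p else if j = N - i then t else 0)"
    have "(\<Sum>j\<le>N. c j (fst p, u 0) * u (N - j)) = (\<Sum>j\<in>{i, N}. c j (fst p, u 0) * u (N - j))"
      by (rule sum.mono_neutral_right) (use i in \<open>auto simp: u_def\<close>)
    then show ?thesis using eq[of "fst p" u] p i by (simp add: u_def jets_over_def)
  qed
  have c0: "c i p = 0" if "p \<in> D" "0 < i" "i < N" for p i
    using eqt[OF that, of 0] eqt[OF that, of 1] by simp
  have c1: "real N * dx \<alpha> p = real (N choose 2) * (dx ^^ 2) \<xi> p" if "p \<in> D" for p
    using c0[OF that, of 1] N by (simp add: c_def numeral_2_eq_2)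
  have c2: "real (N choose 2) * (dx ^^ 2) \<alpha> p = real (N choose 3) * (dx ^^ 3) \<xi> p" if "p \<in> D" for p
    using c0[OF that, of 2] N by (simp add: c_def numeral_2_eq_2 numeral_3_eq_3)
  have N2: "real (N choose 2) = real N * (real N - 1) / 2"
    using N by (cases N) (simp_all add: choose_two real_of_nat_div algebra_simps)
  have N3: "real (N choose 3) = real N * (real N - 1) * (real N - 2) / 6"
  proof -
    obtain m where m: "N = Suc (Suc (Suc m))" by (rule that[of "N - 3"]) (use N in auto)
    have "3 * (Suc (Suc (Suc m)) choose 3) = Suc (Suc (Suc m)) * (Suc (Suc m) choose 2)"
      using Suc_times_binomial[of 2 "Suc (Suc m)"] by (simp add: numeral_3_eq_3 numeral_2_eq_2)
    then have "3 * real (N choose 3) = real N * real (Suc (Suc m) choose 2)"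
      unfolding m by (metis of_nat_mult of_nat_numeral)
    moreover have "real (Suc (Suc m) choose 2) = real (Suc (Suc m)) * real (Suc m) / 2"
      by (simp add: choose_two real_of_nat_div field_simps)
    ultimately show ?thesis unfolding m by (simp add: field_simps)
  qed
  have dxa: "dx \<alpha> p = (real N - 1) / 2 * (dx ^^ 2) \<xi> p" if "p \<in> D" for p
  proof -
    have "real N * (dx \<alpha> p - (real N - 1) / 2 * (dx ^^ 2) \<xi> p) = 0"
      using c1[OF that] unfolding N2 by (simp add: algebra_simps)
    then show ?thesis using N by simp
  qed
  have dxa2: "(dx ^^ 2) \<alpha> p = (real N - 1) / 2 * (dx ^^ 3) \<xi> p" if "p \<in> D" for p
  proof -
    have "dx (dx \<alpha>) p = dx (\<lambda>p. (real N - 1) / 2 * (dx ^^ 2) \<xi> p) p"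
      by (rule dx_cong[OF D(1) that dxa smooth_differentiable[OF smooth_on_dx[OF sm(2)] that]])
    also have "\<dots> = (real N - 1) / 2 * (dx ^^ 3) \<xi> p"
      by (subst dx_mult[OF _ smooth_differentiable[OF X(1) that]]) (simp_all add: numeral_3_eq_3 numeral_2_eq_2)
    finally show ?thesis by (simp add: numeral_2_eq_2)
  qed
  have x3: "(dx ^^ 3) \<xi> p = 0" if "p \<in> D" for p
  proof -
    have "real N * (real N - 1) * (real N + 1) * (dx ^^ 3) \<xi> p = 0"
      using c2[OF that] unfolding N2 N3 dxa2[OF that] by (simp add: field_simps)
    then show ?thesis using N by simp
  qed
  have aN: "(dx ^^ N) \<alpha> p = 0" if "p \<in> D" for p
  proof -
    have a2: "(dx ^^ 2) \<alpha> q = 0" if "q \<in> D" for q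
      using dxa2[OF that] x3[OF that] by simp
    have "(dx ^^ (N - 2)) ((dx ^^ 2) \<alpha>) p = 0"
      by (rule dx_funpow_zero[OF D(1) A(1) a2 that])
    moreover have "(dx ^^ (N - 2)) ((dx ^^ 2) \<alpha>) = (dx ^^ N) \<alpha>"
    proof -
      have "N - 2 + 2 = N" using N by simp
      then show ?thesis using funpow_add[of "N - 2" 2 "dx :: (real \<times> real \<Rightarrow> real) \<Rightarrow> _"] by (simp only: comp_apply)
    qed
    ultimately show ?thesis by simp
  qed
  have bN: "(dx ^^ N) \<beta> p = 0" if "p \<in> D" for p
    using eqt[OF that, of 1 0] N aN[OF that] by (simp add: c_def)
  obtain a where a: "\<And>p. p \<in> D \<Longrightarrow> \<xi> p = (\<Sum>i<3. a i * fst p ^ i)"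
    using polynomial_of_vanishing_derivative[OF D sm(1) y(1) x3] by blast
  obtain b where b: "\<And>p. p \<in> D \<Longrightarrow> \<beta> p = (\<Sum>i<N. b i * fst p ^ i)"
    using polynomial_of_vanishing_derivative[OF D sm(3) y(3) bN] by blast
  have a': "\<xi> p = a 0 + a 1 * fst p + a 2 * (fst p)\<^sup>2" if "p \<in> D" for p
    using a[OF that] by (simp add: numeral_3_eq_3 numeral_2_eq_2 power2_eq_square)
  have dq: "((\<lambda>p. a 0 + a 1 * fst p + a 2 * (fst p)\<^sup>2) has_derivative (\<lambda>h. fst h * (a 1 + 2 * a 2 * fst p))) (at p)" for p :: "real \<times> real"
    by (auto intro!: derivative_eq_intros simp: fun_eq_iff algebra_simps)
  have a1: "dx \<xi> p = a 1 + 2 * a 2 * fst p" if "p \<in> D" for p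
    using dx_cong[OF D(1) that a' smooth_differentiable[OF sm(1) that]] dx_eqI[OF dq, of p] by simp
  define m where "m = (real N - 1) / 2"
  have "(\<lambda>p. \<alpha> p - m * dx \<xi> p) differentiable at p \<and> dx (\<lambda>p. \<alpha> p - m * dx \<xi> p) p = 0
      \<and> dy (\<lambda>p. \<alpha> p - m * dx \<xi> p) p = 0" if "p \<in> D" for p
  proof -
    note d = smooth_differentiable[OF sm(2) that] smooth_differentiable[OF smooth_on_dx[OF sm(1)] that]
    have d': "(\<lambda>p. m * dx \<xi> p) differentiable at p" using d by (auto intro: differentiable_mult)
    have "dx (\<lambda>p. m * dx \<xi> p) p = m * (dx ^^ 2) \<xi> p" "dy (\<lambda>p. m * dx \<xi> p) p = 0"
      using d X(2)[OF that, of 1] by (simp_all add: dx_mult dy_mult numeral_2_eq_2)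
    then show ?thesis
      using y[OF that] dxa[OF that, folded m_def]
      by (simp add: dx_diff[OF d(1) d'] dy_diff[OF d(1) d'] differentiable_diff[OF d(1) d'])
  qed
  then obtain b0 where b0: "\<And>p. p \<in> D \<Longrightarrow> \<alpha> p - m * dx \<xi> p = b0"
    by (rule partials_zero_imp_const[OF D]) blast+
  have "Z = sym_field N D (a 0) (a 1) (a 2) (b0 + m * a 1) b"
  proof (rule vfields_eqI[OF Zv sym_field_vfields[OF D(1)]])
    fix p assume p: "p \<in> D"
    have "\<alpha> p = b0 + m * a 1 + (real N - 1) * a 2 * fst p"
      using b0[OF p] a1[OF p] by (simp add: m_def field_simps)
    moreover have "snd (Z p) = \<alpha> p * snd p + \<beta> p" by (simp add: \<beta>_def)
    ultimately show "Z p = sym_field N D (a 0) (a 1) (a 2) (b0 + m * a 1) b p"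
      using p a'[OF p] b[OF p] by (simp add: sym_field_def prod_eq_iff \<xi>_def)
  qed
  then show ?thesis by blast
qed

theorem symmetry_algebra_eq:
  assumes "open D" "connected D" "N \<ge> 3"
  shows "symmetry_algebra N D = sym_fields N D"
  using symmetry_imp_sym_field[OF assms] sym_field_symmetry[OF assms(1)] by blast

section \<open>Invariant hypersurfaces\<close>

text \<open>On \<open>u\<^sub>N = f\<close>, invariance under the fields \<open>x\<^sup>i \<partial>\<^sub>y\<close> is a triangular system for the derivatives of
  \<open>f\<close> with respect to \<open>u\<^sub>0, \<dots>, u\<^sub>N\<^sub>-\<^sub>1\<close>, so they all vanish, and invariance under \<open>y \<partial>\<^sub>y\<close> then reads
  \<open>u\<^sub>N = 0\<close>.\<close>

theorem invariant_hypersurface_iff_zero: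
  assumes D: "open D" and f: "hypersurface_fun N D \<Omega> f"
  shows "invariant_hypersurface N \<Omega> f (sym_fields N D)
    \<longleftrightarrow> (\<forall>z\<in>\<Omega>. f z = 0)"
proof
  have \<Omega>: "open \<Omega>" "\<Omega> \<subseteq> jets_over D"
    and low: "\<And>x u v. (\<And>k. k < N \<Longrightarrow> u k = v k) \<Longrightarrow> (x, u) \<in> \<Omega> \<Longrightarrow> (x, v) \<in> \<Omega> \<and> f (x, u) = f (x, v)"
    and ck: "jet_C_k_on N (Suc 0) \<Omega> f"
    using f unfolding hypersurface_fun_def by blast+
  {
    assume z: "\<forall>z\<in>\<Omega>. f z = 0"
    have "prolong N (sym_field N D a0 a1 a2 b0 b) (\<lambda>(x, u). u N - f (x, u)) (x, u) = 0"
      if xu: "(x, u) \<in> \<Omega>" and uN: "u N = f (x, u)" for a0 a1 a2 b0 b x u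
    proof -
      have xu': "(x, u) \<in> jets_over D" using xu \<Omega> by auto
      have "prolong N (sym_field N D a0 a1 a2 b0 b) (\<lambda>(x, u). u N - f (x, u)) (x, u)
          = prolong N (sym_field N D a0 a1 a2 b0 b) (\<lambda>(x, u). u N - 0) (x, u)"
        by (rule prolong_cong[OF \<Omega>(1) _ xu]) (use z in auto)
      also have "\<dots> = prolong_coeff (sym_field N D a0 a1 a2 b0 b) N (x, u)"
        by (rule prolong_top_coordinate)
      finally show ?thesis
        using z xu uN by (simp add: prolong_coeff_sym_field[OF D xu'] xpow_deriv_above)
    qed
    then show "invariant_hypersurface N \<Omega> f (sym_fields N D)"
      unfolding invariant_hypersurface_def by auto
  }
  assume inv: "invariant_hypersurface N \<Omega> f (sym_fields N D)"
  show "\<forall>z\<in>\<Omega>. f z = 0"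
  proof safe
    fix x u assume "(x, u) \<in> \<Omega>"
    define v where "v = u(N := f (x, u))"
    have v: "(x, v) \<in> \<Omega>" "f (x, v) = f (x, u)" "v N = f (x, v)"
      using low[of u v x] \<open>(x, u) \<in> \<Omega>\<close> by (auto simp: v_def)
    have v': "(x, v) \<in> jets_over D" using v \<Omega> by auto
    have pd: "pdu k (\<lambda>(x, u). u N - f (x, u)) (x, v) = (if k = N then 1 else - pdu k f (x, v))" if "k \<le> N" for k
    proof (cases "k = N")
      case True
      have "f (x, v(N := t)) = f (x, v)" for t using low[of v "v(N := t)" x] v by auto
      then show ?thesis using True by (intro pdu_eqI) (auto intro!: derivative_eq_intros)
    next
      case False
      then have "(\<lambda>t. f (x, v(k := t))) differentiable at (v k)" using ck v(1) that by auto
      then have "((\<lambda>t. f (x, v(k := t))) has_real_derivative pdu k f (x, v)) (at (v k))"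
        by (simp add: pdu_def DERIV_deriv_iff_real_differentiable)
      then show ?thesis using False by (intro pdu_eqI) (auto intro!: derivative_eq_intros)
    qed
    have inv': "fst (Z (x, v 0)) * pdx (\<lambda>(x, u). u N - f (x, u)) (x, v)
        + (\<Sum>k\<le>N. prolong_coeff Z k (x, v) * (if k = N then 1 else - pdu k f (x, v))) = 0"
      if "Z \<in> sym_fields N D" for Z
    proof -
      have "prolong N Z (\<lambda>(x, u). u N - f (x, u)) (x, v) = 0"
        using inv that v unfolding invariant_hypersurface_def by blast
      moreover have "(\<Sum>k\<le>N. prolong_coeff Z k (x, v) * pdu k (\<lambda>(x, u). u N - f (x, u)) (x, v))
          = (\<Sum>k\<le>N. prolong_coeff Z k (x, v) * (if k = N then 1 else - pdu k f (x, v)))"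
        by (rule sum.cong[OF refl]) (simp only: pd atMost_iff)
      ultimately show ?thesis by (simp add: prolong_def)
    qed
    have zero: "pdu i f (x, v) = 0" if "i < N" for i
      using that
    proof (induction i rule: less_induct)
      case (less i)
      define Z where "Z = sym_field N D 0 0 0 0 (\<lambda>j. if j = i then 1 else 0)"
      have Zin: "Z \<in> sym_fields N D" unfolding Z_def by blast
      have Z0: "fst (Z (x, v 0)) = 0" by (simp add: Z_def sym_field_def)
      have "(\<Sum>j<N. (if j = i then 1 else 0) * xpow_deriv j k (x, v 0)) = xpow_deriv i k (x, v 0)" for k
      proof -
        have "(\<Sum>j<N. (if j = i then 1 else 0) * xpow_deriv j k (x, v 0))
            = (\<Sum>j<N. if j = i then xpow_deriv i k (x, v 0) else 0)"
          by (rule sum.cong) auto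
        then show ?thesis using less.prems by simp
      qed
      then have pc: "prolong_coeff Z k (x, v) = xpow_deriv i k (x, v 0)" for k
        unfolding Z_def prolong_coeff_sym_field[OF D v'] by simp
      have "(\<Sum>k\<le>N. xpow_deriv i k (x, v 0) * (if k = N then 1 else - pdu k f (x, v))) = 0"
        using inv'[OF Zin] Z0 pc by simp
      moreover have "(\<Sum>k\<le>N. xpow_deriv i k (x, v 0) * (if k = N then 1 else - pdu k f (x, v)))
          = (\<Sum>k\<in>{i}. xpow_deriv i k (x, v 0) * (if k = N then 1 else - pdu k f (x, v)))"
      proof (rule sum.mono_neutral_right)
        show "\<forall>k\<in>{..N} - {i}. xpow_deriv i k (x, v 0) * (if k = N then 1 else - pdu k f (x, v)) = 0"
        proof
          fix k assume "k \<in> {..N} - {i}"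
          then consider "k < i" | "i < k" by fastforce
          then show "xpow_deriv i k (x, v 0) * (if k = N then 1 else - pdu k f (x, v)) = 0"
            by cases (use less in \<open>auto simp: xpow_deriv_above\<close>)
        qed
      qed (use less.prems in auto)
      ultimately show ?case using less.prems by simp
    qed
    define Z where "Z = sym_field N D 0 0 0 1 (\<lambda>_. 0)"
      have Zin: "Z \<in> sym_fields N D" unfolding Z_def by blast
      have Z0: "fst (Z (x, v 0)) = 0" by (simp add: Z_def sym_field_def)
    have pc: "prolong_coeff Z k (x, v) = v k" for k
      unfolding Z_def prolong_coeff_sym_field[OF D v'] by simp
    have "(\<Sum>k\<le>N. v k * (if k = N then 1 else - pdu k f (x, v))) = 0"
      using inv'[OF Zin] Z0 pc by simp
    moreover have "(\<Sum>k\<le>N. v k * (if k = N then 1 else - pdu k f (x, v))) = (\<Sum>k\<le>N. if k = N then v N else 0)"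
      by (rule sum.cong) (use zero in auto)
    ultimately show "f (x, u) = 0" using v by simp
  qed
qed

section \<open>The normal form of the algebra\<close>

text \<open>The letters are those of the theorem: \<open>A\<close> is the algebra, \<open>S\<close> the Levi complement, \<open>R = W \<oplus> T\<close> the
  radical.\<close>

locale sl2_levi =
  fixes N :: nat and U :: "(real \<times> real) set" and A S R W T :: "vfield set"
    and X Y H V :: vfield
  assumes N2: "N \<ge> 2" and U: "open U" and A: "local_lie_algebra U A"
    and ASR: "direct_sum A S R" and S: "S = span {X, Y, H}"
    and XY: "lie_bracket U X Y = H" and HX: "lie_bracket U H X = 2 *\<^sub>R X"
    and HY: "lie_bracket U H Y = (-2) *\<^sub>R Y"
    and RWT: "direct_sum R W T"
    and W: "ad_irreducible U S W" and dimW: "dim W = N"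
    and T: "ad_invariant U S T" and dimT: "dim T = 1"
    and V: "highest_weight_vector U H X W V"
    and rank: "has_rank U R 1"
begin

abbreviation "br \<equiv> lie_bracket U"

lemma A_facts: "subspace A" "A \<subseteq> vfields U" "Z \<in> A \<Longrightarrow> Z' \<in> A \<Longrightarrow> br Z Z' \<in> A"
  using A by (auto simp: local_lie_algebra_def lie_subalgebra_def)

lemma direct_sum_subset: "direct_sum L L1 L2 \<Longrightarrow> L1 \<subseteq> L \<and> L2 \<subseteq> L"
proof (intro conjI subsetI)
  assume d: "direct_sum L L1 L2"
  then have z: "0 \<in> L1" "0 \<in> L2" by (auto simp: direct_sum_def subspace_0)
  fix Z
  show "Z \<in> L" if "Z \<in> L1"
    using d that z(2) unfolding direct_sum_def by (metis (mono_tags, lifting) add.right_neutral mem_Collect_eq)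
  show "Z \<in> L" if "Z \<in> L2"
    using d that z(1) unfolding direct_sum_def by (metis (mono_tags, lifting) add.left_neutral mem_Collect_eq)
qed

lemma WR: "W \<subseteq> R" and TR: "T \<subseteq> R" and RA: "R \<subseteq> A" and SA: "S \<subseteq> A"
  using direct_sum_subset[OF ASR] direct_sum_subset[OF RWT] by auto

lemma XYH_S: "X \<in> S" "Y \<in> S" "H \<in> S"
  unfolding S by (auto intro: span_base)

lemma XYH_A: "X \<in> A" "Y \<in> A" "H \<in> A"
  using XYH_S SA by auto

lemma A_vfields: "Z \<in> A \<Longrightarrow> Z \<in> vfields U"
  using A_facts by auto

lemma WA: "Z \<in> W \<Longrightarrow> Z \<in> A" using WR RA by auto

lemma subspace_W: "subspace W" and subspace_T: "subspace T" and W_T: "W \<inter> T = {0}"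
  using RWT by (auto simp: direct_sum_def)

lemma V_facts: "V \<in> W" "V \<noteq> 0" "br X V = 0"
  using V by (auto simp: highest_weight_vector_def)

lemma VA: "V \<in> A" using V_facts WA by auto

lemma W_inv: "Z \<in> S \<Longrightarrow> w \<in> W \<Longrightarrow> br Z w \<in> W"
  using W by (auto simp: ad_irreducible_def ad_invariant_def)

lemma br_add_right: "Z \<in> A \<Longrightarrow> Z1 \<in> A \<Longrightarrow> Z2 \<in> A \<Longrightarrow> br Z (Z1 + Z2) = br Z Z1 + br Z Z2"
  by (intro lie_bracket_add_right A_vfields)

lemma br_scale_right: "Z \<in> A \<Longrightarrow> Z1 \<in> A \<Longrightarrow> br Z (c *\<^sub>R Z1) = c *\<^sub>R br Z Z1"
  by (intro lie_bracket_scale_right A_vfields)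

lemma br_scale_left: "Z \<in> A \<Longrightarrow> Z1 \<in> A \<Longrightarrow> br (c *\<^sub>R Z1) Z = c *\<^sub>R br Z1 Z"
  by (intro lie_bracket_scale_left A_vfields)

lemma br_add_left: "Z \<in> A \<Longrightarrow> Z1 \<in> A \<Longrightarrow> Z2 \<in> A \<Longrightarrow> br (Z1 + Z2) Z = br Z1 Z + br Z2 Z"
  by (intro lie_bracket_add_left A_vfields)

lemma br_zero_right: "Z \<in> A \<Longrightarrow> br Z 0 = 0"
  using br_scale_right[of Z Z 0] by simp

lemma br_jacobi: "Z \<in> A \<Longrightarrow> Z1 \<in> A \<Longrightarrow> Z2 \<in> A \<Longrightarrow> br Z (br Z1 Z2) = br (br Z Z1) Z2 + br Z1 (br Z Z2)"
  by (intro lie_bracket_jacobi U A_vfields)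

text \<open>As the bracket is linear, invariance under \<open>S\<close> follows from that under \<open>X\<close>, \<open>Y\<close> and \<open>H\<close>.\<close>

lemma irreducible_eq:
  assumes Q: "subspace Q" "Q \<subseteq> W" "V \<in> Q"
    and inv: "\<And>w. w \<in> Q \<Longrightarrow> br X w \<in> Q \<and> br Y w \<in> Q \<and> br H w \<in> Q"
  shows "Q = W"
proof -
  have "br Z w \<in> Q" if Z: "Z \<in> S" and w: "w \<in> Q" for Z w
  proof -
    have wA: "w \<in> A" using w Q WA by auto
    have "subspace {Z \<in> A. br Z w \<in> Q}"
      using A_facts(1) Q(1) br_scale_left[OF wA XYH_A(1), of 0] br_add_left[OF wA] br_scale_left[OF wA]
      by (auto simp: subspace_def)
    then have "span {X, Y, H} \<subseteq> {Z \<in> A. br Z w \<in> Q}"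
      using inv[OF w] XYH_A by (intro span_minimal) auto
    then show ?thesis using Z S by auto
  qed
  then have "ad_invariant U S Q" using Q by (simp add: ad_invariant_def)
  then show ?thesis using W Q V_facts by (auto simp: ad_irreducible_def)
qed

text \<open>A one-dimensional representation of \<open>sl(2)\<close> is trivial, because \<open>sl(2)\<close> is perfect.\<close>

lemma T_trivial:
  obtains \<tau> where "\<tau> \<in> A" "\<tau> \<noteq> 0" "T = span {\<tau>}" "br X \<tau> = 0" "br Y \<tau> = 0" "br H \<tau> = 0"
proof -
  obtain B where B: "B \<subseteq> T" "independent B" "T \<subseteq> span B" "card B = dim T"
    using basis_exists by blast
  then obtain \<tau> where \<tau>: "B = {\<tau>}" using dimT by (metis card_1_singletonE)
  have Tsp: "T = span {\<tau>}"
    using B subspace_T by (simp add: \<tau> span_minimal subset_antisym)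
  have \<tau>0: "\<tau> \<noteq> 0" using B(2) \<tau> dependent_zero by auto
  have \<tau>A: "\<tau> \<in> A" using B \<tau> TR RA by auto
  have "\<exists>k. br Z \<tau> = k *\<^sub>R \<tau>" if "Z \<in> S" for Z
  proof -
    have "br Z \<tau> \<in> span {\<tau>}" using T that B \<tau> Tsp by (auto simp: ad_invariant_def)
    then show ?thesis by (auto simp: span_singleton)
  qed
  then obtain kx ky kh where k: "br X \<tau> = kx *\<^sub>R \<tau>" "br Y \<tau> = ky *\<^sub>R \<tau>" "br H \<tau> = kh *\<^sub>R \<tau>"
    using XYH_S by metis
  have h: "br H \<tau> = 0"
    using br_jacobi[OF XYH_A(1,2) \<tau>A] XYH_A \<tau>A by (simp add: XY k br_scale_right mult.commute[of ky kx])
  have x: "br X \<tau> = 0"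
    using br_jacobi[OF XYH_A(3,1) \<tau>A] XYH_A \<tau>A h
    by (simp add: HX br_zero_right br_scale_left) (simp add: k br_scale_right h[unfolded k])
  have y: "br Y \<tau> = 0"
  proof -
    have "br H (br Y \<tau>) = 0" by (simp add: k(2) br_scale_right[OF XYH_A(3) \<tau>A] h)
    moreover have "br (br H Y) \<tau> = (-2) *\<^sub>R br Y \<tau>"
      unfolding HY by (rule br_scale_left[OF \<tau>A XYH_A(2)])
    moreover have "br Y (br H \<tau>) = 0" by (simp add: h br_zero_right XYH_A)
    ultimately show ?thesis using br_jacobi[OF XYH_A(3,2) \<tau>A] by simp
  qed
  show thesis using that \<tau>A \<tau>0 Tsp x y h by blast
qed

end

locale sl2_levi_chart = sl2_levi + chart D \<phi>
  for D \<phi> +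
  assumes DU: "D \<subseteq> U" and nonempty: "D \<noteq> {}"
    and can: "\<And>q. q \<in> \<phi> ` D \<Longrightarrow> push X q = (1, 0)" "\<And>q. q \<in> \<phi> ` D \<Longrightarrow> push V q = (0, 1)"
begin

abbreviation "E \<equiv> \<phi> ` D"
abbreviation "x1 Z \<equiv> \<lambda>q. fst (push Z q)"
abbreviation "x2 Z \<equiv> \<lambda>q. snd (push Z q)"

lemma push_A: "Z \<in> A \<Longrightarrow> push Z \<in> vfields E"
  by (rule push_vfields[OF smooth_on_subset[OF vfieldsD(1)[OF A_vfields] DU]])

lemma smooth_x: "Z \<in> A \<Longrightarrow> smooth_on E (x1 Z)" "Z \<in> A \<Longrightarrow> smooth_on E (x2 Z)"
  using smooth_on_fst[OF open_im vfieldsD(1)[OF push_A]] smooth_on_snd[OF open_im vfieldsD(1)[OF push_A]] by auto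

lemma diff_x: "Z \<in> A \<Longrightarrow> q \<in> E \<Longrightarrow> x1 Z differentiable at q" "Z \<in> A \<Longrightarrow> q \<in> E \<Longrightarrow> x2 Z differentiable at q"
  using smooth_differentiable[OF smooth_x(1)] smooth_differentiable[OF smooth_x(2)] by auto

text \<open>A field of the algebra is determined by its germ, hence by its expression in any chart. Identities
  between fields can therefore be checked in coordinates.\<close>

lemma push_eqI:
  assumes "Z \<in> A" "Z' \<in> A" "\<And>q. q \<in> E \<Longrightarrow> push Z q = push Z' q"
  shows "Z = Z'"
proof -
  have "Z - Z' \<in> A" using assms A_facts(1) by (simp add: subspace_diff)
  moreover have "(Z - Z') p = 0" if "p \<in> D" for p
  proof (rule push_zero_imp[OF that])
    show "push (Z - Z') (\<phi> p) = 0"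
      using assms(3)[of "\<phi> p"] that linear_diff[OF linear_push, of Z Z'] by (simp add: fun_diff_def)
  qed
  ultimately have "Z - Z' = 0"
    using A open_D nonempty DU unfolding local_lie_algebra_def by blast
  then show ?thesis by simp
qed

lemma push_br:
  assumes "Z \<in> A" "Z' \<in> A" "q \<in> E"
  shows "x1 (br Z Z') q = x1 Z q * dx (x1 Z') q + x2 Z q * dy (x1 Z') q
      - (x1 Z' q * dx (x1 Z) q + x2 Z' q * dy (x1 Z) q)"
    "x2 (br Z Z') q = x1 Z q * dx (x2 Z') q + x2 Z q * dy (x2 Z') q
      - (x1 Z' q * dx (x2 Z) q + x2 Z' q * dy (x2 Z) q)"
  using lie_bracket_along[OF assms(3) vfields_differentiable[OF push_A[OF assms(1)] assms(3)]
      vfields_differentiable[OF push_A[OF assms(2)] assms(3)]]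
    push_lie_bracket[OF DU U A_vfields[OF assms(1)] A_vfields[OF assms(2)]]
  by (simp_all add: along_def)

lemma partials_X_V:
  assumes "q \<in> E"
  shows "dx (x1 X) q = 0" "dx (x2 X) q = 0" "dy (x1 X) q = 0" "dy (x2 X) q = 0"
    "dx (x1 V) q = 0" "dx (x2 V) q = 0" "dy (x1 V) q = 0" "dy (x2 V) q = 0"
proof -
  have "dx f q = 0 \<and> dy f q = 0" if "f differentiable at q" "\<And>q. q \<in> E \<Longrightarrow> f q = c"
    for f :: "real \<times> real \<Rightarrow> real" and c
    using dx_cong[OF open_im assms that(2,1)] dy_cong[OF open_im assms that(2,1)] by simp
  note * = this
  show "dx (x1 X) q = 0" "dx (x2 X) q = 0" "dy (x1 X) q = 0" "dy (x2 X) q = 0"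
    "dx (x1 V) q = 0" "dx (x2 V) q = 0" "dy (x1 V) q = 0" "dy (x2 V) q = 0"
    using *[OF diff_x(1)[OF XYH_A(1) assms], of 1] *[OF diff_x(2)[OF XYH_A(1) assms], of 0]
      *[OF diff_x(1)[OF VA assms], of 0] *[OF diff_x(2)[OF VA assms], of 1] can by auto
qed

text \<open>In canonical coordinates \<open>ad X\<close> and \<open>ad V\<close> are the partial derivatives of components. All
  differential equations below are brackets read through this lemma and the next one.\<close>

lemma dx_x:
  assumes "Z \<in> A" "q \<in> E"
  shows "dx (x1 Z) q = x1 (br X Z) q" "dx (x2 Z) q = x2 (br X Z) q"
  using assms XYH_A by (simp_all add: push_br partials_X_V can)

lemma dy_x:
  assumes "Z \<in> A" "q \<in> E"
  shows "dy (x1 Z) q = x1 (br V Z) q" "dy (x2 Z) q = x2 (br V Z) q"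
  using assms VA by (simp_all add: push_br partials_X_V can)

lemma push_scale_at: "push (c *\<^sub>R Z) q = c *\<^sub>R push Z q"
  unfolding push_scale by (simp add: scaleR_fun_def)

lemma push_add_at: "push (Z + Z') q = push Z q + push Z' q"
  unfolding push_add by (simp add: plus_fun_def)

lemma push_minus_at: "push (- Z) q = - push Z q"
  using push_scale_at[of "-1" Z q] by simp

lemma push_0_at: "push 0 q = 0"
  using push_scale_at[of 0 0 q] by simp

lemma affine_of_constant_partials:
  fixes f :: "real \<times> real \<Rightarrow> real"
  assumes "smooth_on E f" "\<And>q. q \<in> E \<Longrightarrow> dx f q = \<alpha>" "\<And>q. q \<in> E \<Longrightarrow> dy f q = \<beta>"
  obtains k where "\<And>q. q \<in> E \<Longrightarrow> f q = \<alpha> * fst q + \<beta> * snd q + k"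
proof -
  have l: "((\<lambda>q. \<alpha> * fst q + \<beta> * snd q) has_derivative (\<lambda>h. \<alpha> * fst h + \<beta> * snd h)) (at q)" for q :: "real \<times> real"
    by (auto intro!: derivative_eq_intros)
  have *: "(\<lambda>q. f q - (\<alpha> * fst q + \<beta> * snd q)) differentiable at q
      \<and> dx (\<lambda>q. f q - (\<alpha> * fst q + \<beta> * snd q)) q = 0 \<and> dy (\<lambda>q. f q - (\<alpha> * fst q + \<beta> * snd q)) q = 0"
    if "q \<in> E" for q
  proof -
    note d = smooth_differentiable[OF assms(1) that]
    have d': "(\<lambda>q. \<alpha> * fst q + \<beta> * snd q) differentiable at q"
      unfolding differentiable_def using l[of q] by blast
    show ?thesis
      using assms(2,3)[OF that] dx_eqI[OF l, of q] dy_eqI[OF l, of q]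
      by (simp add: dx_diff[OF d d'] dy_diff[OF d d'] differentiable_diff[OF d d'])
  qed
  obtain k where "\<And>q. q \<in> E \<Longrightarrow> f q - (\<alpha> * fst q + \<beta> * snd q) = k"
    by (rule partials_zero_imp_const[OF open_im connected_im *]) blast+
  then show thesis using that[of k] by (metis add.commute diff_add_cancel)
qed

text \<open>Rank one means that at generic points every field of \<open>R\<close> is a multiple of \<open>V\<close>, which belongs
  to \<open>R\<close>; by continuity it has no \<open>\<partial>\<^sub>x\<close>-component anywhere.\<close>

lemma x1_R:
  assumes Z: "Z \<in> R" and q: "q \<in> E"
  shows "x1 Z q = 0"
proof (rule ccontr)
  assume n: "x1 Z q \<noteq> 0"
  obtain G where G: "open G" "U \<subseteq> closure G" "\<And>p. p \<in> G \<Longrightarrow> dim {Z p | Z. Z \<in> R} = 1"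
    using rank by (auto simp: has_rank_def)
  have ZA: "Z \<in> A" using Z RA by auto
  have "continuous_on D (\<lambda>p. x1 Z (\<phi> p))"
    by (rule continuous_on_compose2[OF smooth_continuous_on[OF smooth_x(1)[OF ZA]]
          smooth_continuous_on[OF smooth]]) auto
  then have op: "open (D \<inter> (\<lambda>p. x1 Z (\<phi> p)) -` (- {0}))"
    by (rule continuous_open_preimage[OF _ open_D]) auto
  obtain p0 where p0: "p0 \<in> D" "q = \<phi> p0" using q by auto
  then have "p0 \<in> D \<inter> (\<lambda>p. x1 Z (\<phi> p)) -` (- {0})" "p0 \<in> closure G"
    using n G(2) DU by auto
  then obtain p where p: "p \<in> G" "p \<in> D" "x1 Z (\<phi> p) \<noteq> 0"
    using closure_iff_nhds_not_empty[of p0 G] op by blast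
  have V0: "V p \<noteq> 0"
  proof
    assume "V p = 0"
    then have "push V (\<phi> p) = 0"
      using p(2) linear_0[OF linear_frechet_derivative[OF differentiable[OF p(2)]]] by (simp add: push_apply)
    then show False using can(2)[of "\<phi> p"] p(2) by (simp add: zero_prod_def)
  qed
  have "span {V p} = span {Z p | Z. Z \<in> R}"
  proof (rule dim_eq_span)
    show "{V p} \<subseteq> {Z p | Z. Z \<in> R}" using V_facts WR by auto
    show "dim {Z p | Z. Z \<in> R} \<le> dim {V p}" using G(3)[OF p(1)] V0 by (simp add: dim_singleton)
  qed
  moreover have "Z p \<in> span {Z p | Z. Z \<in> R}" using Z by (auto intro: span_base)
  ultimately obtain k where k: "Z p = k *\<^sub>R V p" by (auto simp: span_singleton)
  have "push Z (\<phi> p) = k *\<^sub>R push V (\<phi> p)"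
    using p(2) k linear_scale[OF linear_frechet_derivative[OF differentiable[OF p(2)]]] by (simp add: push_apply)
  then show False using p can(2)[of "\<phi> p"] by simp
qed

lemma x1_W: "w \<in> W \<Longrightarrow> q \<in> E \<Longrightarrow> x1 w q = 0"
  using x1_R[of w q] WR by blast

lemma push_W_eqI:
  assumes "w \<in> W" "w' \<in> W" "\<And>q. q \<in> E \<Longrightarrow> x2 w q = x2 w' q"
  shows "w = w'"
  by (rule push_eqI[OF WA WA]) (use assms x1_W in \<open>auto simp: prod_eq_iff\<close>)

lemma push_H:
  obtains a b c where "br H V = c *\<^sub>R V" "\<And>q. q \<in> E \<Longrightarrow> push H q = (- 2 * fst q + a, - c * snd q + b)"
proof -
  obtain c where c: "br H V = c *\<^sub>R V" using V by (auto simp: highest_weight_vector_def)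
  have XH: "br X H = (-2) *\<^sub>R X" and VH: "br V H = (- c) *\<^sub>R V"
    using lie_bracket_antisym[of U X H] lie_bracket_antisym[of U V H] by (simp_all add: HX c)
  note d = dx_x[OF XYH_A(3)] dy_x[OF XYH_A(3)]
  obtain a where a: "\<And>q. q \<in> E \<Longrightarrow> x1 H q = - 2 * fst q + 0 * snd q + a"
    by (rule affine_of_constant_partials[OF smooth_x(1)[OF XYH_A(3)], of "-2" 0])
      (auto simp: d XH VH push_scale_at push_minus_at can)
  obtain b where b: "\<And>q. q \<in> E \<Longrightarrow> x2 H q = 0 * fst q + (- c) * snd q + b"
    by (rule affine_of_constant_partials[OF smooth_x(2)[OF XYH_A(3)], of 0 "- c"])
      (auto simp: d XH VH push_scale_at push_minus_at can)
  show thesis by (rule that[OF c, of a b]) (simp add: prod_eq_iff a b)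
qed

lemma push_Y_partials:
  assumes q: "q \<in> E"
  shows "dx (x1 Y) q = x1 H q" "dy (x1 Y) q = 0" "dx (x2 Y) q = x2 H q"
    "dy (x2 Y) q = - x2 (br Y V) q"
  using dx_x[OF XYH_A(2) q] dy_x[OF XYH_A(2) q] x1_W[OF W_inv[OF XYH_S(2) V_facts(1)] q]
    lie_bracket_antisym[of U V Y]
  by (simp_all add: XY push_minus_at)

text \<open>A weight \<open>c = 0\<close> would make \<open>\<tau>\<close> a multiple of \<open>V\<close>, if \<open>H\<close> has a \<open>\<partial>\<^sub>y\<close>-component, or else make
  the line through \<open>V\<close> invariant.\<close>

lemma weight_nonzero:
  assumes c: "br H V = c *\<^sub>R V" and H: "\<And>q. q \<in> E \<Longrightarrow> push H q = (- 2 * fst q + a, - c * snd q + b)"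
  shows "c \<noteq> 0"
proof
  assume c0: "c = 0"
  obtain \<tau> where \<tau>: "\<tau> \<in> A" "\<tau> \<noteq> 0" "T = span {\<tau>}" "br X \<tau> = 0" "br Y \<tau> = 0" "br H \<tau> = 0"
    by (rule T_trivial)
  have \<tau>R: "\<tau> \<in> R" using \<tau>(3) TR by (auto intro: span_base)
  have dH: "dx (x1 H) q = -2" "dy (x1 H) q = 0" "dx (x2 H) q = 0" "dy (x2 H) q = 0" if "q \<in> E" for q
    using dx_x[OF XYH_A(3) that] dy_x[OF XYH_A(3) that] lie_bracket_antisym[of U X H] lie_bracket_antisym[of U V H] that
    by (simp_all add: HX c c0 push_minus_at push_scale_at can push_0_at)
  show False
  proof (cases "b = 0")
    case False
    have dt: "dx (x2 \<tau>) q = 0" "dy (x2 \<tau>) q = 0" if q: "q \<in> E" for q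
    proof -
      show x: "dx (x2 \<tau>) q = 0" using dx_x[OF \<tau>(1) q] by (simp add: \<tau> push_0_at)
      have "b * dy (x2 \<tau>) q = 0"
        using push_br(2)[OF XYH_A(3) \<tau>(1) q] x dH[OF q] x1_R[OF \<tau>R q] H[OF q]
        by (simp add: \<tau> push_0_at c0)
      then show "dy (x2 \<tau>) q = 0" using False by simp
    qed
    obtain k where k: "\<And>q. q \<in> E \<Longrightarrow> x2 \<tau> q = 0 * fst q + 0 * snd q + k"
      by (rule affine_of_constant_partials[OF smooth_x(2)[OF \<tau>(1)] dt]) blast+
    have "\<tau> = k *\<^sub>R V"
      by (rule push_eqI[OF \<tau>(1) subspace_scale[OF A_facts(1) VA]])
        (simp add: k x1_R[OF \<tau>R] can push_scale_at prod_eq_iff)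
    then have "\<tau> \<in> W \<inter> T" using V_facts subspace_scale[OF subspace_W] \<tau>(3) by (auto intro: span_base)
    then show False using W_T \<tau>(2) by auto
  next
    case True
    have Y0: "x2 Y q = 0" if q: "q \<in> E" for q
      using push_br(2)[OF XYH_A(3,2) q] dH[OF q] H[OF q] push_Y_partials(3)[OF q]
      by (simp add: HY push_scale_at push_minus_at c0 True)
    have "br Y V = 0"
    proof (rule push_W_eqI[OF W_inv[OF XYH_S(2) V_facts(1)] subspace_0[OF subspace_W]])
      fix q assume q: "q \<in> E"
      have "dy (x2 Y) q = dy (\<lambda>_. 0) q"
        by (rule dy_cong[OF open_im q Y0 diff_x(2)[OF XYH_A(2) q]])
      then show "x2 (br Y V) q = x2 0 q" using push_Y_partials(4)[OF q] by (simp add: push_0_at)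
    qed
    have "span {V} = W"
    proof (rule irreducible_eq)
      show "span {V} \<subseteq> W" using V_facts subspace_W by (intro span_minimal) auto
      show "V \<in> span {V}" by (rule span_base) simp
      fix w assume "w \<in> span {V}"
      then obtain k where k: "w = k *\<^sub>R V" by (auto simp: span_singleton)
      have "br X w = 0" "br Y w = 0" "br H w = 0"
        unfolding k using c c0 V_facts(3) \<open>br Y V = 0\<close> by (simp_all add: br_scale_right XYH_A VA)
      then show "br X w \<in> span {V} \<and> br Y w \<in> span {V} \<and> br H w \<in> span {V}"
        by (simp add: span_zero)
    qed simp
    then have "dim W \<le> card {V}"
      by (intro dim_le_card) auto
    then show False using dimW N2 by simp
  qed
qed

end

lemma independent_family:
  fixes f :: "nat \<Rightarrow> 'a::real_vector"
  assumes "\<And>a. (\<Sum>k\<le>n. a k *\<^sub>R f k) = 0 \<Longrightarrow> (\<forall>k\<le>n. a k = 0)"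
  shows "inj_on f {..n}" "independent (f ` {..n})"
proof -
  show inj: "inj_on f {..n}"
  proof (rule inj_onI, rule ccontr)
    fix i j assume ij: "i \<in> {..n}" "j \<in> {..n}" "f i = f j" "i \<noteq> j"
    define a :: "nat \<Rightarrow> real" where "a = (\<lambda>k. if k = i then 1 else if k = j then -1 else 0)"
    have "(\<Sum>k\<le>n. a k *\<^sub>R f k) = (\<Sum>k\<in>{i, j}. a k *\<^sub>R f k)"
      by (rule sum.mono_neutral_right) (use ij in \<open>auto simp: a_def\<close>)
    also have "\<dots> = 0" using ij by (simp add: a_def)
    finally have "a i = 0" using assms[of a] ij by auto
    then show False by (simp add: a_def)
  qed
  show "independent (f ` {..n})"
  proof (rule independent_if_scalars_zero)
    fix g x assume g: "(\<Sum>x\<in>f ` {..n}. g x *\<^sub>R x) = 0" and x: "x \<in> f ` {..n}"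
    have "(\<Sum>k\<le>n. g (f k) *\<^sub>R f k) = 0" using g by (simp add: sum.reindex[OF inj])
    then show "g x = 0" using assms[of "\<lambda>k. g (f k)"] x by auto
  qed simp
qed

lemma span_family:
  fixes f :: "nat \<Rightarrow> 'a::real_vector"
  shows "v \<in> span (f ` {..<n}) \<Longrightarrow> \<exists>a. v = (\<Sum>k<n. a k *\<^sub>R f k)"
proof (induction n arbitrary: v)
  case (Suc n)
  then obtain r where "v - r *\<^sub>R f n \<in> span (f ` {..<n})"
    by (auto simp: lessThan_Suc span_insert)
  then obtain a where a: "v - r *\<^sub>R f n = (\<Sum>k<n. a k *\<^sub>R f k)" using Suc.IH by blast
  have "(\<Sum>k<n. (a(n := r)) k *\<^sub>R f k) = (\<Sum>k<n. a k *\<^sub>R f k)" by (rule sum.cong) auto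
  then have "v = (\<Sum>k<Suc n. (a(n := r)) k *\<^sub>R f k)" using a by (simp add: algebra_simps)
  then show ?case by (rule exI[of _ "a(n := r)"])
qed simp

text \<open>Canonical coordinates in which the affine expression of \<open>H\<close> is linear, as they are obtained by a
  translation once the weight \<open>c\<close> is known to be nonzero.\<close>

locale sl2_levi_normal = sl2_levi_chart +
  fixes c :: real
  assumes weight: "br H V = c *\<^sub>R V" and c0: "c \<noteq> 0"
    and pH: "\<And>q. q \<in> E \<Longrightarrow> push H q = (- 2 * fst q, - c * snd q)"
begin

lemma partials_H:
  assumes q: "q \<in> E"
  shows "dx (x1 H) q = -2" "dy (x1 H) q = 0" "dx (x2 H) q = 0" "dy (x2 H) q = - c"
  using dx_x[OF XYH_A(3) q] dy_x[OF XYH_A(3) q] lie_bracket_antisym[of U X H] lie_bracket_antisym[of U V H] q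
  by (simp_all add: HX weight push_minus_at push_scale_at can)

lemma snd_mult_zero: "g p = 0" if "smooth_on E g" "\<And>p. p \<in> E \<Longrightarrow> snd p * g p = 0" "p \<in> E" for g p
  using snd_mult_zero_imp_zero[OF open_im smooth_continuous_on[OF that(1)] that(2,3)] .

lemma E_two_points:
  obtains x y e where "(x, y) \<in> E" "(x, y + e) \<in> E" "e \<noteq> 0"
proof -
  obtain x y where xy: "(x, y) \<in> E" using nonempty by (metis all_not_in_conv image_is_empty surj_pair)
  obtain e where e: "e > 0" "ball (x, y) e \<subseteq> E" using openE[OF open_im xy] by blast
  have "(x, y + e/2) \<in> ball (x, y) e" using e by (simp add: dist_Pair_Pair dist_real_def)
  then show thesis using that[OF xy, of "e/2"] e by auto
qed

text \<open>Since \<open>[H, \<tau>] = 0\<close>, the component \<open>t\<close> of \<open>\<tau>\<close> satisfies \<open>t = y t\<^sub>y\<close>, and differentiating once more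
  gives \<open>y t\<^sub>y\<^sub>y = 0\<close>. Hence \<open>\<tau>\<close> is a multiple of \<open>y \<partial>\<^sub>y\<close>.\<close>

lemma T_is_scaling:
  obtains \<tau> \<kappa> where "\<tau> \<in> A" "T = span {\<tau>}" "br X \<tau> = 0" "br Y \<tau> = 0" "br H \<tau> = 0" "\<kappa> \<noteq> 0"
    "\<And>q. q \<in> E \<Longrightarrow> push \<tau> q = (0, \<kappa> * snd q)"
proof -
  obtain \<tau> where \<tau>: "\<tau> \<in> A" "\<tau> \<noteq> 0" "T = span {\<tau>}" "br X \<tau> = 0" "br Y \<tau> = 0" "br H \<tau> = 0"
    by (rule T_trivial)
  have \<tau>R: "\<tau> \<in> R" using \<tau>(3) TR by (auto intro: span_base)
  define \<sigma> where "\<sigma> = br V \<tau>"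
  have \<sigma>A: "\<sigma> \<in> A" unfolding \<sigma>_def by (rule A_facts(3)[OF VA \<tau>(1)])
  have X\<sigma>: "br X \<sigma> = 0"
    using br_jacobi[OF XYH_A(1) VA \<tau>(1)] lie_bracket_self[of U \<tau>] br_scale_left[OF \<tau>(1) VA, of 0]
    by (simp add: \<sigma>_def V_facts \<tau> br_zero_right VA)
  have t: "x2 \<tau> q = snd q * x2 \<sigma> q" if q: "q \<in> E" for q
  proof -
    have "c * (x2 \<tau> q - snd q * x2 \<sigma> q) = 0"
      using push_br(2)[OF XYH_A(3) \<tau>(1) q] partials_H[OF q] x1_R[OF \<tau>R q] pH[OF q]
        dx_x(2)[OF \<tau>(1) q] dy_x(2)[OF \<tau>(1) q]
      by (auto simp: \<tau> push_0_at \<sigma>_def algebra_simps)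
    then show ?thesis using c0 by simp
  qed
  have ds: "dx (x2 \<sigma>) q = 0" if "q \<in> E" for q
    using dx_x(2)[OF \<sigma>A that] by (simp add: X\<sigma> push_0_at)
  have "snd q * dy (x2 \<sigma>) q = 0" if q: "q \<in> E" for q
  proof -
    have dsnd: "snd differentiable at q"
      unfolding differentiable_def using has_derivative_snd[OF has_derivative_ident] by blast
    have "dy (x2 \<tau>) q = dy (\<lambda>q. snd q * x2 \<sigma> q) q"
      by (rule dy_cong[OF open_im q t diff_x(2)[OF \<tau>(1) q]])
    moreover have "dy (x2 \<tau>) q = x2 \<sigma> q" using dy_x(2)[OF \<tau>(1) q] by (simp add: \<sigma>_def)
    ultimately show ?thesis by (simp add: dy_mult[OF dsnd diff_x(2)[OF \<sigma>A q]])
  qed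
  then have dys: "dy (x2 \<sigma>) q = 0" if "q \<in> E" for q
    using snd_mult_zero[OF smooth_on_dy[OF smooth_x(2)[OF \<sigma>A]] _ that] by blast
  obtain \<kappa> where \<kappa>: "\<And>q. q \<in> E \<Longrightarrow> x2 \<sigma> q = 0 * fst q + 0 * snd q + \<kappa>"
    by (rule affine_of_constant_partials[OF smooth_x(2)[OF \<sigma>A] ds dys]) blast+
  have p\<tau>: "push \<tau> q = (0, \<kappa> * snd q)" if "q \<in> E" for q
    using t[OF that] \<kappa>[OF that] x1_R[OF \<tau>R that] by (simp add: prod_eq_iff)
  have "\<kappa> \<noteq> 0"
  proof
    assume "\<kappa> = 0"
    then have "\<tau> = 0"
      by (intro push_eqI[OF \<tau>(1) subspace_0[OF A_facts(1)]]) (simp add: p\<tau> push_0_at zero_prod_def)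
    then show False using \<tau> by simp
  qed
  then show thesis using that \<tau> p\<tau> by blast
qed

text \<open>The operator \<open>ad \<tau>\<close> commutes with \<open>S\<close> and acts on \<open>V\<close> by a scalar, hence on \<open>W\<close> by the same
  scalar. In coordinates this says that the fields of \<open>W\<close> do not depend on \<open>y\<close>.\<close>

lemma W_indep_of_y:
  assumes w: "w \<in> W" and q: "q \<in> E"
  shows "dy (x2 w) q = 0"
proof -
  obtain \<tau> \<kappa> where \<tau>: "\<tau> \<in> A" "T = span {\<tau>}" "br X \<tau> = 0" "br Y \<tau> = 0" "br H \<tau> = 0" "\<kappa> \<noteq> 0"
    "\<And>q. q \<in> E \<Longrightarrow> push \<tau> q = (0, \<kappa> * snd q)"
    by (rule T_is_scaling) blast
  have \<tau>R: "\<tau> \<in> R" using \<tau>(2) TR by (auto intro: span_base)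
  have d\<tau>: "dy (x2 \<tau>) q = \<kappa>" "dx (x2 \<tau>) q = 0" if q: "q \<in> E" for q
  proof -
    have d: "((\<lambda>q. \<kappa> * snd q) has_derivative (\<lambda>h. \<kappa> * snd h)) (at q)"
      by (auto intro!: derivative_eq_intros)
    have "dy (x2 \<tau>) q = dy (\<lambda>q. \<kappa> * snd q) q"
      by (rule dy_cong[OF open_im q _ diff_x(2)[OF \<tau>(1) q]]) (simp add: \<tau>)
    then show "dy (x2 \<tau>) q = \<kappa>" using dy_eqI[OF d] by simp
    show "dx (x2 \<tau>) q = 0" using dx_x(2)[OF \<tau>(1) q] by (simp add: \<tau> push_0_at)
  qed
  define Q where "Q = {w \<in> W. br \<tau> w = (- \<kappa>) *\<^sub>R w}"
  have "Q = W"
  proof (rule irreducible_eq)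
    show "subspace Q"
      using subspace_W br_zero_right[OF \<tau>(1)] br_add_right[OF \<tau>(1) WA WA] br_scale_right[OF \<tau>(1) WA]
      unfolding Q_def subspace_def by (auto simp: scaleR_add_right)
    show "Q \<subseteq> W" by (auto simp: Q_def)
    have "br \<tau> V = (- \<kappa>) *\<^sub>R V"
    proof (rule push_eqI[OF A_facts(3)[OF \<tau>(1) VA] subspace_scale[OF A_facts(1) VA]])
      fix q assume q: "q \<in> E"
      have "br \<tau> V = - br V \<tau>" by (rule lie_bracket_antisym)
      then show "push (br \<tau> V) q = push (- \<kappa> *\<^sub>R V) q"
        using dy_x[OF \<tau>(1) q] d\<tau>[OF q] q push_br(1)[OF VA \<tau>(1) q] partials_X_V[OF q] x1_R[OF \<tau>R]
          dy_cong[OF open_im q x1_R[OF \<tau>R] diff_x(1)[OF \<tau>(1) q]]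
        by (simp add: prod_eq_iff push_minus_at push_scale_at can)
    qed
    then show "V \<in> Q" using V_facts by (simp add: Q_def)
    fix w assume "w \<in> Q"
    then have w: "w \<in> W" "br \<tau> w = (- \<kappa>) *\<^sub>R w" by (auto simp: Q_def)
    have "br Z w \<in> Q" if Z: "Z \<in> S" "br Z \<tau> = 0" for Z
    proof -
      have ZA: "Z \<in> A" using Z SA by auto
      have "br \<tau> Z = 0" using lie_bracket_antisym[of U \<tau> Z] Z by simp
      then have "br \<tau> (br Z w) = br Z (br \<tau> w)"
        using br_jacobi[OF \<tau>(1) ZA WA[OF w(1)]] br_scale_left[OF WA[OF w(1)] ZA, of 0] by simp
      also have "\<dots> = (- \<kappa>) *\<^sub>R br Z w"
        unfolding w(2) by (rule br_scale_right[OF ZA WA[OF w(1)]])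
      finally show ?thesis using W_inv[OF Z(1) w(1)] by (simp add: Q_def)
    qed
    then show "br X w \<in> Q \<and> br Y w \<in> Q \<and> br H w \<in> Q" using XYH_S \<tau> by blast
  qed
  then have br\<tau>: "br \<tau> w = (- \<kappa>) *\<^sub>R w" using w by (auto simp: Q_def)
  have "snd q * dy (x2 w) q = 0" if q: "q \<in> E" for q
  proof -
    have "\<kappa> * (snd q * dy (x2 w) q) = 0"
      using push_br(2)[OF \<tau>(1) WA[OF w] q] d\<tau>[OF q] x1_W[OF w q] \<tau>(7)[OF q]
      by (simp add: br\<tau> push_scale_at push_minus_at)
    then show ?thesis using \<tau>(6) by simp
  qed
  then show ?thesis using snd_mult_zero[OF smooth_on_dy[OF smooth_x(2)[OF WA[OF w]]] _ q] by blast
qed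

text \<open>The field \<open>[Y, V]\<close> lies in \<open>W\<close>, so its component does not depend on \<open>y\<close>, and \<open>[X, [Y, V]] = c V\<close> makes
  it \<open>c x + k\<close>. This is minus the \<open>y\<close>-derivative of the component of \<open>Y\<close>, whose \<open>x\<close>-derivative is that of
  \<open>[X, Y] = H\<close>. The relation \<open>[H, Y] = -2 Y\<close> is then affine in \<open>y\<close> and forces \<open>k = 0\<close>. At this stage
  \<open>c = -2\<close>, and with it a constant \<open>m \<noteq> 0\<close>, is not excluded.\<close>

lemma push_Y:
  obtains m where "(c + 2) * m = 0"
    "\<And>q. q \<in> E \<Longrightarrow> push Y q = (- (fst q)\<^sup>2, - c * fst q * snd q + m)"
    "\<And>q. q \<in> E \<Longrightarrow> dy (x2 Y) q = - c * fst q"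
proof -
  note WYV = W_inv[OF XYH_S(2) V_facts(1)]
  have XYV: "br X (br Y V) = c *\<^sub>R V"
    using br_jacobi[OF XYH_A(1,2) VA] by (simp add: XY weight V_facts br_zero_right XYH_A)
  obtain k where k: "\<And>q. q \<in> E \<Longrightarrow> x2 (br Y V) q = c * fst q + 0 * snd q + k"
  proof (rule affine_of_constant_partials[OF smooth_x(2)[OF WA[OF WYV]]])
    show "dx (x2 (br Y V)) q = c" if "q \<in> E" for q
      using dx_x(2)[OF WA[OF WYV] that] can that by (simp add: XYV push_scale_at)
    show "dy (x2 (br Y V)) q = 0" if "q \<in> E" for q by (rule W_indep_of_y[OF WYV that])
  qed blast
  have Y1: "x1 Y q = - (fst q)\<^sup>2" if q: "q \<in> E" for q
    using push_br(1)[OF XYH_A(3,2) q] partials_H[OF q] push_Y_partials(1,2)[OF q] pH[OF q]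
    by (simp add: HY push_scale_at push_minus_at power2_eq_square)
  have dxy: "((\<lambda>q. c * fst q * snd q) has_derivative (\<lambda>h. c * (fst h * snd q + fst q * snd h))) (at q)"
    for q :: "real \<times> real"
    by (auto intro!: derivative_eq_intros simp: algebra_simps)
  have dxy': "(\<lambda>q. c * fst q * snd q) differentiable at q" for q :: "real \<times> real"
    unfolding differentiable_def using dxy[of q] by blast
  have sm: "smooth_on E (\<lambda>q. x2 Y q + c * fst q * snd q)"
    by (intro smooth_on_add smooth_on_mult smooth_on_const smooth_on_fst smooth_on_snd smooth_on_ident open_im smooth_x(2) XYH_A)
  obtain m where m: "\<And>q. q \<in> E \<Longrightarrow> x2 Y q + c * fst q * snd q = 0 * fst q + (- k) * snd q + m"
  proof (rule affine_of_constant_partials[OF sm])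
    fix q assume q: "q \<in> E"
    show "dx (\<lambda>q. x2 Y q + c * fst q * snd q) q = 0"
      using push_Y_partials(3)[OF q] pH[OF q] dx_eqI[OF dxy, of q]
      by (simp add: dx_add[OF diff_x(2)[OF XYH_A(2) q] dxy'])
    show "dy (\<lambda>q. x2 Y q + c * fst q * snd q) q = - k"
      using push_Y_partials(4)[OF q] k[OF q] dy_eqI[OF dxy, of q]
      by (simp add: dy_add[OF diff_x(2)[OF XYH_A(2) q] dxy'])
  qed blast
  have lin: "- 2 * k * snd q + (c + 2) * m = 0" if q: "q \<in> E" for q
  proof -
    have "- 2 * x2 Y q = (- 2 * fst q) * (- c * snd q) + (- c * snd q) * (- (c * fst q + k)) + c * x2 Y q"
      using push_br(2)[OF XYH_A(3,2) q] partials_H[OF q] push_Y_partials(3,4)[OF q] pH[OF q] k[OF q]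
      by (simp add: HY push_scale_at push_minus_at)
    moreover have "x2 Y q = - c * fst q * snd q - k * snd q + m" using m[OF q] by simp
    ultimately show ?thesis by (simp add: algebra_simps)
  qed
  obtain x y e where xy: "(x, y) \<in> E" "(x, y + e) \<in> E" "e \<noteq> 0" by (rule E_two_points)
  have "k * e = 0" using lin[OF xy(1)] lin[OF xy(2)] by (simp add: algebra_simps)
  then have k0: "k = 0" using xy(3) by simp
  show thesis
  proof (rule that[of m])
    show "(c + 2) * m = 0" using lin[OF xy(1)] k0 by simp
    show "push Y q = (- (fst q)\<^sup>2, - c * fst q * snd q + m)" if "q \<in> E" for q
      using Y1[OF that] m[OF that] k0 by (simp add: prod_eq_iff)
    show "dy (x2 Y) q = - c * fst q" if "q \<in> E" for q
      using push_Y_partials(4)[OF that] k[OF that] k0 by simp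
  qed
qed

text \<open>\<open>Vk k = (ad Y)\<^sup>k V\<close> turns out to be \<open>ff k x\<^sup>k \<partial>\<^sub>y\<close> with the falling factorial
  \<open>ff k = c (c - 1) \<cdots> (c - k + 1)\<close>.\<close>

primrec Vk :: "nat \<Rightarrow> vfield" where
  "Vk 0 = V" | "Vk (Suc k) = br Y (Vk k)"

primrec ff :: "nat \<Rightarrow> real" where
  "ff 0 = 1" | "ff (Suc k) = (c - real k) * ff k"

lemma Vk_W: "Vk k \<in> W"
  by (induction k) (auto intro: V_facts W_inv XYH_S)

lemma Vk_A: "Vk k \<in> A" by (rule WA[OF Vk_W])

lemma has_derivative_monomial:
  "((\<lambda>q :: real \<times> real. f * fst q ^ k) has_derivative (\<lambda>h. f * (real k * fst h * fst q ^ (k - 1)))) (at q)"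
  by (rule has_derivative_mult_right, rule has_derivative_eq_rhs[OF has_derivative_power[OF has_derivative_fst[OF has_derivative_ident]]])
    (auto simp: fun_eq_iff)

lemma Vk_monomial:
  assumes "q \<in> E"
  shows "x2 (Vk k) q = ff k * fst q ^ k"
  using assms
proof (induction k arbitrary: q)
  case 0
  then show ?case by (simp add: can)
next
  case (Suc k)
  obtain m where m: "\<And>q. q \<in> E \<Longrightarrow> push Y q = (- (fst q)\<^sup>2, - c * fst q * snd q + m)"
    "\<And>q. q \<in> E \<Longrightarrow> dy (x2 Y) q = - c * fst q" by (rule push_Y) blast
  note q = Suc.prems
  have "dx (x2 (Vk k)) q = dx (\<lambda>q. ff k * fst q ^ k) q"
    by (rule dx_cong[OF open_im q Suc.IH diff_x(2)[OF Vk_A q]])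
  then have d: "dx (x2 (Vk k)) q = ff k * (real k * fst q ^ (k - 1))"
    using dx_eqI[OF has_derivative_monomial, of "ff k" k q] by simp
  have h: "x2 (Vk (Suc k)) q = - ((fst q)\<^sup>2 * (ff k * (real k * fst q ^ (k - 1)))) + c * fst q * (ff k * fst q ^ k)"
    using push_br(2)[OF XYH_A(2) Vk_A[of k] q] d W_indep_of_y[OF Vk_W q] x1_W[OF Vk_W q] m[OF q] Suc.IH[OF q]
    by simp
  have e: "(fst q)\<^sup>2 * (ff k * (real k * fst q ^ (k - 1))) = real k * ff k * fst q ^ Suc k"
    by (cases k) (simp_all add: power2_eq_square)
  show ?case using h unfolding e by (simp add: algebra_simps)
qed

lemma push_sum_at: "push (\<Sum>i\<in>I. f i) q = (\<Sum>i\<in>I. push (f i) q)"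
proof (induction I rule: infinite_finite_induct)
  case (infinite I)
  then show ?case by (simp only: sum.infinite push_0_at not_False_eq_True)
next
  case empty
  show ?case by (simp only: sum.empty push_0_at)
next
  case (insert i I)
  then show ?case by (simp only: sum.insert push_add_at not_False_eq_True)
qed

lemma x2_sum_Vk: "q \<in> E \<Longrightarrow> x2 (\<Sum>k\<in>I. a k *\<^sub>R Vk k) q = (\<Sum>k\<in>I. a k * ff k * fst q ^ k)"
  by (simp add: push_sum_at snd_sum push_scale_at Vk_monomial algebra_simps)

lemma br_X_Vk: "br X (Vk (Suc k)) = (real (Suc k) * (c - real k)) *\<^sub>R Vk k"
proof (rule push_W_eqI[OF W_inv[OF XYH_S(1) Vk_W] subspace_scale[OF subspace_W Vk_W]])
  fix q assume q: "q \<in> E"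
  have "dx (x2 (Vk (Suc k))) q = dx (\<lambda>q. ff (Suc k) * fst q ^ Suc k) q"
    by (rule dx_cong[OF open_im q Vk_monomial diff_x(2)[OF Vk_A q]])
  then show "x2 (br X (Vk (Suc k))) q = x2 ((real (Suc k) * (c - real k)) *\<^sub>R Vk k) q"
    using dx_eqI[OF has_derivative_monomial, of "ff (Suc k)" "Suc k" q] dx_x(2)[OF Vk_A q, of "Suc k"] Vk_monomial[OF q, of k]
    by (simp add: push_scale_at del: Vk.simps)
qed

lemma br_H_Vk: "br H (Vk k) = (c - 2 * real k) *\<^sub>R Vk k"
proof (rule push_W_eqI[OF W_inv[OF XYH_S(3) Vk_W] subspace_scale[OF subspace_W Vk_W]])
  fix q assume q: "q \<in> E"
  have "dx (x2 (Vk k)) q = dx (\<lambda>q. ff k * fst q ^ k) q"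
    by (rule dx_cong[OF open_im q Vk_monomial diff_x(2)[OF Vk_A q]])
  then have d: "dx (x2 (Vk k)) q = ff k * (real k * fst q ^ (k - 1))"
    using dx_eqI[OF has_derivative_monomial, of "ff k" k q] by simp
  have "x2 (br H (Vk k)) q = - 2 * fst q * (ff k * (real k * fst q ^ (k - 1))) + c * (ff k * fst q ^ k)"
    using push_br(2)[OF XYH_A(3) Vk_A[of k] q] d W_indep_of_y[OF Vk_W q] x1_W[OF Vk_W q] pH[OF q] partials_H[OF q] Vk_monomial[OF q, of k]
    by simp
  also have "\<dots> = (c - 2 * real k) * (ff k * fst q ^ k)"
    by (cases k) (simp_all add: algebra_simps)
  finally show "x2 (br H (Vk k)) q = x2 ((c - 2 * real k) *\<^sub>R Vk k) q"
    using Vk_monomial[OF q, of k] by (simp add: push_scale_at)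
qed

text \<open>If no \<open>ff k\<close> with \<open>k \<le> N\<close> vanished, the \<open>N + 1\<close> fields \<open>Vk 0, \<dots>, Vk N\<close> would be independent
  in \<open>W\<close>, because a polynomial that vanishes on an open set is zero.\<close>

lemma weight_natural:
  obtains n where "c = real n" "n < N"
proof -
  have "\<exists>k\<le>N. ff k = 0"
  proof (rule ccontr)
    assume "\<not> ?thesis"
    then have nz: "\<And>k. k \<le> N \<Longrightarrow> ff k \<noteq> 0" by blast
    have lin: "\<forall>k\<le>N. a k = 0" if a: "(\<Sum>k\<le>N. a k *\<^sub>R Vk k) = 0" for a
    proof (rule ccontr)
      assume "\<not> ?thesis"
      then have "\<exists>i\<le>N. a i * ff i \<noteq> 0" using nz by auto
      then have fin: "finite {z. (\<Sum>i\<le>N. (a i * ff i) * z ^ i) = 0}" by (simp add: polyfun_finite_roots)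
      have "fst ` E \<subseteq> {z. (\<Sum>i\<le>N. (a i * ff i) * z ^ i) = 0}"
      proof
        fix z assume "z \<in> fst ` E"
        then obtain q where q: "q \<in> E" "z = fst q" by blast
        have "x2 (\<Sum>k\<le>N. a k *\<^sub>R Vk k) q = 0" unfolding a by (simp only: push_0_at snd_zero)
        then show "z \<in> {z. (\<Sum>i\<le>N. (a i * ff i) * z ^ i) = 0}"
          unfolding x2_sum_Vk[OF q(1)] using q(2) by simp
      qed
      then have "finite (fst ` E)" using fin finite_subset by blast
      moreover have "open (fst ` E)" by (rule open_image_fst[OF open_im])
      ultimately show False using nonempty finite_imp_not_open by blast
    qed
    note ind = independent_family[OF lin]
    obtain B where B: "B \<subseteq> W" "independent B" "W \<subseteq> span B" "card B = dim W"
      using basis_exists by blast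
    have "finite B" using B(4) dimW N2 by (metis card.infinite not_numeral_le_zero)
    moreover have "Vk ` {..N} \<subseteq> span B" using B(3) Vk_W by auto
    ultimately have "card (Vk ` {..N}) \<le> card B" using independent_span_bound[OF _ ind(2)] by blast
    then show False using B(4) dimW by (simp add: card_image[OF ind(1)])
  qed
  then obtain k where k: "k \<le> N" "ff k = 0" by blast
  have "ff k = 0 \<Longrightarrow> \<exists>n<k. c = real n" for k
    by (induction k) (auto simp: less_Suc_eq)
  then show thesis using that k less_le_trans by blast
qed

text \<open>With \<open>c = n\<close> a natural number, \<open>Vk 0, \<dots>, Vk n\<close> span a subrepresentation, which must be all of
  \<open>W\<close>; comparing dimensions gives \<open>n = N - 1\<close>.\<close>

lemma weight_eq: "c = real N - 1"
  and W_eq: "W = span (Vk ` {..<N})"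
  and ff_nonzero: "i < N \<Longrightarrow> ff i \<noteq> 0"
proof -
  obtain n where n: "c = real n" "n < N" by (rule weight_natural)
  have ff_nz: "ff i \<noteq> 0" if "i \<le> n" for i
    using that
  proof (induction i)
    case (Suc i)
    have "c - real i \<noteq> 0" using Suc.prems n(1) by simp
    then show ?case using Suc by simp
  qed simp
  let ?Q = "span (Vk ` {..n})"
  have gen: "Vk k \<in> ?Q" if "k \<le> n" for k using that by (auto intro: span_base)
  have QW: "?Q \<subseteq> W" by (rule span_minimal[OF _ subspace_W]) (use Vk_W in auto)
  have top: "Vk (Suc n) = 0"
  proof (rule push_W_eqI[OF Vk_W subspace_0[OF subspace_W]])
    fix q assume q: "q \<in> E"
    have "ff (Suc n) = 0" unfolding ff.simps using n(1) by simp
    then show "x2 (Vk (Suc n)) q = x2 0 q" using Vk_monomial[OF q, of "Suc n"] by (simp only: push_0_at) simp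
  qed
  have closed: "br Z w \<in> ?Q" if Z: "Z \<in> A" and g: "\<And>k. k \<le> n \<Longrightarrow> br Z (Vk k) \<in> ?Q" and w: "w \<in> ?Q" for Z w
  proof -
    have "subspace {w \<in> A. br Z w \<in> ?Q}"
      using A_facts(1) br_zero_right[OF Z] br_add_right[OF Z] br_scale_right[OF Z]
      unfolding subspace_def by (auto intro: span_add span_scale span_zero)
    then have "?Q \<subseteq> {w \<in> A. br Z w \<in> ?Q}" using g Vk_A by (intro span_minimal) auto
    then show ?thesis using w by auto
  qed
  have QeqW: "?Q = W"
  proof (rule irreducible_eq[OF subspace_span QW])
    show "V \<in> ?Q" using gen[of 0] by simp
    have "br X (Vk k) \<in> ?Q" if "k \<le> n" for k
    proof (cases k)
      case 0
      then show ?thesis by (simp add: V_facts span_zero)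
    next
      case (Suc j)
      then show ?thesis using that unfolding Suc br_X_Vk by (intro span_scale gen) auto
    qed
    moreover have "br H (Vk k) \<in> ?Q" if "k \<le> n" for k
      unfolding br_H_Vk by (intro span_scale gen that)
    moreover have "br Y (Vk k) \<in> ?Q" if "k \<le> n" for k
    proof (cases "k = n")
      case True
      then show ?thesis using top by (simp add: span_zero)
    next
      case False
      then show ?thesis using gen[of "Suc k"] that by simp
    qed
    ultimately show "br X w \<in> ?Q \<and> br Y w \<in> ?Q \<and> br H w \<in> ?Q" if "w \<in> ?Q" for w
      using closed XYH_A that by blast
  qed
  have "dim W \<le> card (Vk ` {..n})"
    by (rule dim_le_card) (use QeqW in auto)
  also have "\<dots> \<le> Suc n" using card_image_le[of "{..n}" Vk] by simp
  finally have "N = Suc n" using dimW n(2) by simp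
  then show "c = real N - 1" "W = span (Vk ` {..<N})" "i < N \<Longrightarrow> ff i \<noteq> 0"
    using n QeqW ff_nz by (simp_all add: lessThan_Suc_atMost)
qed

lemma W_polynomial:
  assumes "w \<in> W"
  shows "\<exists>b. \<forall>q\<in>E. x2 w q = (\<Sum>i<N. b i * fst q ^ i)"
proof -
  obtain a where a: "w = (\<Sum>k<N. a k *\<^sub>R Vk k)" using span_family assms W_eq by blast
  have "\<forall>q\<in>E. x2 w q = (\<Sum>i<N. (a i * ff i) * fst q ^ i)" unfolding a by (intro ballI x2_sum_Vk)
  then show ?thesis by (intro exI)
qed

lemma W_surjective:
  obtains w where "w \<in> W" "\<And>q. q \<in> E \<Longrightarrow> push w q = (0, \<Sum>i<N. b i * fst q ^ i)"
proof -
  define w where "w = (\<Sum>i<N. (b i / ff i) *\<^sub>R Vk i)"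
  have wW: "w \<in> W" unfolding w_def by (intro subspace_sum subspace_scale subspace_W Vk_W)
  have "x2 w q = (\<Sum>i<N. b i * fst q ^ i)" if "q \<in> E" for q
    unfolding w_def x2_sum_Vk[OF that] by (rule sum.cong) (simp_all add: ff_nonzero)
  then show thesis using that[OF wW] x1_W[OF wW] by (simp add: prod_eq_iff)
qed

text \<open>An element of \<open>A\<close> is a combination of \<open>X\<close>, \<open>Y\<close>, \<open>H\<close>, \<open>\<tau>\<close> and a polynomial field of \<open>W\<close>. The component
  \<open>\<partial>\<^sub>x\<close> determines the coefficients of \<open>X\<close>, \<open>Y\<close> and \<open>H\<close>, and that of \<open>\<tau>\<close> adjusts \<open>b0\<close>.\<close>

theorem push_algebra: "push ` A = sym_fields N E"
proof -
  obtain \<tau> \<kappa> where \<tau>: "\<tau> \<in> A" "T = span {\<tau>}" "\<kappa> \<noteq> 0"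
    "\<And>q. q \<in> E \<Longrightarrow> push \<tau> q = (0, \<kappa> * snd q)"
    by (rule T_is_scaling) blast
  obtain m where m: "(c + 2) * m = 0"
    "\<And>q. q \<in> E \<Longrightarrow> push Y q = (- (fst q)\<^sup>2, - c * fst q * snd q + m)" by (rule push_Y) blast
  have "c + 2 \<noteq> 0" using weight_eq N2 by simp
  then have pY: "push Y q = (- (fst q)\<^sup>2, - c * fst q * snd q)" if "q \<in> E" for q
    using m that by simp
  have gen: "push (\<alpha> *\<^sub>R X + \<beta> *\<^sub>R Y + \<gamma> *\<^sub>R H + (w + \<delta> *\<^sub>R \<tau>))
      = sym_field N E \<alpha> (-2 * \<gamma>) (- \<beta>) (\<delta> * \<kappa> - (real N - 1) * \<gamma>) b"
    if w: "w \<in> W" and b: "\<And>q. q \<in> E \<Longrightarrow> x2 w q = (\<Sum>i<N. b i * fst q ^ i)" for \<alpha> \<beta> \<gamma> \<delta> w b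
  proof
    fix q
    show "push (\<alpha> *\<^sub>R X + \<beta> *\<^sub>R Y + \<gamma> *\<^sub>R H + (w + \<delta> *\<^sub>R \<tau>)) q
      = sym_field N E \<alpha> (-2 * \<gamma>) (- \<beta>) (\<delta> * \<kappa> - (real N - 1) * \<gamma>) b q"
    proof (cases "q \<in> E")
      case True
      then show ?thesis
        using x1_W[OF w True] b[OF True]
        by (simp add: prod_eq_iff push_add_at push_scale_at can pY pH \<tau> sym_field_def weight_eq algebra_simps)
    qed (simp add: push_outside sym_field_def)
  qed
  show ?thesis
  proof (intro equalityI subsetI)
    fix F assume "F \<in> push ` A"
    then obtain Z where Z: "Z \<in> A" "F = push Z" by auto
    then obtain s r where sr: "s \<in> S" "r \<in> R" "Z = s + r" using ASR by (auto simp: direct_sum_def)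
    obtain w t where wt: "w \<in> W" "t \<in> T" "r = w + t" using sr RWT by (auto simp: direct_sum_def)
    obtain \<delta> where \<delta>: "t = \<delta> *\<^sub>R \<tau>" using wt \<tau>(2) by (auto simp: span_singleton)
    have "s \<in> {s. \<exists>\<alpha> \<beta> \<gamma>. s = \<alpha> *\<^sub>R X + \<beta> *\<^sub>R Y + \<gamma> *\<^sub>R H}"
      using sr(1) unfolding S span_insert
      by (auto simp: span_singleton algebra_simps)
    then obtain \<alpha> \<beta> \<gamma> where s: "s = \<alpha> *\<^sub>R X + \<beta> *\<^sub>R Y + \<gamma> *\<^sub>R H" by blast
    obtain b where "\<And>q. q \<in> E \<Longrightarrow> x2 w q = (\<Sum>i<N. b i * fst q ^ i)" using W_polynomial[OF wt(1)] by blast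
    then show "F \<in> sym_fields N E"
      unfolding Z sr(3) s wt(3) \<delta> using gen[OF wt(1)] by blast
  next
    fix F assume "F \<in> sym_fields N E"
    then obtain a0 a1 a2 b0 b where F: "F = sym_field N E a0 a1 a2 b0 b" by blast
    obtain w where w: "w \<in> W" "\<And>q. q \<in> E \<Longrightarrow> push w q = (0, \<Sum>i<N. b i * fst q ^ i)"
      by (rule W_surjective[of b]) blast
    define \<delta> where "\<delta> = (b0 - (real N - 1) * a1 / 2) / \<kappa>"
    have "F = push (a0 *\<^sub>R X + (- a2) *\<^sub>R Y + (- a1 / 2) *\<^sub>R H + (w + \<delta> *\<^sub>R \<tau>))"
      using gen[OF w(1), of b a0 "- a2" "- a1 / 2" \<delta>] w(2) \<tau>(3) by (simp add: F \<delta>_def)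
    moreover have "a0 *\<^sub>R X + (- a2) *\<^sub>R Y + (- a1 / 2) *\<^sub>R H + (w + \<delta> *\<^sub>R \<tau>) \<in> A"
      by (intro subspace_add subspace_scale A_facts(1) XYH_A \<tau> WA w)
    ultimately show "F \<in> push ` A" by blast
  qed
qed

end

lemma canonical_coordinates_translate:
  assumes can: "canonical_coordinates D \<phi> X V"
  shows "canonical_coordinates D ((\<lambda>p. p + v) \<circ> \<phi>) X V"
    and "q \<in> \<phi> ` D \<Longrightarrow> pushforward D ((\<lambda>p. p + v) \<circ> \<phi>) Z (q + v) = pushforward D \<phi> Z q"
proof -
  interpret chart D \<phi> using can by unfold_locales (simp add: canonical_coordinates_def)
  let ?\<psi> = "(\<lambda>p. p + v) \<circ> \<phi>"
  have im: "?\<psi> ` D = (\<lambda>p. p + v) ` \<phi> ` D" by auto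
  have inj': "inj_on ?\<psi> D" using inj by (auto simp: inj_on_def)
  have inv': "inv_into D ?\<psi> (q + v) = inv_into D \<phi> q" if q: "q \<in> \<phi> ` D" for q
  proof -
    obtain p where p: "p \<in> D" "q = \<phi> p" using q by blast
    have "inv_into D ?\<psi> (?\<psi> p) = p" by (rule inv_into_f_f[OF inj' p(1)])
    then show ?thesis using p by simp
  qed
  have fd: "frechet_derivative ?\<psi> (at p) = frechet_derivative \<phi> (at p)" if "p \<in> D" for p
  proof -
    have "(?\<psi> has_derivative frechet_derivative \<phi> (at p)) (at p)"
      unfolding comp_def
      using has_derivative_add[OF smooth_on_imp_has_derivative[OF smooth that] has_derivative_const[of v]] by simp
    then show ?thesis by (rule frechet_derivative_at[symmetric])
  qed
  have push': "pushforward D ?\<psi> Z (q + v) = pushforward D \<phi> Z q" if q: "q \<in> \<phi> ` D" for q Z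
  proof -
    have "q + v \<in> ?\<psi> ` D" using q by auto
    then show ?thesis using q inv'[OF q] fd[OF inv_into_into[OF q]] by (simp only: pushforward_def if_True)
  qed
  then show "q \<in> \<phi> ` D \<Longrightarrow> pushforward D ((\<lambda>p. p + v) \<circ> \<phi>) Z (q + v) = pushforward D \<phi> Z q" .
  have op: "open (?\<psi> ` D)"
    unfolding im using open_translation[OF open_im, of v] by (simp add: add.commute)
  have sm: "smooth_on (?\<psi> ` D) (inv_into D ?\<psi>)"
  proof (rule smooth_on_cong[OF op])
    show "inv_into D \<phi> (q - v) = inv_into D ?\<psi> q" if "q \<in> ?\<psi> ` D" for q
    proof -
      obtain p where "p \<in> D" "q = \<phi> p + v" using \<open>q \<in> ?\<psi> ` D\<close> by auto
      then show ?thesis using inv'[of "\<phi> p"] by simp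
    qed
    show "smooth_on (?\<psi> ` D) (\<lambda>q. inv_into D \<phi> (q - v))"
      by (rule smooth_on_compose[OF op open_im _ smooth_on_diff[OF op smooth_on_ident[OF op] smooth_on_const] smooth_inv]) auto
  qed
  have "smooth_on D ?\<psi>" unfolding comp_def by (rule smooth_on_add[OF open_D smooth smooth_on_const])
  then have "is_chart D ?\<psi>" using open_D connected_D inj' op sm by (simp add: is_chart_def)
  then show "canonical_coordinates D ?\<psi> X V"
    using can push' unfolding canonical_coordinates_def im by auto
qed

lemma affine_change_translation: "affine_change (\<lambda>p. p + v)"
  unfolding affine_change_def by (rule exI[of _ "\<lambda>p. p"], rule exI[of _ v]) (auto simp: linear_id[unfolded id_def] bij_def inj_on_def)

context sl2_levi
begin

lemma sl2_levi_chartI: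
  "D \<subseteq> U \<Longrightarrow> D \<noteq> {} \<Longrightarrow> canonical_coordinates D \<phi> X V \<Longrightarrow> sl2_levi_chart N U A S R W T X Y H V D \<phi>"
  by unfold_locales (auto simp: canonical_coordinates_def)

text \<open>Over an empty chart domain all fields are zero and the identity serves as the affine change.\<close>

theorem normal_form:
  assumes "D \<subseteq> U" "canonical_coordinates D \<phi> X V"
  obtains \<alpha> where "affine_change \<alpha>" "is_chart D (\<alpha> \<circ> \<phi>)"
    "pushforward D (\<alpha> \<circ> \<phi>) ` A = sym_fields N ((\<alpha> \<circ> \<phi>) ` D)"
proof (cases "D = {}")
  case True
  have "is_chart D ((\<lambda>p. p + 0) \<circ> \<phi>)"
    using canonical_coordinates_translate(1)[OF assms(2), of 0] unfolding canonical_coordinates_def by blast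
  moreover have "pushforward D \<psi> Z = (\<lambda>_. 0)" for \<psi> Z by (simp add: pushforward_def True)
  moreover have "sym_field N {} a0 a1 a2 b0 b = (\<lambda>_. 0)" for a0 a1 a2 b0 b by (simp add: sym_field_def)
  moreover have "A \<noteq> {}" using VA by auto
  ultimately show thesis
    by (intro that[of "\<lambda>p. p + 0"] affine_change_translation) (auto simp: True)
next
  case False
  interpret sl2_levi_chart N U A S R W T X Y H V D \<phi> by (rule sl2_levi_chartI[OF assms(1) False assms(2)])
  obtain a b c where c: "br H V = c *\<^sub>R V" and pH: "\<And>q. q \<in> \<phi> ` D \<Longrightarrow> push H q = (- 2 * fst q + a, - c * snd q + b)"
    by (rule push_H) blast
  have c0: "c \<noteq> 0" by (rule weight_nonzero[OF c pH])
  \<comment> \<open>moves the zero \<open>(a / 2, b / c)\<close> of the expression of \<open>H\<close> to the origin\<close>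
  define v where "v = (- a / 2, - b / c)"
  let ?\<alpha> = "\<lambda>p. p + v"
  have can': "canonical_coordinates D (?\<alpha> \<circ> \<phi>) X V"
    by (rule canonical_coordinates_translate(1)[OF assms(2)])
  interpret t: sl2_levi_chart N U A S R W T X Y H V D "?\<alpha> \<circ> \<phi>"
    by (rule sl2_levi_chartI[OF assms(1) False can'])
  interpret t: sl2_levi_normal N U A S R W T X Y H V D "?\<alpha> \<circ> \<phi>" c
  proof unfold_locales
    show "pushforward D (?\<alpha> \<circ> \<phi>) H q = (- 2 * fst q, - c * snd q)" if "q \<in> (?\<alpha> \<circ> \<phi>) ` D" for q
    proof -
      obtain p where p: "p \<in> D" "q = \<phi> p + v" using \<open>q \<in> (?\<alpha> \<circ> \<phi>) ` D\<close> by auto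
      have "\<phi> p \<in> \<phi> ` D" using p by auto
      then show ?thesis
        using canonical_coordinates_translate(2)[OF assms(2), of "\<phi> p" v H] pH[of "\<phi> p"] p(2) c0
        by (simp add: v_def field_simps)
    qed
  qed (rule c c0)+
  show thesis
    by (rule that[OF affine_change_translation t.chart t.push_algebra])
qed

end

theorem theorem3p4:
  fixes N :: nat and U :: "(real \<times> real) set" and A S R W T :: "vfield set"
    and X Y H V :: vfield
  assumes "N \<ge> 2"
    and "open U"
    and "local_lie_algebra U A"
    and "levi_decomposition U A S R"
    and "S = span {X, Y, H}" and "independent {X, Y, H}"
    and "lie_bracket U X Y = H"
    and "lie_bracket U H X = 2 *\<^sub>R X"
    and "lie_bracket U H Y = (-2) *\<^sub>R Y"
    and "direct_sum R W T"
    and "ad_irreducible U S W" and "dim W = N"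
    and "ad_invariant U S T" and "dim T = 1"
    and "highest_weight_vector U H X W V"
    and "has_rank U R 1"
    and "has_rank U (span {X, V}) 2"
  shows "(\<forall>p\<in>U. dim {Z p | Z. Z \<in> span {X, V}} = 2 \<longrightarrow>
            (\<exists>D \<phi>. p \<in> D \<and> D \<subseteq> U \<and> canonical_coordinates D \<phi> X V))
       \<and> (\<forall>D \<phi>. D \<subseteq> U \<and> canonical_coordinates D \<phi> X V \<longrightarrow>
            (\<exists>\<alpha>. affine_change \<alpha> \<and>
               (let \<psi> = \<alpha> \<circ> \<phi>; D' = \<psi> ` D; A' = pushforward D \<psi> ` A in
                  (N \<ge> 3 \<longrightarrow> A' = symmetry_algebra N D') \<and>
                  (\<forall>\<Omega> f. hypersurface_fun N D' \<Omega> f \<longrightarrow>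
                     (invariant_hypersurface N \<Omega> f A' \<longleftrightarrow> (\<forall>j\<in>\<Omega>. f j = 0))))))"
proof -
  interpret sl2_levi N U A S R W T X Y H V
    by unfold_locales (use assms in \<open>auto simp: levi_decomposition_def\<close>)
  show ?thesis
  proof (intro conjI ballI allI impI)
    fix p assume p: "p \<in> U" and "dim {Z p | Z. Z \<in> span {X, V}} = 2"
    then have det: "fst (X p) * snd (V p) - snd (X p) * fst (V p) \<noteq> 0"
      by (intro dim_span_values_2_imp_det)
    show "\<exists>D \<phi>. p \<in> D \<and> D \<subseteq> U \<and> canonical_coordinates D \<phi> X V"
      by (rule canonical_coordinates_exist[OF U A_vfields[OF XYH_A(1)] A_vfields[OF VA] V_facts(3) p det]) blast
  next
    fix D \<phi> assume "D \<subseteq> U \<and> canonical_coordinates D \<phi> X V"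
    then obtain \<alpha> where \<alpha>: "affine_change \<alpha>" "is_chart D (\<alpha> \<circ> \<phi>)"
      "pushforward D (\<alpha> \<circ> \<phi>) ` A = sym_fields N ((\<alpha> \<circ> \<phi>) ` D)"
      by (elim conjE normal_form) blast
    interpret chart D "\<alpha> \<circ> \<phi>" by unfold_locales (rule \<alpha>(2))
    show "\<exists>\<alpha>. affine_change \<alpha> \<and>
               (let \<psi> = \<alpha> \<circ> \<phi>; D' = \<psi> ` D; A' = pushforward D \<psi> ` A in
                  (N \<ge> 3 \<longrightarrow> A' = symmetry_algebra N D') \<and>
                  (\<forall>\<Omega> f. hypersurface_fun N D' \<Omega> f \<longrightarrow>
                     (invariant_hypersurface N \<Omega> f A' \<longleftrightarrow> (\<forall>j\<in>\<Omega>. f j = 0))))"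
      unfolding Let_def
    proof (intro exI[of _ \<alpha>] conjI impI allI)
      show "affine_change \<alpha>" by (rule \<alpha>(1))
      show "pushforward D (\<alpha> \<circ> \<phi>) ` A = symmetry_algebra N ((\<alpha> \<circ> \<phi>) ` D)" if "N \<ge> 3"
        unfolding \<alpha>(3) symmetry_algebra_eq[OF open_im connected_im that] ..
      show "invariant_hypersurface N \<Omega> f (pushforward D (\<alpha> \<circ> \<phi>) ` A) \<longleftrightarrow> (\<forall>j\<in>\<Omega>. f j = 0)"
        if "hypersurface_fun N ((\<alpha> \<circ> \<phi>) ` D) \<Omega> f" for \<Omega> f
        unfolding \<alpha>(3) by (rule invariant_hypersurface_iff_zero[OF open_im that])
    qed
  qed
qed

end
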